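(* Up to isomorphism there are exactly seven $5$-regular graphs with girth $5$ and diameter $4$ that have order $5^2+5+2=32$. Their automorphism groups have orders $4$, $4$, $10$, $10$, $48$, $64$ and $1920$ respectively.
   Context: Graphs are finite, simple and undirected. The order of a graph is its number of vertices; its diameter is the maximum distance between a pair of its vertices (so a graph of finite diameter is connected); its girth is the length of its smallest circuit. *)

theory Defs
  imports
    "Graph_Theory.Pair_Digraph"
    "Graph_Theory.Digraph_Isomorphism"
    "Graph_Theory.Shortest_Path"
    "HOL-Library.Extended_Nat"
    "HOL-Algebra.Bij"
    "HOL-Algebra.Coset"
begin

text \<open>
  A finite simple undirected graph is a \<^locale>\<open>pair_graph\<close>: a finite, loop-free, symmetric digraph
  without parallel arcs, each edge being represented by its two opposite arcs.
\<close>

text \<open>By symmetry, the out-degree of a vertex is its number of neighbours.\<close>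

definition regular :: "'a pair_pre_digraph \<Rightarrow> nat \<Rightarrow> bool" where
  "regular G k \<longleftrightarrow> (\<forall>v \<in> pverts G. out_degree (with_proj G) v = k)"

text \<open>
  In a symmetric digraph an edge traversed back and forth counts as a
  \<^const>\<open>pre_digraph.cycle\<close> of length 2. The circuits of the undirected graph are the cycles of
  length at least 3. The girth of a forest is \<^term>\<open>\<infinity> :: enat\<close>.
\<close>

definition girth :: "'a pair_pre_digraph \<Rightarrow> enat" where
  "girth G = (INF p \<in> {p. pre_digraph.cycle (with_proj G) p \<and> 3 \<le> length p}. enat (length p))"

text \<open>
  The distance is the shortest-path distance with unit arc weights. It is infinite between vertices
  in different components, so that only connected graphs have finite diameter.
\<close>

definition distance :: "'a pair_pre_digraph \<Rightarrow> 'a \<Rightarrow> 'a \<Rightarrow> ereal" where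
  "distance G u v = wf_digraph.\<mu> (with_proj G) (\<lambda>_. 1) u v"

definition graph_diameter :: "'a pair_pre_digraph \<Rightarrow> ereal" where
  "graph_diameter G = (SUP u \<in> pverts G. SUP v \<in> pverts G. distance G u v)"

text \<open>
  As for \<^const>\<open>AutoGroup\<close>, automorphisms are extensional functions on the vertex set, so that each
  is counted once.
\<close>

definition graph_autos :: "'a pair_pre_digraph \<Rightarrow> ('a \<Rightarrow> 'a) set" where
  "graph_autos G = {f \<in> Bij (pverts G).
     \<forall>u \<in> pverts G. \<forall>v \<in> pverts G. (f u, f v) \<in> parcs G \<longleftrightarrow> (u, v) \<in> parcs G}"

definition graph_AutoGroup :: "'a pair_pre_digraph \<Rightarrow> ('a \<Rightarrow> 'a) monoid" where
  "graph_AutoGroup G = BijGroup (pverts G) \<lparr>carrier := graph_autos G\<rparr>"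

lemma subgroup_graph_autos: "subgroup (graph_autos G) (BijGroup (pverts G))"
proof (rule subgroup.intro)
  show "graph_autos G \<subseteq> carrier (BijGroup (pverts G))"
    by (auto simp: graph_autos_def BijGroup_def)
next
  fix f g
  assume "f \<in> graph_autos G" "g \<in> graph_autos G"
  then show "f \<otimes>\<^bsub>BijGroup (pverts G)\<^esub> g \<in> graph_autos G"
    using Bij_imp_funcset[of g "pverts G"]
    by (auto simp: graph_autos_def BijGroup_def compose_Bij compose_eq Pi_iff)
next
  show "\<one>\<^bsub>BijGroup (pverts G)\<^esub> \<in> graph_autos G"
    by (auto simp: graph_autos_def BijGroup_def id_Bij)
next
  fix f
  assume f: "f \<in> graph_autos G"
  let ?V = "pverts G" and ?g = "inv_into (pverts G) f"
  have B: "f \<in> Bij ?V" and onto: "f ` ?V = ?V"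
    using f by (auto simp: graph_autos_def Bij_def bij_betw_def)
  have "(?g u, ?g v) \<in> parcs G \<longleftrightarrow> (u, v) \<in> parcs G" if "u \<in> ?V" "v \<in> ?V" for u v
  proof -
    have "(f (?g u), f (?g v)) \<in> parcs G \<longleftrightarrow> (?g u, ?g v) \<in> parcs G"
      using f that B by (auto simp: graph_autos_def Bij_inv_into_mem)
    moreover have "f (?g u) = u" "f (?g v) = v"
      using that onto by (auto intro: f_inv_into_f)
    ultimately show ?thesis by simp
  qed
  then show "inv\<^bsub>BijGroup ?V\<^esub> f \<in> graph_autos G"
    using B by (simp add: graph_autos_def inv_BijGroup restrict_inv_into_Bij)
qed

theorem group_graph_AutoGroup: "group (graph_AutoGroup G)"
  by (simp add: graph_AutoGroup_def subgroup.subgroup_is_group subgroup_graph_autos group_BijGroup)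

text \<open>The \<open>k\<close>-regular graphs with girth \<open>g\<close>, diameter \<open>d\<close> and order \<open>n\<close>.\<close>

definition graphs_with :: "nat \<Rightarrow> nat \<Rightarrow> nat \<Rightarrow> nat \<Rightarrow> 'a pair_pre_digraph set" where
  "graphs_with k g d n = {G. pair_graph G \<and> regular G k \<and> girth G = enat g \<and>
     graph_diameter G = ereal (real d) \<and> card (pverts G) = n}"

abbreviation graph_iso :: "'a pair_pre_digraph \<Rightarrow> 'b pair_pre_digraph \<Rightarrow> bool" where
  "graph_iso G H \<equiv> digraph_iso (with_proj G) (with_proj H)"

end

theory Submission
  imports Defs
begin

text \<open>
  Let \<open>u\<close> and \<open>v\<close> be vertices at distance 4 in a graph as in the theorem. Degree 5 and girth 5
  put exactly \<open>1 + 5 + 20 = 26\<close> vertices within distance 2 of \<open>u\<close>. Neither \<open>v\<close> nor any of its five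
  neighbours is one of them, so these six are all the remaining vertices. It follows that each
  neighbour of \<open>v\<close> has a common neighbour with all neighbours of \<open>u\<close> except one
  (\<open>unique_remote_nbr\<close>). Write \<open>a\<^sub>i\<close> for the neighbours of \<open>u\<close> and \<open>b\<^sub>i\<close> for the neighbour of \<open>v\<close> that
  has no common neighbour with \<open>a\<^sub>i\<close>. The other 20 vertices are the cells \<open>(i, j)\<close> with \<open>i \<noteq> j\<close>, where
  \<open>(i, j)\<close> is the common neighbour of \<open>a\<^sub>i\<close> and \<open>b\<^sub>j\<close> (\<open>frame_exists\<close>). So the graph is determined by a
  cubic relation on the 20 cells. That the girth is 5 means that this relation has no
  triangles and no squares, and that a cell and its three neighbours lie in four different rows and
  four different columns (locale \<open>cubic\<close>). Permuting the five indices and exchanging \<open>u\<close> with \<open>v\<close>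
  gives an action of \<open>S\<^sub>5 \<times> Z\<^sub>2\<close> on such relations.

  What remains is a finite search, and the bulk of the work is to make it small enough to be run by
  rewriting. Read as arcs on five points, a cell and its three neighbours have four different tails
  and four different heads, so they form disjoint paths and directed cycles. With the arc of the cell
  itself marked there are only eight such configurations up to symmetry. The search assumes that one
  of them occurs at the cell \<open>(0, 1)\<close> while those treated before occur nowhere. It branches on the
  fact that a cell, which has neighbours in three of the four other rows, has one in any two given
  rows, and likewise for columns. The search trees were found beforehand and are written down as
  certificates. The function \<open>check\<close> follows them, and \<open>check_sound\<close> turns its success into the
  statement that every cubic relation is, up to symmetry, one of eight (\<open>cubic_realises_reps\<close>). Two of
  the eight belong to the same graph, seen from pairs \<open>u\<close>, \<open>v\<close> in different orbits of its automorphism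
  group.

  The labelling also counts isomorphisms. An isomorphism from the graph of a relation \<open>E\<close> to the graph
  of \<open>F\<close> carries \<open>u\<close> and \<open>v\<close> to vertices \<open>x\<close> and \<open>y\<close> at distance 4, and once \<open>x\<close>, \<open>y\<close> and the bijection
  between the neighbours of \<open>u\<close> and of \<open>x\<close> are chosen, the images of all other vertices are
  forced (\<open>frame_unique\<close>). So for each such pair only the 120 bijections have to be tried (\<open>card_isos\<close>).
  This gives the orders of the automorphism groups. They separate the seven graphs except
  for the two pairs of equal orders, which have no isomorphisms between them by the same count.
\<close>

section \<open>Isomorphism, girth and distance in terms of adjacency\<close>

abbreviation adjacent :: "'a pair_pre_digraph \<Rightarrow> 'a \<Rightarrow> 'a \<Rightarrow> bool" where
  "adjacent G x y \<equiv> (x, y) \<in> parcs G"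

text \<open>
  Arcs of a pair digraph are determined by their ends, so that the maps on arcs, heads and tails that
  belong to a digraph isomorphism carry no information.
\<close>

lemma graph_iso_iff:
  assumes "pair_graph G" "pair_graph H"
  shows "graph_iso G H \<longleftrightarrow>
    (\<exists>f. bij_betw f (pverts G) (pverts H) \<and>
      (\<forall>x\<in>pverts G. \<forall>y\<in>pverts G. (f x, f y) \<in> parcs H \<longleftrightarrow> (x, y) \<in> parcs G))"
    (is "_ \<longleftrightarrow> (\<exists>f. ?iso f)")
proof
  interpret G: pair_graph G by fact
  interpret H: pair_graph H by fact
  assume "graph_iso G H"
  then obtain h where h: "G.digraph_isomorphism h" and H: "with_proj H = app_iso h (with_proj G)"
    unfolding digraph_iso_def by blast
  have V: "pverts H = iso_verts h ` pverts G" and A: "parcs H = iso_arcs h ` parcs G"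
    and ends: "iso_tail h = fst" "iso_head h = snd"
    using H by (simp_all add: with_proj_def app_iso_def)
  have inj: "inj_on (iso_verts h) (pverts G)" using h by (simp add: G.digraph_isomorphism_def)
  have arc: "iso_arcs h (x, y) = (iso_verts h x, iso_verts h y)" if "(x, y) \<in> parcs G" for x y
  proof -
    have "\<forall>a\<in>parcs G. iso_verts h (fst a) = fst (iso_arcs h a) \<and> iso_verts h (snd a) = snd (iso_arcs h a)"
      using h unfolding G.digraph_isomorphism_def with_proj_simps ends by blast
    from bspec[OF this that] show ?thesis by (metis fst_conv snd_conv prod.collapse)
  qed
  have "(iso_verts h x, iso_verts h y) \<in> parcs H \<longleftrightarrow> (x, y) \<in> parcs G"
    if xy: "x \<in> pverts G" "y \<in> pverts G" for x y
  proof
    assume "(iso_verts h x, iso_verts h y) \<in> parcs H"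
    then obtain x' y' where *: "(x', y') \<in> parcs G"
      "(iso_verts h x, iso_verts h y) = (iso_verts h x', iso_verts h y')"
      unfolding A using arc by fastforce
    then have "x = x'" "y = y'"
      using inj xy G.wellformed'[OF *(1)] by (auto dest: inj_onD)
    with * show "(x, y) \<in> parcs G" by simp
  next
    assume "(x, y) \<in> parcs G"
    then show "(iso_verts h x, iso_verts h y) \<in> parcs H"
      unfolding A using arc by force
  qed
  then show "\<exists>f. ?iso f" using inj V by (auto simp: bij_betw_def)
next
  interpret G: pair_graph G by fact
  interpret H: pair_graph H by fact
  assume "\<exists>f. ?iso f"
  then obtain f where bij: "bij_betw f (pverts G) (pverts H)"
    and f: "\<And>x y. x \<in> pverts G \<Longrightarrow> y \<in> pverts G \<Longrightarrow> (f x, f y) \<in> parcs H \<longleftrightarrow> (x, y) \<in> parcs G"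
    by blast
  have inj: "inj_on f (pverts G)" and V: "f ` pverts G = pverts H"
    using bij by (auto simp: bij_betw_def)
  define h where "h = \<lparr>iso_verts = f, iso_arcs = map_prod f f, iso_head = snd, iso_tail = fst\<rparr>"
  have "parcs H \<subseteq> map_prod f f ` parcs G"
  proof (rule subrelI)
    fix x y assume xy: "(x, y) \<in> parcs H"
    then obtain x' y' where "x' \<in> pverts G" "y' \<in> pverts G" "x = f x'" "y = f y'"
      using H.wellformed'[OF xy] unfolding V[symmetric] by blast
    with xy f show "(x, y) \<in> map_prod f f ` parcs G" by (force simp: map_prod_def)
  qed
  moreover have "map_prod f f ` parcs G \<subseteq> parcs H"
    using f G.wellformed' by (auto simp: map_prod_def)
  ultimately have "with_proj H = app_iso h (with_proj G)"
    using V by (auto simp: with_proj_def app_iso_def h_def)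
  moreover have "inj_on (map_prod f f) (parcs G)"
    using inj G.wellformed' by (auto simp: inj_on_def)
  then have "G.digraph_isomorphism h"
    using inj G.wf_digraph_axioms by (simp add: G.digraph_isomorphism_def h_def)
  ultimately show "graph_iso G H" unfolding digraph_iso_def by blast
qed

lemma girth_le:
  assumes "pre_digraph.cycle (with_proj G) p" "3 \<le> length p"
  shows "girth G \<le> enat (length p)"
  unfolding girth_def using assms by (intro INF_lower) auto

text \<open>
  Excluding circuits of length 3 and 4 in terms of adjacency is what all later arguments use; a
  square is excluded in the form that two vertices have at most one common neighbour.
\<close>

lemma girth_5_iff:
  fixes G :: "'a pair_pre_digraph"
  assumes "pair_graph G"
  defines "adj \<equiv> \<lambda>x y. (x, y) \<in> parcs G"
  shows "girth G = 5 \<longleftrightarrow>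
    (\<forall>x y z. adj x y \<longrightarrow> adj y z \<longrightarrow> \<not> adj x z) \<and>
    (\<forall>x y z w. adj x y \<longrightarrow> adj y z \<longrightarrow> adj x w \<longrightarrow> adj w z \<longrightarrow> x \<noteq> z \<longrightarrow> y = w) \<and>
    (\<exists>p. pre_digraph.cycle (with_proj G) p \<and> length p = 5)" (is "_ \<longleftrightarrow> ?T \<and> ?Q \<and> ?P")
proof -
  interpret pair_graph G by fact
  have sym: "adj y x" if "adj x y" for x y using that arcs_symmetric by (simp add: adj_def)
  have irr: "x \<noteq> y" if "adj x y" for x y using that no_loops' by (simp add: adj_def)
  have inV: "x \<in> pverts G" if "adj x y" for x y using that wellformed' by (simp add: adj_def)
  have three: "girth G \<le> 3" if "adj x y" "adj y z" "adj x z" for x y z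
  proof -
    have "cycle [(x, y), (y, z), (z, x)]"
      unfolding cycle_def using that sym[OF that(3)] irr inV
      by (intro exI[of _ x]) (auto simp: awalk_def adj_def)
    from girth_le[OF this] show ?thesis by (simp add: numeral_eq_enat eval_nat_numeral)
  qed
  have four: "girth G \<le> 4" if "adj x y" "adj y z" "adj x w" "adj w z" "x \<noteq> z" "y \<noteq> w" for x y z w
  proof -
    have "cycle [(x, y), (y, z), (z, w), (w, x)]"
      unfolding cycle_def using that sym[OF that(3)] sym[OF that(4)] irr inV
      by (intro exI[of _ x]) (auto simp: awalk_def adj_def)
    from girth_le[OF this] show ?thesis by (simp add: numeral_eq_enat eval_nat_numeral)
  qed
  show ?thesis
  proof
    assume g: "girth G = 5"
    have "\<not> (5 :: enat) \<le> 3" "\<not> (5 :: enat) \<le> 4" by simp_all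
    then have no: "\<not> girth G \<le> 3" "\<not> girth G \<le> 4" unfolding g by simp_all
    have ?T using three no(1) by blast
    moreover have ?Q using four no(2) by blast
    moreover let ?L = "(\<lambda>p. enat (length p)) ` {p. cycle p \<and> 3 \<le> length p}"
    have "?L \<noteq> {}"
    proof
      assume "?L = {}"
      then have "girth G = \<infinity>" by (simp only: girth_def Inf_empty top_enat_def)
      then show False using g by simp
    qed
    then have "girth G \<in> ?L" unfolding girth_def Inf_enat_def by (auto intro: LeastI)
    then have "?P" using g by (auto simp: numeral_eq_enat)
    ultimately show "?T \<and> ?Q \<and> ?P" by blast
  next
    assume *: "?T \<and> ?Q \<and> ?P"
    have "enat 5 \<le> enat (length p)" if p: "cycle p" "3 \<le> length p" for p
    proof (rule ccontr)
      assume "\<not> enat 5 \<le> enat (length p)"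
      then have "length p = 3 \<or> length p = 4" using p by auto
      then show False
      proof
        assume "length p = 3"
        then obtain a b c where "p = [a, b, c]" by (auto simp: numeral_3_eq_3 length_Suc_conv)
        then obtain x y z where "adj x y" "adj y z" "adj z x"
          using p(1) unfolding cycle_def adj_def awalk_def by (cases a; cases b; cases c) auto
        then show False using * sym by blast
      next
        assume "length p = 4"
        then obtain a b c d where "p = [a, b, c, d]" by (auto simp: eval_nat_numeral length_Suc_conv)
        then obtain x y z w where "adj x y" "adj y z" "adj z w" "adj w x" "x \<noteq> z" "y \<noteq> w"
          using p(1) unfolding cycle_def adj_def awalk_def
          by (cases a; cases b; cases c; cases d) auto
        then show False using * sym by blast
      qed
    qed
    then have "enat 5 \<le> girth G" unfolding girth_def by (intro INF_greatest) auto
    moreover obtain p where "cycle p" "length p = 5" using * by blast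
    then have "girth G \<le> enat 5" using girth_le[of G p] by simp
    ultimately show "girth G = 5" by (simp add: numeral_eq_enat)
  qed
qed

text \<open>
  Distance at least 4, without reference to walks.
\<close>

definition remote :: "('a \<Rightarrow> 'a \<Rightarrow> bool) \<Rightarrow> 'a \<Rightarrow> 'a \<Rightarrow> bool" where
  "remote adj u v \<longleftrightarrow> u \<noteq> v \<and> \<not> adj u v \<and> (\<forall>x. adj u x \<longrightarrow> \<not> adj x v) \<and>
    (\<forall>x y. adj u x \<longrightarrow> adj x y \<longrightarrow> \<not> adj y v)"

lemma (in pair_graph) distance_le:
  assumes "awalk u p v" shows "distance G u v \<le> length p"
proof -
  have "awalk_cost (\<lambda>_. 1) p = length p" for p by (induction p) (auto simp: awalk_cost_def)
  then show ?thesis using min_cost_le_walk_cost[OF assms, of "\<lambda>_. 1"] by (simp add: distance_def)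
qed

lemma (in pair_graph) distance_ge:
  assumes "\<And>p. awalk u p v \<Longrightarrow> n \<le> length p" shows "n \<le> distance G u v"
proof -
  have "awalk_cost (\<lambda>_. 1) p = length p" for p by (induction p) (auto simp: awalk_cost_def)
  then show ?thesis using assms unfolding distance_def \<mu>_def by (intro INF_greatest) auto
qed

lemma (in pair_graph) remote_iff_distance:
  assumes "u \<in> pverts G" "v \<in> pverts G"
  shows "remote (\<lambda>x y. (x, y) \<in> parcs G) u v \<longleftrightarrow> 4 \<le> distance G u v"
proof
  assume r: "remote (\<lambda>x y. (x, y) \<in> parcs G) u v"
  have "4 \<le> length p" if "awalk u p v" for p
  proof (rule ccontr)
    assume "\<not> 4 \<le> length p"
    then consider "p = []" | a where "p = [a]" | a b where "p = [a, b]" | a b c where "p = [a, b, c]"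
      by (cases p; cases "tl p"; cases "tl (tl p)"; cases "tl (tl (tl p))") auto
    then show False using that r 
      by cases (auto simp: awalk_def remote_def)
  qed
  then show "4 \<le> distance G u v" using distance_ge[of u v 4] by simp
next
  assume d: "4 \<le> distance G u v"
  have walk: "4 \<le> length p" if "awalk u p v" for p
    using order_trans[OF d distance_le[OF that]] by simp
  have "\<not> awalk u [] v" "\<not> awalk u [(u, v)] v" "\<not> awalk u [(u, x), (x, v)] v"
    "\<not> awalk u [(u, x), (x, y), (y, v)] v" for x y
    using walk[of "[]"] walk[of "[(u, v)]"] walk[of "[(u, x), (x, v)]"]
      walk[of "[(u, x), (x, y), (y, v)]"] by auto
  then show "remote (\<lambda>x y. (x, y) \<in> parcs G) u v"
    using assms arcs_symmetric unfolding remote_def awalk_def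
    by (simp add: in_arcsD1 in_arcsD2)
qed

text \<open>
  Automorphisms of an arbitrary relation, in order to compare the automorphism groups of graphs
  with those of the relation on labels introduced below.
\<close>

definition rel_autos :: "'a set \<Rightarrow> ('a \<Rightarrow> 'a \<Rightarrow> bool) \<Rightarrow> ('a \<Rightarrow> 'a) set" where
  "rel_autos V R = {f \<in> extensional V. bij_betw f V V \<and> (\<forall>x\<in>V. \<forall>y\<in>V. R (f x) (f y) \<longleftrightarrow> R x y)}"

lemma finite_rel_autos: "finite V \<Longrightarrow> finite (rel_autos V R)"
proof -
  assume V: "finite V"
  have "rel_autos V R \<subseteq> V \<rightarrow>\<^sub>E V" by (auto simp: rel_autos_def PiE_def bij_betw_def)
  then show ?thesis using finite_PiE[OF V V] finite_subset by blast
qed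

lemma card_rel_autos_le:
  assumes "finite V'" and f: "bij_betw f V V'" and g: "bij_betw g V' V"
    and gf: "\<And>x. x \<in> V \<Longrightarrow> g (f x) = x" and fg: "\<And>y. y \<in> V' \<Longrightarrow> f (g y) = y"
    and R: "\<And>x y. x \<in> V \<Longrightarrow> y \<in> V \<Longrightarrow> S (f x) (f y) \<longleftrightarrow> R x y"
  shows "card (rel_autos V R) \<le> card (rel_autos V' S)"
proof (rule card_inj_on_le)
  let ?c = "\<lambda>h. restrict (\<lambda>y. f (h (g y))) V'"
  have fV: "f x \<in> V'" if "x \<in> V" for x using f that by (auto simp: bij_betw_def)
  have gW: "g y \<in> V" if "y \<in> V'" for y using g that by (auto simp: bij_betw_def)
  show "inj_on ?c (rel_autos V R)"
  proof (rule inj_onI)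
    fix h k assume h: "h \<in> rel_autos V R" and k: "k \<in> rel_autos V R" and eq: "?c h = ?c k"
    show "h = k"
    proof (rule extensionalityI[of _ V])
      show "h x = k x" if x: "x \<in> V" for x
      proof -
        have "h x \<in> V" "k x \<in> V" using h k x by (auto simp: rel_autos_def bij_betw_def)
        moreover have "f (h x) = f (k x)" using fun_cong[OF eq, of "f x"] x by (simp add: fV gf)
        ultimately show ?thesis using gf by metis
      qed
    qed (use h k in \<open>auto simp: rel_autos_def\<close>)
  qed
  show "?c ` rel_autos V R \<subseteq> rel_autos V' S"
  proof
    fix c assume "c \<in> ?c ` rel_autos V R"
    then obtain h where h: "h \<in> rel_autos V R" and c: "c = ?c h" by blast
    have hV: "bij_betw h V V" "\<And>x. x \<in> V \<Longrightarrow> h x \<in> V" using h by (auto simp: rel_autos_def bij_betw_def)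
    have "bij_betw (f \<circ> (h \<circ> g)) V' V'" using bij_betw_trans[OF bij_betw_trans[OF g hV(1)] f] by (simp add: comp_assoc)
    then have "bij_betw c V' V'" unfolding c by (simp add: comp_def cong: bij_betw_cong)
    moreover have "S (c x) (c y) \<longleftrightarrow> S x y" if "x \<in> V'" "y \<in> V'" for x y
    proof -
      have "S (c x) (c y) \<longleftrightarrow> R (h (g x)) (h (g y))" using that by (simp add: c R hV gW)
      also have "\<dots> \<longleftrightarrow> R (g x) (g y)" using h that gW by (simp add: rel_autos_def)
      also have "\<dots> \<longleftrightarrow> S x y" using R[of "g x" "g y"] that by (simp add: gW fg)
      finally show ?thesis .
    qed
    ultimately show "c \<in> rel_autos V' S" by (simp add: rel_autos_def c)
  qed
  show "finite (rel_autos V' S)" using finite_rel_autos assms(1) .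
qed

lemma card_rel_autos_eq:
  assumes V: "finite V" and f: "bij_betw f V V'"
    and R: "\<And>x y. x \<in> V \<Longrightarrow> y \<in> V \<Longrightarrow> S (f x) (f y) \<longleftrightarrow> R x y"
  shows "card (rel_autos V R) = card (rel_autos V' S)"
proof (rule antisym)
  define g where "g = the_inv_into V f"
  have g: "bij_betw g V' V" unfolding g_def using f by (rule bij_betw_the_inv_into)
  have gf: "g (f x) = x" if "x \<in> V" for x
    using f that by (simp add: g_def bij_betw_def the_inv_into_f_f)
  have fg: "f (g y) = y" if "y \<in> V'" for y
    using f that by (simp add: g_def f_the_inv_into_f_bij_betw)
  have V': "finite V'" using V f bij_betw_finite by blast
  show "card (rel_autos V R) \<le> card (rel_autos V' S)"
    by (rule card_rel_autos_le[OF V' f g]) (simp_all add: gf fg R)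
  have "R (g x) (g y) \<longleftrightarrow> S x y" if "x \<in> V'" "y \<in> V'" for x y
    using R[of "g x" "g y"] that g fg by (auto simp: bij_betw_def)
  then show "card (rel_autos V' S) \<le> card (rel_autos V R)"
    by (intro card_rel_autos_le[OF V g f]) (simp_all add: gf fg)
qed

lemma order_AutoGroup: "order (graph_AutoGroup G) = card (rel_autos (pverts G) (adjacent G))"
proof -
  have "graph_autos G = rel_autos (pverts G) (adjacent G)"
    by (auto simp: graph_autos_def rel_autos_def Bij_def)
  then show ?thesis by (simp add: order_def graph_AutoGroup_def)
qed

lemma order_AutoGroup_iso:
  assumes "pair_graph G" "pair_graph H" "graph_iso G H"
  shows "order (graph_AutoGroup G) = order (graph_AutoGroup H)"
proof -
  interpret pair_graph G by fact
  obtain f where "bij_betw f (pverts G) (pverts H)"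
    "\<forall>x\<in>pverts G. \<forall>y\<in>pverts G. (f x, f y) \<in> parcs H \<longleftrightarrow> (x, y) \<in> parcs G"
    using assms by (auto simp: graph_iso_iff)
  then show ?thesis unfolding order_AutoGroup
    by (intro card_rel_autos_eq[OF pair_finite_verts]) auto
qed

section \<open>Graphs with 32 vertices, degree 5 and no short circuits\<close>

text \<open>
  The Moore bound for degree 5 and girth 5 is 26; these graphs have six vertices more.
\<close>

locale near_moore =
  fixes V :: "'a set" and adj :: "'a \<Rightarrow> 'a \<Rightarrow> bool"
  assumes finite_V: "finite V" and card_V: "card V = 32"
    and adj_V: "adj x y \<Longrightarrow> x \<in> V"
    and sym: "adj x y \<Longrightarrow> adj y x"
    and irrefl: "\<not> adj x x"
    and degree: "x \<in> V \<Longrightarrow> card {y. adj x y} = 5"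
    and no_triangle: "adj x y \<Longrightarrow> adj y z \<Longrightarrow> \<not> adj x z"
    and no_square: "adj x y \<Longrightarrow> adj y z \<Longrightarrow> adj x w \<Longrightarrow> adj w z \<Longrightarrow> x \<noteq> z \<Longrightarrow> y = w"
begin

lemma adj_V': "adj x y \<Longrightarrow> y \<in> V"
  using adj_V sym by blast

lemma finite_nbrs: "finite {y. adj x y}"
  using finite_subset[OF _ finite_V, of "{y. adj x y}"] adj_V' by blast

definition ball2 :: "'a \<Rightarrow> 'a set" where
  "ball2 x = insert x ({y. adj x y} \<union> (\<Union>y\<in>{y. adj x y}. {z. adj y z} - {x}))"

lemma ball2_subset: "x \<in> V \<Longrightarrow> ball2 x \<subseteq> V"
  using adj_V' by (auto simp: ball2_def)

lemma card_ball2: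
  assumes "x \<in> V" shows "card (ball2 x) = 26"
proof -
  let ?N = "{y. adj x y}" and ?M = "\<lambda>y. {z. adj y z} - {x}"
  have "card (?M y) = 4" if "y \<in> ?N" for y
    using that sym finite_nbrs adj_V' by (simp add: degree)
  moreover have "?M y \<inter> ?M z = {}" if "y \<in> ?N" "z \<in> ?N" "y \<noteq> z" for y z
    using that no_square sym by blast
  ultimately have "card (\<Union>y\<in>?N. ?M y) = 20"
    using finite_nbrs degree[OF assms] by (subst card_UN_disjoint) auto
  moreover have "?N \<inter> (\<Union>y\<in>?N. ?M y) = {}" using no_triangle by blast
  ultimately have "card (?N \<union> (\<Union>y\<in>?N. ?M y)) = 25"
    using finite_nbrs degree[OF assms] by (subst card_Un_disjoint) auto
  then show ?thesis unfolding ball2_def using irrefl finite_nbrs by (subst card_insert_disjoint) auto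
qed

text \<open>
  Two disjoint balls of radius 2 would need 52 vertices. Hence the diameter of such a graph is
  at most 4 and the graph is connected.
\<close>

lemma ball2_meet:
  assumes "x \<in> V" "y \<in> V" shows "ball2 x \<inter> ball2 y \<noteq> {}"
proof
  assume "ball2 x \<inter> ball2 y = {}"
  then have "card (ball2 x \<union> ball2 y) = 52"
    using assms card_ball2 finite_subset[OF ball2_subset finite_V] by (subst card_Un_disjoint) auto
  moreover have "card (ball2 x \<union> ball2 y) \<le> 32"
    using assms ball2_subset card_mono[OF finite_V] card_V by (metis Un_subset_iff)
  ultimately show False by simp
qed

end

lemma regular_iff: "regular G k \<longleftrightarrow> (\<forall>v\<in>pverts G. card {w. adjacent G v w} = k)"
proof -
  have "out_arcs (with_proj G) v = Pair v ` {w. adjacent G v w}" for v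
    by (auto simp: out_arcs_def)
  then have "out_degree (with_proj G) v = card {w. adjacent G v w}" for v
    by (simp add: out_degree_def card_image inj_on_def)
  then show ?thesis by (simp add: regular_def)
qed

lemma graphs_with_D:
  assumes "G \<in> graphs_with 5 5 4 (5^2 + 5 + 2)"
  shows "near_moore (pverts G) (adjacent G)"
    and "\<exists>u\<in>pverts G. \<exists>v\<in>pverts G. remote (adjacent G) u v"
proof -
  have G: "pair_graph G" and reg: "regular G 5" and girth: "girth G = 5"
    and diam: "graph_diameter G = 4" and card: "card (pverts G) = 32"
    using assms by (simp_all add: graphs_with_def numeral_eq_enat)
  interpret pair_graph G by fact
  note no_short = girth[unfolded girth_5_iff[OF G]]
  show "near_moore (pverts G) (adjacent G)"
  proof
    show "finite (pverts G)" by (rule pair_finite_verts)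
    show "card (pverts G) = 32" by (rule card)
    show "\<not> adjacent G x x" for x using no_loops' by blast
    show "card {y. adjacent G x y} = 5" if "x \<in> pverts G" for x
      using reg that by (simp add: regular_iff)
    show "\<not> adjacent G x z" if "adjacent G x y" "adjacent G y z" for x y z
      using no_short that by blast
    show "y = w" if "adjacent G x y" "adjacent G y z" "adjacent G x w" "adjacent G w z" "x \<noteq> z" for x y z w
      using no_short that by blast
  qed (auto intro: wellformed' arcs_symmetric)
  show "\<exists>u\<in>pverts G. \<exists>v\<in>pverts G. remote (adjacent G) u v"
  proof (rule ccontr)
    assume "\<not> ?thesis"
    then have near: "\<exists>p. awalk u p v \<and> length p \<le> 3" if "u \<in> pverts G" "v \<in> pverts G" for u v
      using that distance_ge[of u v 4] remote_iff_distance[OF that] by force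
    have "distance G u v \<le> 3" if uv: "u \<in> pverts G" "v \<in> pverts G" for u v
    proof -
      obtain p where p: "awalk u p v" "length p \<le> 3" using near[OF uv] by blast
      have "distance G u v \<le> length p" using p(1) by (rule distance_le)
      also have "\<dots> \<le> 3" using p(2) by simp
      finally show ?thesis .
    qed
    then have "graph_diameter G \<le> 3" unfolding graph_diameter_def by (intro SUP_least)
    with diam show False by simp
  qed
qed

lemma graphs_with_I:
  fixes G :: "'a pair_pre_digraph"
  assumes G: "pair_graph G" and "near_moore (pverts G) (adjacent G)"
    and uv: "u \<in> pverts G" "v \<in> pverts G" "remote (adjacent G) u v"
    and p: "pre_digraph.cycle (with_proj G) p" "length p = 5"
  shows "G \<in> graphs_with 5 5 4 (5^2 + 5 + 2)"
proof -
  interpret pair_graph G by fact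
  interpret M: near_moore "pverts G" "adjacent G" by fact
  have "girth G = 5"
    unfolding girth_5_iff[OF G] using p M.no_triangle M.no_square by blast
  moreover have "distance G x y \<le> 4" if xy: "x \<in> pverts G" "y \<in> pverts G" for x y
  proof -
    have walk: "\<exists>p. awalk x p z \<and> length p \<le> 2" if "x \<in> pverts G" "z \<in> M.ball2 x" for x z
    proof -
      consider "z = x" | "adjacent G x z" | y where "adjacent G x y" "adjacent G y z"
        using \<open>z \<in> M.ball2 x\<close> unfolding M.ball2_def by blast
      then show ?thesis
      proof cases
        case 1 then show ?thesis using that by (intro exI[of _ "[]"]) (simp add: awalk_def)
      next
        case 2 then show ?thesis using that
          by (intro exI[of _ "[(x, z)]"]) (simp add: awalk_def)
      next
        case 3 then show ?thesis using that
          by (intro exI[of _ "[(x, y), (y, z)]"]) (simp add: awalk_def)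
      qed
    qed
    obtain z where "z \<in> M.ball2 x" "z \<in> M.ball2 y" using M.ball2_meet[OF xy] by blast
    then obtain p q where p: "awalk x p z" "length p \<le> 2" and q: "awalk y q z" "length q \<le> 2"
      using walk xy by metis
    have len: "length (rev_path r) = length r" for r :: "('a \<times> 'a) list" by (induction r) auto
    have "awalk x (p @ rev_path q) y" using p q by (simp add: awalk_appendI)
    then have "distance G x y \<le> length (p @ rev_path q)" by (rule distance_le)
    also have "\<dots> \<le> 4" using p q by (simp add: len)
    finally show ?thesis .
  qed
  then have "graph_diameter G \<le> 4" unfolding graph_diameter_def by (intro SUP_least)
  moreover have "4 \<le> distance G u v" using uv by (simp add: remote_iff_distance)
  then have "4 \<le> graph_diameter G"
    unfolding graph_diameter_def using uv by (intro SUP_upper2[of u] SUP_upper2[of v])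
  ultimately show ?thesis
    using G M.degree M.card_V by (simp add: graphs_with_def regular_iff numeral_eq_enat antisym)
qed

section \<open>Labelling such a graph from two vertices at distance 4\<close>

datatype pt = P0 | P1 | P2 | P3 | P4

lemma UNIV_pt: "UNIV = {P0, P1, P2, P3, P4}"
  by (auto intro: pt.exhaust)

instance pt :: finite
  by standard (simp add: UNIV_pt)

lemma card_pt: "card (UNIV :: pt set) = 5"
  by (simp add: UNIV_pt)

type_synonym cell = "pt \<times> pt"

text \<open>
  \<open>U\<close> and \<open>W\<close> stand for the two vertices at distance 4, \<open>A i\<close> and \<open>B i\<close> for their neighbours, and
  \<open>C i j\<close> for the common neighbour of \<open>A i\<close> and \<open>B j\<close>. As \<open>A i\<close> and \<open>B i\<close> have none, \<open>C i i\<close> is not used;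
  \<open>labels\<close> leaves it out.
\<close>

datatype label = U | W | A pt | B pt | C pt pt

definition labels :: "label set" where
  "labels = {U, W} \<union> range A \<union> range B \<union> (\<lambda>(i, j). C i j) ` {(i, j). i \<noteq> j}"

lemma mem_labels [simp]: "U \<in> labels" "W \<in> labels" "A i \<in> labels" "B i \<in> labels"
  "C i j \<in> labels \<longleftrightarrow> i \<noteq> j"
  by (auto simp: labels_def)

lemma finite_labels: "finite labels"
  by (simp add: labels_def)

lemma card_labels: "card labels = 32"
proof -
  have off: "{(i, j). i \<noteq> j} = (UNIV :: cell set) - range (\<lambda>i. (i, i))" by auto
  have "card {(i :: pt, j). i \<noteq> j} = 20"
    unfolding off by (subst card_Diff_subset) (auto simp: card_image inj_on_def card_pt card_cartesian_product simp flip: UNIV_Times_UNIV)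
  then have C: "card ((\<lambda>(i, j). C i j) ` {(i, j). i \<noteq> j}) = 20"
    by (subst card_image) (auto simp: inj_on_def)
  have AB: "card (range A) = 5" "card (range B) = 5"
    by (simp_all add: card_image inj_on_def card_pt)
  have "card ({U, W} \<union> range A) = 7" by (subst card_Un_disjoint) (auto simp: AB)
  then have "card ({U, W} \<union> range A \<union> range B) = 12" by (subst card_Un_disjoint) (auto simp: AB)
  then show ?thesis unfolding labels_def by (subst card_Un_disjoint) (auto simp: C)
qed

text \<open>
  The first eight equations describe the edges forced by the labelling, so \<open>label_adj (\<lambda>_ _. False)\<close> is
  the skeleton common to all these graphs.
\<close>

fun label_adj :: "(cell \<Rightarrow> cell \<Rightarrow> bool) \<Rightarrow> label \<Rightarrow> label \<Rightarrow> bool" where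
  "label_adj E U (A i) = True" | "label_adj E (A i) U = True"
| "label_adj E W (B i) = True" | "label_adj E (B i) W = True"
| "label_adj E (A i) (C k l) = (i = k \<and> k \<noteq> l)" | "label_adj E (C k l) (A i) = (i = k \<and> k \<noteq> l)"
| "label_adj E (B i) (C k l) = (i = l \<and> k \<noteq> l)" | "label_adj E (C k l) (B i) = (i = l \<and> k \<noteq> l)"
| "label_adj E (C i j) (C k l) = E (i, j) (k, l)"
| "label_adj E _ _ = False"

fun apart :: "cell \<Rightarrow> cell \<Rightarrow> bool" where
  "apart (i, j) (k, l) = (if i = k then False else j \<noteq> l)"

lemma apart_iff: "apart x y \<longleftrightarrow> fst x \<noteq> fst y \<and> snd x \<noteq> snd y"
  by (cases x; cases y) auto

text \<open>
  These are exactly the conditions on the cells under which \<open>label_adj E\<close> has degree 5 and no circuits of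
  length 3 or 4. Two adjacent cells in the same row \<open>i\<close> would form a triangle with \<open>A i\<close>, and two
  neighbours of a cell in the same row would form a square.
\<close>

locale cubic =
  fixes E :: "cell \<Rightarrow> cell \<Rightarrow> bool"
  assumes sym: "E x y \<Longrightarrow> E y x"
    and off_diag: "E x y \<Longrightarrow> fst x \<noteq> snd x"
    and apart: "E x y \<Longrightarrow> apart x y"
    and nbrs_apart: "E x y \<Longrightarrow> E x z \<Longrightarrow> y \<noteq> z \<Longrightarrow> apart y z"
    and no_triangle: "E x y \<Longrightarrow> E y z \<Longrightarrow> \<not> E x z"
    and no_square: "E x y \<Longrightarrow> E y z \<Longrightarrow> E x w \<Longrightarrow> E w z \<Longrightarrow> x \<noteq> z \<Longrightarrow> y = w"
    and three: "fst x \<noteq> snd x \<Longrightarrow> card {y. E x y} = 3"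

lemma remote_sym:
  assumes "\<And>x y. adj x y \<Longrightarrow> adj y x" and "remote adj u v" shows "remote adj v u"
  using assms unfolding remote_def by metis

context near_moore begin

text \<open>
  The ball around \<open>u\<close> leaves out only \<open>v\<close> and its neighbours. So the four neighbours of \<open>b\<close> other than
  \<open>v\<close> are at distance 2 from \<open>u\<close>, and no two of them have the same parent among the neighbours of
  \<open>u\<close>, since this parent and \<open>b\<close> would then have two common neighbours. Thus \<open>b\<close> has a common
  neighbour with four of the five neighbours of \<open>u\<close>.
\<close>

lemma unique_remote_nbr:
  assumes u: "u \<in> V" and v: "v \<in> V" and far: "remote adj u v" and b: "adj v b"
  shows "\<exists>!a. adj u a \<and> \<not> (\<exists>c. adj a c \<and> adj b c)"
proof -
  let ?N = "\<lambda>x. {y. adj x y}"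
  have N: "finite (?N x)" for x by (rule finite_nbrs)
  have "insert v (?N v) \<subseteq> V - ball2 u"
    using far sym v adj_V' unfolding remote_def ball2_def by blast
  moreover have "card (insert v (?N v)) = 6" using N irrefl degree[OF v] by simp
  moreover have "card (V - ball2 u) = 6"
    using card_ball2[OF u] ball2_subset[OF u] finite_subset[OF ball2_subset[OF u] finite_V]
    by (simp add: card_Diff_subset card_V)
  ultimately have rest: "insert v (?N v) = V - ball2 u"
    using finite_V by (intro card_subset_eq) auto
  have parent: "\<exists>a. adj u a \<and> adj a c" if "c \<in> ?N b - {v}" for c
  proof -
    have "c \<notin> insert v (?N v)" using that no_triangle[OF b] by blast
    then have "c \<in> ball2 u" using rest that adj_V' by blast
    moreover have "c \<noteq> u" "\<not> adj u c" using that far sym b unfolding remote_def by blast+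
    ultimately show ?thesis by (auto simp: ball2_def)
  qed
  then obtain par where par: "\<And>c. c \<in> ?N b - {v} \<Longrightarrow> adj u (par c) \<and> adj (par c) c" by metis
  have "inj_on par (?N b - {v})"
  proof (rule inj_onI)
    fix c d assume c: "c \<in> ?N b - {v}" and d: "d \<in> ?N b - {v}" and eq: "par c = par d"
    have "par c \<noteq> b" using par[OF c] b far sym unfolding remote_def by blast
    then show "c = d"
      using no_square[of "par c" c b d] par[OF c] par[OF d] c d eq sym by auto
  qed
  moreover have "b \<in> V" using b adj_V' by blast
  ultimately have "card (par ` (?N b - {v})) = 4"
    using b sym N by (simp add: card_image degree)
  moreover have "{a \<in> ?N u. \<exists>c. adj a c \<and> adj b c} = par ` (?N b - {v})"
  proof (intro equalityI subsetI)
    fix a assume "a \<in> {a \<in> ?N u. \<exists>c. adj a c \<and> adj b c}"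
    then obtain c where c: "adj u a" "adj a c" "adj b c" by blast
    then have "c \<noteq> v" using far unfolding remote_def by blast
    then have "c \<in> ?N b - {v}" using c by blast
    moreover have "u \<noteq> c" using c(3) b far sym unfolding remote_def by blast
    then have "a = par c" using no_square[of u a c "par c"] c par[OF \<open>c \<in> ?N b - {v}\<close>] by blast
    ultimately show "a \<in> par ` (?N b - {v})" by blast
  qed (use par sym in blast)
  ultimately have "card {a \<in> ?N u. \<exists>c. adj a c \<and> adj b c} = 4" by simp
  then have "card (?N u - {a \<in> ?N u. \<exists>c. adj a c \<and> adj b c}) = 1"
    using N degree[OF u] by (subst card_Diff_subset) auto
  moreover have "?N u - {a \<in> ?N u. \<exists>c. adj a c \<and> adj b c} = {a. adj u a \<and> \<not> (\<exists>c. adj a c \<and> adj b c)}"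
    by blast
  ultimately have "card {a. adj u a \<and> \<not> (\<exists>c. adj a c \<and> adj b c)} = 1" by (simp only:)
  then obtain x where x: "{a. adj u a \<and> \<not> (\<exists>c. adj a c \<and> adj b c)} = {x}"
    by (rule card_1_singletonE)
  have "adj u a \<and> \<not> (\<exists>c. adj a c \<and> adj b c) \<longleftrightarrow> a = x" for a
    using arg_cong[OF x, of "\<lambda>S. a \<in> S"] by simp
  then show ?thesis by simp
qed

definition frame :: "(label \<Rightarrow> 'a) \<Rightarrow> bool" where
  "frame p \<longleftrightarrow> bij_betw p labels V \<and>
    (\<forall>x\<in>labels. \<forall>y\<in>labels. label_adj (\<lambda>_ _. False) x y \<longrightarrow> adj (p x) (p y))"

text \<open>
  The enumeration \<open>a\<close> of the neighbours of \<open>u\<close> is at the caller's disposal; the count of isomorphisms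
  relies on this freedom.
\<close>

lemma frame_exists:
  assumes u: "u \<in> V" and v: "v \<in> V" and far: "remote adj u v"
    and a: "bij_betw a UNIV {y. adj u y}"
  obtains p where "frame p" "p U = u" "p W = v" "\<And>i. p (A i) = a i"
proof -
  have far': "remote adj v u" using remote_sym[OF sym far] .
  have ua: "adj u (a i)" for i using a by (auto simp: bij_betw_def)
  have inj_a: "a i = a j \<longleftrightarrow> i = j" for i j using a by (auto simp: bij_betw_def inj_on_def)
  have "\<exists>b. adj v b \<and> \<not> (\<exists>c. adj (a i) c \<and> adj b c)" for i
    using unique_remote_nbr[OF v u far' ua, of i] by blast
  then obtain b where vb: "\<And>i. adj v (b i)" and miss: "\<And>i. \<not> (\<exists>c. adj (a i) c \<and> adj (b i) c)"
    by metis
  have uniq: "i = j" if "\<not> (\<exists>c. adj (a i) c \<and> adj (b j) c)" for i j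
    using unique_remote_nbr[OF u v far vb, of j] miss[of j] that ua inj_a by metis
  have "\<exists>c. adj (a i) c \<and> adj (b j) c" if "i \<noteq> j" for i j using uniq that by blast
  then obtain c where c: "\<And>i j. i \<noteq> j \<Longrightarrow> adj (a i) (c i j) \<and> adj (b j) (c i j)" by metis
  have inj_b: "b i = b j \<longleftrightarrow> i = j" for i j using uniq miss by metis
  define p where "p x = (case x of U \<Rightarrow> u | W \<Rightarrow> v | A i \<Rightarrow> a i | B i \<Rightarrow> b i | C i j \<Rightarrow> c i j)" for x
  have p [simp]: "p U = u" "p W = v" "p (A i) = a i" "p (B i) = b i" "p (C i j) = c i j" for i j
    by (simp_all add: p_def)
  have ne: "u \<noteq> v" "u \<noteq> a i" "v \<noteq> b i" "u \<noteq> b i" "v \<noteq> a i" "a i \<noteq> b j" for i j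
    using far ua[of i] vb[of i] vb[of j] irrefl sym unfolding remote_def by metis+
  have cne: "c i j \<noteq> u" "c i j \<noteq> v" "c i j \<noteq> a k" "c i j \<noteq> b k" if "i \<noteq> j" for i j k
  proof -
    show "c i j \<noteq> u" using c[OF that] vb[of j] far sym unfolding remote_def by metis
    show "c i j \<noteq> v" using c[OF that] ua[of i] far sym unfolding remote_def by metis
    show "c i j \<noteq> a k" using c[OF that] no_triangle[OF ua[of i], of "a k"] ua[of k] by metis
    show "c i j \<noteq> b k" using c[OF that] no_triangle[OF vb[of j], of "b k"] vb[of k] by metis
  qed
  have cc: "i = k \<and> j = l" if "i \<noteq> j" "k \<noteq> l" "c i j = c k l" for i j k l
  proof -
    have "a i = a k"
      using no_square[OF ua[of i] _ ua[of k], of "c i j"] c[OF that(1)] c[OF that(2)] that cne(1) by metis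
    moreover have "b j = b l"
      using no_square[OF vb[of j] _ vb[of l], of "c i j"] c[OF that(1)] c[OF that(2)] that cne(2) by metis
    ultimately show ?thesis by (simp add: inj_a inj_b)
  qed
  have inj: "inj_on p labels"
  proof (rule inj_onI)
    fix x y assume xy: "x \<in> labels" "y \<in> labels" "p x = p y"
    note [simp] = ne ne[symmetric] cne cne[symmetric] inj_a inj_b
    show "x = y" using xy by (cases x; cases y) (simp_all, use cc in blast)
  qed
  have "p ` labels \<subseteq> V"
    using u v adj_V'[OF ua] adj_V'[OF vb] adj_V'[OF conjunct1[OF c]] by (auto simp: labels_def)
  then have "p ` labels = V"
    using inj finite_V card_V by (intro card_subset_eq) (auto simp: card_image card_labels)
  with inj have bij: "bij_betw p labels V" by (simp add: bij_betw_def)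
  have "adj (p x) (p y)" if "x \<in> labels" "y \<in> labels" "label_adj (\<lambda>_ _. False) x y" for x y
    using that ua vb c sym by (cases x; cases y) auto
  with bij have "frame p" by (simp add: frame_def)
  then show thesis using that by simp
qed

lemma frameD:
  assumes "frame p"
  shows "bij_betw p labels V"
    and "x \<in> labels \<Longrightarrow> y \<in> labels \<Longrightarrow> label_adj (\<lambda>_ _. False) x y \<Longrightarrow> adj (p x) (p y)"
    and "x \<in> labels \<Longrightarrow> y \<in> labels \<Longrightarrow> p x = p y \<longleftrightarrow> x = y"
    and "x \<in> labels \<Longrightarrow> p x \<in> V"
  using assms by (auto simp: frame_def bij_betw_def inj_on_def)

definition induced :: "(label \<Rightarrow> 'a) \<Rightarrow> cell \<Rightarrow> cell \<Rightarrow> bool" where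
  "induced p = (\<lambda>(i, j) (k, l). i \<noteq> j \<and> k \<noteq> l \<and> adj (p (C i j)) (p (C k l)))"

lemma frame_nbrs:
  assumes p: "frame p" and x: "x \<in> labels"
    and T: "T \<subseteq> labels" "card T = 5" "\<And>y. y \<in> T \<Longrightarrow> adj (p x) (p y)"
  shows "{y. adj (p x) y} = p ` T"
proof -
  have "finite T" using T(2) by (metis card.infinite zero_neq_numeral)
  moreover have "inj_on p T" using frameD(1)[OF p] T(1) by (auto simp: bij_betw_def intro: inj_on_subset)
  ultimately have "card (p ` T) = 5" using T(2) by (simp add: card_image)
  moreover have "card {y. adj (p x) y} = 5" using degree frameD(4)[OF p x] by simp
  ultimately show ?thesis using T(3) finite_nbrs by (intro card_subset_eq[symmetric]) auto
qed

text \<open>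
  Apart from the cells, every vertex has five neighbours in the skeleton already.
\<close>

lemma frame_nbrs_tree:
  assumes p: "frame p"
  shows "{y. adj (p U) y} = p ` range A" "{y. adj (p W) y} = p ` range B"
    "{y. adj (p (A i)) y} = p ` insert U (C i ` (- {i}))"
    "{y. adj (p (B i)) y} = p ` insert W ((\<lambda>j. C j i) ` (- {i}))"
proof -
  have *: "card (- {i}) = 4" for i :: pt by (simp add: Compl_eq_Diff_UNIV card_Diff_subset card_pt)
  show "{y. adj (p U) y} = p ` range A"
    by (rule frame_nbrs[OF p]) (auto intro: frameD(2)[OF p] simp: card_image inj_on_def card_pt)
  show "{y. adj (p W) y} = p ` range B"
    by (rule frame_nbrs[OF p]) (auto intro: frameD(2)[OF p] simp: card_image inj_on_def card_pt)
  have "card (insert U (C i ` (- {i}))) = 5"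
    by (subst card_insert_disjoint) (auto simp: card_image inj_on_def *)
  then show "{y. adj (p (A i)) y} = p ` insert U (C i ` (- {i}))"
    by (intro frame_nbrs[OF p]) (auto intro: frameD(2)[OF p])
  have "card (insert W ((\<lambda>j. C j i) ` (- {i}))) = 5"
    by (subst card_insert_disjoint) (auto simp: card_image inj_on_def *)
  then show "{y. adj (p (B i)) y} = p ` insert W ((\<lambda>j. C j i) ` (- {i}))"
    by (intro frame_nbrs[OF p]) (auto intro: frameD(2)[OF p])
qed

lemma frame_adj:
  assumes p: "frame p" and x: "x \<in> labels" and y: "y \<in> labels"
  shows "adj (p x) (p y) \<longleftrightarrow> label_adj (induced p) x y"
proof -
  have tree: "adj (p x) (p y) \<longleftrightarrow> label_adj (induced p) x y"
    if "x \<in> labels" "y \<in> labels" "\<And>i j. x \<noteq> C i j" for x y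
  proof -
    have eq: "p y = p z \<longleftrightarrow> y = z" if "z \<in> labels" for z
      using frameD(3)[OF p \<open>y \<in> labels\<close> that] by simp
    have im: "p y \<in> p ` T \<longleftrightarrow> y \<in> T" if "T \<subseteq> labels" for T
      using that eq by blast
    have "adj (p x) (p y) \<longleftrightarrow> p y \<in> {y. adj (p x) y}" by simp
    also have "\<dots> \<longleftrightarrow> label_adj (induced p) x y"
    proof (cases x)
      case U then show ?thesis
        unfolding U frame_nbrs_tree(1)[OF p] by (subst im) (auto, cases y, auto)
    next
      case W then show ?thesis
        unfolding W frame_nbrs_tree(2)[OF p] by (subst im) (auto, cases y, auto)
    next
      case (A i) then show ?thesis
        unfolding A frame_nbrs_tree(3)[OF p] using \<open>y \<in> labels\<close>
        by (subst im) (auto, cases y, auto)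
    next
      case (B i) then show ?thesis
        unfolding B frame_nbrs_tree(4)[OF p] using \<open>y \<in> labels\<close>
        by (subst im) (auto, cases y, auto)
    next
      case (C i j) then show ?thesis using that(3) by simp
    qed
    finally show ?thesis .
  qed
  have gsym: "label_adj (induced p) x y \<longleftrightarrow> label_adj (induced p) y x" for x y
    using sym by (cases x; cases y) (auto simp: induced_def)
  show ?thesis
  proof (cases "(\<exists>i j. x = C i j) \<and> (\<exists>k l. y = C k l)")
    case True
    then show ?thesis using x y by (auto simp: induced_def)
  next
    case False
    then show ?thesis using tree x y gsym sym by metis
  qed
qed

text \<open>
  Degrees and short circuits of the graph, read off at the cells. A cell has two of its five
  neighbours in the skeleton.
\<close>

lemma frame_cubic:
  assumes p: "frame p" shows "cubic (induced p)"
proof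
  let ?E = "induced p"
  show "?E y x" if "?E x y" for x y using that sym by (auto simp: induced_def split: prod.splits)
  show "fst x \<noteq> snd x" if "?E x y" for x y using that by (auto simp: induced_def split: prod.splits)
  note [simp] = frameD(3)[OF p]
  show "apart x y" if xy: "?E x y" for x y
  proof (cases x; cases y)
    fix i j k l assume [simp]: "x = (i, j)" "y = (k, l)"
    have E: "i \<noteq> j" "k \<noteq> l" "adj (p (C i j)) (p (C k l))" using xy by (auto simp: induced_def)
    have "adj (p (A i)) (p (C i j))" "adj (p (A k)) (p (C k l))"
      "adj (p (B j)) (p (C i j))" "adj (p (B l)) (p (C k l))"
      using E by (auto intro: frameD(2)[OF p])
    then have "i \<noteq> k" "j \<noteq> l" using no_triangle E(3) by blast+
    then show ?thesis by simp
  qed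
  show "apart y z" if xy: "?E x y" and xz: "?E x z" and "y \<noteq> z" for x y z
  proof (cases x; cases y; cases z)
    fix i j k l m n assume [simp]: "x = (i, j)" "y = (k, l)" "z = (m, n)"
    have E: "i \<noteq> j" "k \<noteq> l" "adj (p (C i j)) (p (C k l))" "m \<noteq> n" "adj (p (C i j)) (p (C m n))"
      using xy xz by (auto simp: induced_def)
    have *: "adj (p (C k l)) (p (A k))" "adj (p (C m n)) (p (A m))"
      "adj (p (C k l)) (p (B l))" "adj (p (C m n)) (p (B n))"
      using E by (auto intro: frameD(2)[OF p])
    have "k \<noteq> m"
    proof
      assume "k = m"
      then have "p (C k l) = p (C m n)"
        using no_square[OF E(3) *(1) E(5)] *(2) E(1) by simp
      then show False using \<open>y \<noteq> z\<close> E by simp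
    qed
    moreover have "l \<noteq> n"
    proof
      assume "l = n"
      then have "p (C k l) = p (C m n)"
        using no_square[OF E(3) *(3) E(5)] *(4) E(1) by simp
      then show False using \<open>y \<noteq> z\<close> E by simp
    qed
    ultimately show ?thesis by simp
  qed
  show "\<not> ?E x z" if "?E x y" "?E y z" for x y z
    using that no_triangle by (auto simp: induced_def split: prod.splits)
  show "y = w" if "?E x y" "?E y z" "?E x w" "?E w z" "x \<noteq> z" for x y z w
  proof -
    obtain i j k l m n r s where [simp]: "x = (i, j)" "y = (k, l)" "z = (m, n)" "w = (r, s)"
      by (metis surj_pair)
    have "p (C k l) = p (C r s)"
      using that by (intro no_square[of "p (C i j)" _ "p (C m n)"]) (auto simp: induced_def)
    then show ?thesis using that by (auto simp: induced_def)
  qed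
  show "card {y. ?E x y} = 3" if "fst x \<noteq> snd x" for x
  proof (cases x)
    fix i j assume [simp]: "x = (i, j)"
    have "i \<noteq> j" using that by simp
    let ?S = "(\<lambda>(k, l). C k l) ` {y. ?E x y}"
    have S: "finite ?S" by simp
    have "{y. adj (p (C i j)) y} = p ` {y \<in> labels. label_adj ?E (C i j) y}"
    proof -
      have "{y. adj (p (C i j)) y} \<subseteq> p ` labels"
        using adj_V' frameD(1)[OF p] by (auto simp: bij_betw_def)
      then have "{y. adj (p (C i j)) y} = p ` {y \<in> labels. adj (p (C i j)) (p y)}" by blast
      then show ?thesis using frame_adj[OF p, of "C i j"] \<open>i \<noteq> j\<close> by (simp cong: conj_cong)
    qed
    also have "{y \<in> labels. label_adj ?E (C i j) y} = insert (A i) (insert (B j) ?S)"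
    proof (rule Set.set_eqI)
      fix y
      show "y \<in> {y \<in> labels. label_adj ?E (C i j) y} \<longleftrightarrow> y \<in> insert (A i) (insert (B j) ?S)"
        using \<open>i \<noteq> j\<close> by (cases y) (auto simp: induced_def image_iff)
    qed
    finally have "{y. adj (p (C i j)) y} = p ` insert (A i) (insert (B j) ?S)" .
    moreover have "card {y. adj (p (C i j)) y} = 5"
      using \<open>i \<noteq> j\<close> by (intro degree frameD(4)[OF p]) simp
    ultimately have "card (p ` insert (A i) (insert (B j) ?S)) = 5" by (simp only:)
    moreover have "inj_on p (insert (A i) (insert (B j) ?S))"
      using frameD(1)[OF p] unfolding bij_betw_def
      by (elim conjE, elim inj_on_subset) (auto simp: induced_def)
    then have "card (p ` insert (A i) (insert (B j) ?S)) = card (insert (A i) (insert (B j) ?S))"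
      by (rule card_image)
    ultimately have "card (insert (A i) (insert (B j) ?S)) = 5" by (simp only:)
    moreover have "A i \<notin> insert (B j) ?S" "B j \<notin> ?S" by auto
    ultimately have "card ?S = 3" using S by simp
    then show ?thesis by (subst (asm) card_image) (auto simp: inj_on_def)
  qed
qed

end

section \<open>The graph of a cubic relation and its symmetries\<close>

text \<open>
  The converse of \<open>frame_cubic\<close>: every cubic relation yields a graph of the kind considered.
\<close>

lemma (in cubic) near_moore: "near_moore labels (label_adj E)"
proof
  have apart': "i \<noteq> k" "j \<noteq> l" if "E (i, j) (k, l)" for i j k l
    using apart[OF that] by (auto simp: apart_iff)
  have row: "l = n" if "E x (k, l)" "E x (k, n)" for x k l n
    using nbrs_apart[OF that] by (auto simp: apart_iff)
  have col: "k = m" if "E x (k, l)" "E x (m, l)" for x k l m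
    using nbrs_apart[OF that] by (auto simp: apart_iff)
  have off: "i \<noteq> j" "k \<noteq> l" if "E (i, j) (k, l)" for i j k l
    using off_diag[OF that] off_diag[OF sym[OF that]] by auto
  show "finite labels" "card labels = 32" by (rule finite_labels card_labels)+
  show "x \<in> labels" if "label_adj E x y" for x y
    using that off by (cases x; cases y) auto
  show gsym: "label_adj E y x" if "label_adj E x y" for x y
    using that sym by (cases x; cases y) auto
  show "\<not> label_adj E x x" for x using apart' by (cases x) auto
  show "\<not> label_adj E x z" if "label_adj E x y" "label_adj E y z" for x y z
    using that by (cases x; cases y; cases z) (simp_all, (use apart' no_triangle in blast)+)
  show "card {y. label_adj E x y} = 5" if "x \<in> labels" for x
  proof -
    have *: "card (- {i}) = 4" for i :: pt by (simp add: Compl_eq_Diff_UNIV card_Diff_subset card_pt)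
    have count: "card {y. label_adj E x y} = 5" if "card T = 5" "\<And>y. label_adj E x y \<longleftrightarrow> y \<in> T" for T
      using that by simp
    show ?thesis
    proof (cases x)
      case U
      have "label_adj E x y \<longleftrightarrow> y \<in> range A" for y unfolding U by (cases y) auto
      then show ?thesis by (rule count[rotated]) (simp add: card_image inj_on_def card_pt)
    next
      case W
      have "label_adj E x y \<longleftrightarrow> y \<in> range B" for y unfolding W by (cases y) auto
      then show ?thesis by (rule count[rotated]) (simp add: card_image inj_on_def card_pt)
    next
      case (A i)
      have "label_adj E x y \<longleftrightarrow> y \<in> insert U (C i ` (- {i}))" for y unfolding A by (cases y) auto
      then show ?thesis
        by (rule count[rotated]) (subst card_insert_disjoint, auto simp: card_image inj_on_def *)
    next
      case (B i)
      have "label_adj E x y \<longleftrightarrow> y \<in> insert W ((\<lambda>j. C j i) ` (- {i}))" for y unfolding B by (cases y) auto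
      then show ?thesis
        by (rule count[rotated]) (subst card_insert_disjoint, auto simp: card_image inj_on_def *)
    next
      case (C i j)
      let ?S = "(\<lambda>(k, l). C k l) ` {y. E (i, j) y}"
      have "i \<noteq> j" using that C by simp
      then have "label_adj E x y \<longleftrightarrow> y \<in> insert (A i) (insert (B j) ?S)" for y
        unfolding C by (cases y) (auto simp: image_iff)
      moreover have "card ?S = 3" using three[of "(i, j)"] \<open>i \<noteq> j\<close>
        by (subst card_image) (auto simp: inj_on_def)
      moreover have "A i \<notin> insert (B j) ?S" "B j \<notin> ?S" by auto
      ultimately show ?thesis by (intro count[of "insert (A i) (insert (B j) ?S)"]) simp_all
    qed
  qed
  show "y = w" if *: "label_adj E x y" "label_adj E y z" "label_adj E x w" "label_adj E w z" "x \<noteq> z" for x y z w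
  proof -
    have cell: "y = w" if "x = C i j" "label_adj E x y" "label_adj E y z" "label_adj E x w" "label_adj E w z" "x \<noteq> z"
      for x y z w i j
    proof (cases z)
      case U with that show ?thesis by (cases y; cases w) auto
    next
      case W with that show ?thesis by (cases y; cases w) auto
    next
      case (A k) with that show ?thesis
        by (cases y; cases w) (simp_all, (use row in blast)+)
    next
      case (B k) with that show ?thesis
        by (cases y; cases w) (simp_all, (use col in blast)+)
    next
      case (C k l)
      have row': "i \<noteq> k" if "E (i, j) e" "E e (k, l)" for e
        using nbrs_apart[OF sym[OF that(1)] that(2)] \<open>x \<noteq> z\<close> C \<open>x = _\<close> by (auto simp: apart_iff)
      have col': "j \<noteq> l" if "E (i, j) e" "E e (k, l)" for e
        using nbrs_apart[OF sym[OF that(1)] that(2)] \<open>x \<noteq> z\<close> C \<open>x = _\<close> by (auto simp: apart_iff)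
      have "i \<noteq> k \<or> j \<noteq> l" using \<open>x \<noteq> z\<close> C \<open>x = _\<close> by auto
      then show ?thesis using that(2-5) unfolding C \<open>x = _\<close>
        by (cases y; cases w) (simp_all, (use row' col' no_square in blast)+)
    qed
    consider i j where "x = C i j" | k l where "z = C k l"
      | "\<And>i j. x \<noteq> C i j" "\<And>k l. z \<noteq> C k l" by metis
    then show ?thesis
    proof cases
      case 1 then show ?thesis using cell * by blast
    next
      case 2 then show ?thesis using cell[of z _ _ y x w] * gsym by blast
    next
      case 3 then show ?thesis using * by (cases x; cases z; cases y; cases w) auto
    qed
  qed
qed

fun relabel :: "(pt \<Rightarrow> pt) \<Rightarrow> label \<Rightarrow> label" where
  "relabel s U = U" | "relabel s W = W" | "relabel s (A i) = A (s i)"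
| "relabel s (B i) = B (s i)" | "relabel s (C i j) = C (s i) (s j)"

fun mirror :: "label \<Rightarrow> label" where
  "mirror U = W" | "mirror W = U" | "mirror (A i) = B i" | "mirror (B i) = A i"
| "mirror (C i j) = C j i"

lemma bij_relabel: assumes "bij s" shows "bij_betw (relabel s) labels labels"
proof -
  have s: "s i = s j \<longleftrightarrow> i = j" for i j using assms by (simp add: bij_def inj_eq)
  have "inj_on (relabel s) labels"
  proof (rule inj_onI)
    fix x y show "relabel s x = relabel s y \<Longrightarrow> x = y"
      by (cases x; cases y) (simp_all add: s)
  qed
  moreover have "relabel s x \<in> labels" if "x \<in> labels" for x
    using that by (cases x) (simp_all add: s)
  then have "relabel s ` labels \<subseteq> labels" by blast
  ultimately show ?thesis using finite_labels by (simp add: bij_betw_def endo_inj_surj)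
qed

lemma bij_mirror: "bij_betw mirror labels labels"
proof -
  have "mirror (mirror x) = x" for x by (cases x) simp_all
  moreover have "mirror x \<in> labels \<longleftrightarrow> x \<in> labels" for x by (cases x) auto
  ultimately show ?thesis by (intro bij_betwI[where g = mirror]) auto
qed

text \<open>
  The action of \<open>S\<^sub>5 \<times> Z\<^sub>2\<close> on cells.
\<close>

inductive symmetry :: "(cell \<Rightarrow> cell) \<Rightarrow> bool" where
  keep: "bij s \<Longrightarrow> symmetry (\<lambda>(i, j). (s i, s j))"
| flip: "bij s \<Longrightarrow> symmetry (\<lambda>(i, j). (s j, s i))"

lemma symmetry_comp: "symmetry f \<Longrightarrow> symmetry g \<Longrightarrow> symmetry (\<lambda>x. f (g x))"
proof -
  have 1: "bij (\<lambda>i. s (t i))" if "bij s" "bij t" for s t :: "pt \<Rightarrow> pt"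
    using bij_comp[OF that(2,1)] by (simp add: comp_def)
  assume "symmetry f" "symmetry g"
  then show ?thesis
    by cases (erule symmetry.cases; use 1 symmetry.intros in \<open>force simp: case_prod_unfold\<close>)+
qed

context near_moore begin

lemma frame_relabel:
  assumes p: "frame p" and s: "bij s" shows "frame (\<lambda>x. p (relabel s x))"
proof -
  have s': "s i = s j \<longleftrightarrow> i = j" for i j using s by (simp add: bij_def inj_eq)
  have "adj (p (relabel s x)) (p (relabel s y))"
    if "x \<in> labels" "y \<in> labels" "label_adj (\<lambda>_ _. False) x y" for x y
    using that by (intro frameD(2)[OF p]; cases x; cases y) (auto simp: s')
  then show ?thesis
    using bij_betw_trans[OF bij_relabel[OF s] frameD(1)[OF p]] by (simp add: frame_def comp_def)
qed

lemma frame_mirror: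
  assumes p: "frame p" shows "frame (\<lambda>x. p (mirror x))"
proof -
  have "adj (p (mirror x)) (p (mirror y))"
    if "x \<in> labels" "y \<in> labels" "label_adj (\<lambda>_ _. False) x y" for x y
    using that by (intro frameD(2)[OF p]; cases x; cases y) auto
  then show ?thesis
    using bij_betw_trans[OF bij_mirror frameD(1)[OF p]] by (simp add: frame_def comp_def)
qed

lemma frame_symmetry:
  assumes p: "frame p" and f: "symmetry f"
  obtains q where "frame q" "induced q = (\<lambda>x y. induced p (f x) (f y))"
  using f
proof cases
  case (keep s)
  then have "s i = s j \<longleftrightarrow> i = j" for i j by (simp add: bij_def inj_eq)
  then show ?thesis using that[OF frame_relabel[OF p keep(2)]] keep
    by (simp add: induced_def fun_eq_iff split: prod.splits)
next
  case (flip s)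
  then have "s i = s j \<longleftrightarrow> i = j" for i j by (simp add: bij_def inj_eq)
  then show ?thesis using that[OF frame_mirror[OF frame_relabel[OF p flip(2)]]] that[OF frame_relabel[OF frame_mirror[OF p] flip(2)]] flip
    by (auto simp: induced_def fun_eq_iff split: prod.splits)
qed

end

text \<open>
  Instead of checking the axioms one by one: the identity is a frame of the graph of \<open>E\<close>, moving it by
  a symmetry gives another frame, and a frame induces a cubic relation.
\<close>

lemma cubic_symmetry:
  assumes E: "cubic E" and f: "symmetry f" shows "cubic (\<lambda>x y. E (f x) (f y))"
proof -
  interpret cubic E by fact
  interpret near_moore labels "label_adj E" by (rule near_moore)
  have "frame id"
  proof -
    have "label_adj E x y" if "label_adj (\<lambda>_ _. False) x y" for x y using that by (cases x; cases y) auto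
    then show ?thesis by (simp add: frame_def)
  qed
  moreover have "induced id = E" using off_diag off_diag[OF cubic.sym[OF E]]
    by (force simp: induced_def fun_eq_iff)
  ultimately show ?thesis using f frame_symmetry frame_cubic by metis
qed

section \<open>Checking a search tree\<close>

text \<open>
  Everything from here on is evaluated by rewriting with code equations. This is fast enough only if
  a lookup is a single rewrite step and comparisons are cheap, hence five-element tuples indexed by a
  datatype of five constants instead of lists indexed by numbers. Conjunctions are written as nested
  conditionals because rewriting evaluates both sides of a conjunction.
\<close>

datatype 'a five = Five 'a 'a 'a 'a 'a

fun entry :: "'a five \<Rightarrow> pt \<Rightarrow> 'a" where
  "entry (Five a b c d e) P0 = a" | "entry (Five a b c d e) P1 = b" | "entry (Five a b c d e) P2 = c"
| "entry (Five a b c d e) P3 = d" | "entry (Five a b c d e) P4 = e"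

fun put :: "'a five \<Rightarrow> pt \<Rightarrow> 'a \<Rightarrow> 'a five" where
  "put (Five a b c d e) P0 x = Five x b c d e" | "put (Five a b c d e) P1 x = Five a x c d e"
| "put (Five a b c d e) P2 x = Five a b x d e" | "put (Five a b c d e) P3 x = Five a b c x e"
| "put (Five a b c d e) P4 x = Five a b c d x"

lemma entry_put [simp]: "entry (put t i x) j = (if i = j then x else entry t j)"
  by (cases t; cases i; cases j) simp_all

type_synonym table = "cell list five five"

fun get :: "table \<Rightarrow> cell \<Rightarrow> cell list" where
  "get t (i, j) = entry (entry t i) j"

fun add :: "cell \<Rightarrow> cell \<Rightarrow> table \<Rightarrow> table" where
  "add (i, j) y t = put t i (put (entry t i) j (y # entry (entry t i) j))"

text \<open>
  A table of neighbour lists represents a set of edges; both ends of an edge are entered.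
\<close>

definition link :: "cell \<Rightarrow> cell \<Rightarrow> table \<Rightarrow> table" where
  "link x y t = add x y (add y x t)"

lemma get_add: "get (add x y t) z = (if x = z then y # get t z else get t z)"
  by (cases x; cases z) auto

lemma get_link:
  "x \<noteq> y \<Longrightarrow> get (link x y t) z = (if x = z then y # get t z else if y = z then x # get t z else get t z)"
  by (auto simp: link_def get_add)

definition empty :: table where
  "empty = (let r = Five [] [] [] [] [] in Five r r r r r)"

lemma get_empty [simp]: "get empty x = []"
  by (cases x; cases "fst x"; cases "snd x") (simp_all add: empty_def Let_def)

declare get.simps [simp del]

definition start :: "cell list \<Rightarrow> table" where
  "start T = foldr (link (P0, P1)) T empty"

definition pts :: "pt list" where "pts = [P0, P1, P2, P3, P4]"

lemma set_pts [simp]: "set pts = UNIV" by (simp add: pts_def UNIV_pt)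

definition cells :: "cell list" where
  "cells = filter (\<lambda>x. fst x \<noteq> snd x) (List.product pts pts)"

lemma set_cells: "set cells = {x. fst x \<noteq> snd x}" by (auto simp: cells_def)

datatype cell_symmetry = Keep pt pt pt pt pt | Flip pt pt pt pt pt

fun act :: "cell_symmetry \<Rightarrow> cell \<Rightarrow> cell" where
  "act (Keep a b c d e) (i, j) = (entry (Five a b c d e) i, entry (Five a b c d e) j)"
| "act (Flip a b c d e) (i, j) = (entry (Five a b c d e) j, entry (Five a b c d e) i)"

fun bijective :: "pt five \<Rightarrow> bool" where
  "bijective (Five a b c d e) = distinct [a, b, c, d, e]"

fun legal :: "cell_symmetry \<Rightarrow> bool" where
  "legal (Keep a b c d e) = bijective (Five a b c d e)"
| "legal (Flip a b c d e) = bijective (Five a b c d e)"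

lemma bijective_iff: "bijective s \<longleftrightarrow> bij (entry s)"
proof -
  have "inj (entry s) \<longleftrightarrow> bijective s"
    by (cases s) (simp add: inj_on_def UNIV_pt, blast)
  moreover have "inj (entry s) \<longleftrightarrow> bij (entry s)"
    by (metis bij_def finite finite_UNIV_inj_surj)
  ultimately show ?thesis by simp
qed

lemma symmetry_act:
  assumes "legal g" shows "symmetry (act g)"
proof (cases g)
  case (Keep a b c d e)
  then have "act g = (\<lambda>(i, j). (entry (Five a b c d e) i, entry (Five a b c d e) j))" by auto
  then show ?thesis using assms Keep by (simp only: symmetry.keep bijective_iff legal.simps)
next
  case (Flip a b c d e)
  then have "act g = (\<lambda>(i, j). (entry (Five a b c d e) j, entry (Five a b c d e) i))" by auto
  then show ?thesis using assms Flip by (simp only: symmetry.flip bijective_iff legal.simps)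
qed

fun mem :: "'a \<Rightarrow> 'a list \<Rightarrow> bool" where
  "mem x [] = False" | "mem x (y # ys) = (if x = y then True else mem x ys)"

fun all_apart :: "cell \<Rightarrow> cell list \<Rightarrow> bool" where
  "all_apart x [] = True" | "all_apart x (y # ys) = (if apart x y then all_apart x ys else False)"

fun short :: "cell list \<Rightarrow> bool" where
  "short [] = True" | "short [x] = True" | "short [x, y] = True" | "short (x # y # z # zs) = False"

fun disj :: "'a list \<Rightarrow> 'a list \<Rightarrow> bool" where
  "disj [] ys = True" | "disj (x # xs) ys = (if mem x ys then False else disj xs ys)"

fun far :: "table \<Rightarrow> cell list \<Rightarrow> cell list \<Rightarrow> bool" where
  "far p [] ys = True"
| "far p (x # xs) ys = (if disj ys (get p x) then far p xs ys else False)"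

lemma mem_iff [simp]: "mem x xs \<longleftrightarrow> x \<in> set xs" by (induction xs) auto
lemma all_apart_iff [simp]: "all_apart x ys \<longleftrightarrow> (\<forall>y\<in>set ys. apart x y)" by (induction ys) auto
lemma disj_iff [simp]: "disj xs ys \<longleftrightarrow> set xs \<inter> set ys = {}" by (induction xs) auto
lemma far_iff [simp]: "far p xs ys \<longleftrightarrow> (\<forall>x\<in>set xs. set ys \<inter> set (get p x) = {})"
  by (induction xs) auto
lemma short_iff [simp]: "short xs \<longleftrightarrow> length xs < 3" by (cases xs rule: short.cases) auto

text \<open>
  Whether the edge between \<open>x\<close> and \<open>y\<close> can be added to the edges in \<open>p\<close> without violating an axiom of
  \<open>cubic\<close>; \<open>q\<close> holds the edges that earlier branches have excluded.
\<close>

definition fits :: "table \<Rightarrow> table \<Rightarrow> cell \<Rightarrow> cell \<Rightarrow> bool" where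
  "fits p q x y =
    (if mem y (get q x) then False
     else if short (get p x) then if short (get p y) then
       if all_apart y (get p x) then if all_apart x (get p y) then
         far p (get p x) (y # get p y)
       else False else False else False else False)"

text \<open>
  \<open>Row i j r s\<close> branches on the neighbour of the cell \<open>(i, j)\<close> in one of the rows \<open>r\<close> and \<open>s\<close>; \<open>Col\<close> does
  the same for columns. The subtrees belong to those candidates, in the order of \<open>in_row\<close> and \<open>in_col\<close>,
  that pass \<open>fits\<close>. The leaves claim that the edges chosen so far contain, up to the given symmetry, an
  excluded configuration around some cell (\<open>Known\<close>) or one of the listed relations (\<open>Found\<close>).
\<close>

datatype cert = Row pt pt pt pt "cert list" | Col pt pt pt pt "cert list" | Known cell_symmetry | Found cell_symmetry

definition in_row :: "pt \<Rightarrow> pt \<Rightarrow> cell list" where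
  "in_row j r = map (\<lambda>c. (r, c)) (filter (\<lambda>c. if c = r then False else c \<noteq> j) pts)"

definition in_col :: "pt \<Rightarrow> pt \<Rightarrow> cell list" where
  "in_col i c = map (\<lambda>r. (r, c)) (filter (\<lambda>r. if r = c then False else r \<noteq> i) pts)"

lemma set_in_row: "set (in_row j r) = {y. fst y = r \<and> fst y \<noteq> snd y \<and> snd y \<noteq> j}"
  by (auto simp: in_row_def)

lemma set_in_col: "set (in_col i c) = {y. snd y = c \<and> fst y \<noteq> snd y \<and> fst y \<noteq> i}"
  by (auto simp: in_col_def)

fun no_row :: "pt \<Rightarrow> cell list \<Rightarrow> bool" where
  "no_row r [] = True" | "no_row r (x # xs) = (if fst x = r then False else no_row r xs)"

fun no_col :: "pt \<Rightarrow> cell list \<Rightarrow> bool" where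
  "no_col c [] = True" | "no_col c (x # xs) = (if snd x = c then False else no_col c xs)"

lemma no_row_iff [simp]: "no_row r xs \<longleftrightarrow> (\<forall>x\<in>set xs. fst x \<noteq> r)" by (induction xs) auto
lemma no_col_iff [simp]: "no_col r xs \<longleftrightarrow> (\<forall>x\<in>set xs. snd x \<noteq> r)" by (induction xs) auto

fun sub_nbrs :: "table \<Rightarrow> cell_symmetry \<Rightarrow> cell \<Rightarrow> cell list \<Rightarrow> bool" where
  "sub_nbrs p g x [] = True"
| "sub_nbrs p g x (y # ys) = (if mem (act g y) (get p (act g x)) then sub_nbrs p g x ys else False)"

lemma sub_nbrs_iff [simp]: "sub_nbrs p g x ys \<longleftrightarrow> (\<forall>y\<in>set ys. act g y \<in> set (get p (act g x)))"
  by (induction ys) auto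

text \<open>
  \<open>R\<close> lists the relations that may be found, and \<open>K\<close> the configurations that may be assumed not to
  occur, each given by the neighbours of the cell \<open>(P0, P1)\<close>. After a branch has been refuted, its edge
  is excluded in the following ones.
\<close>

fun check :: "table list \<Rightarrow> cell list list \<Rightarrow> table \<Rightarrow> table \<Rightarrow> cert \<Rightarrow> bool"
  and check_all :: "table list \<Rightarrow> cell list list \<Rightarrow> table \<Rightarrow> table \<Rightarrow> cell \<Rightarrow> cell list \<Rightarrow> cert list \<Rightarrow> bool"
where
  "check R K p q (Row i j r s cs) =
    (if distinct [j, i] then if distinct [i, r, s] then
      if no_row r (get p (i, j)) then if no_row s (get p (i, j)) then
        check_all R K p q (i, j) (in_row j r @ in_row j s) cs
      else False else False else False else False)"
| "check R K p q (Col i j r s cs) =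
    (if distinct [i, j] then if distinct [j, r, s] then
      if no_col r (get p (i, j)) then if no_col s (get p (i, j)) then
        check_all R K p q (i, j) (in_col i r @ in_col i s) cs
      else False else False else False else False)"
| "check R K p q (Known g) = (if legal g then list_ex (sub_nbrs p g (P0, P1)) K else False)"
| "check R K p q (Found g) =
    (if legal g then list_ex (\<lambda>t. list_all (\<lambda>x. sub_nbrs p g x (get t x)) cells) R else False)"
| "check_all R K p q x [] cs = True"
| "check_all R K p q x (y # ys) cs =
    (if fits p q x y then
      (case cs of [] \<Rightarrow> False
       | c # cs \<Rightarrow> if check R K (link x y p) q c then check_all R K p (link x y q) x ys cs else False)
     else check_all R K p q x ys cs)"

definition realises :: "(cell \<Rightarrow> cell \<Rightarrow> bool) \<Rightarrow> table list \<Rightarrow> bool" where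
  "realises E R \<longleftrightarrow>
    (\<exists>f t. symmetry f \<and> t \<in> set R \<and> (\<forall>x\<in>set cells. \<forall>y\<in>set (get t x). E (f x) (f y)))"

definition avoids :: "(cell \<Rightarrow> cell \<Rightarrow> bool) \<Rightarrow> cell list list \<Rightarrow> bool" where
  "avoids E K \<longleftrightarrow> (\<forall>T\<in>set K. \<forall>f. symmetry f \<longrightarrow> \<not> (\<forall>y\<in>set T. E (f (P0, P1)) (f y)))"

context cubic begin

definition agrees :: "table \<Rightarrow> table \<Rightarrow> bool" where
  "agrees p q \<longleftrightarrow>
    (\<forall>x y. y \<in> set (get p x) \<longrightarrow> E x y \<and> x \<in> set (get p y)) \<and> (\<forall>x. distinct (get p x)) \<and>
    (\<forall>x y. y \<in> set (get q x) \<longrightarrow> \<not> E x y)"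

lemma agrees_link:
  assumes "agrees p q" "E x y" "y \<notin> set (get p x)" shows "agrees (link x y p) q"
proof -
  have "x \<noteq> y" using apart[OF assms(2)] by (auto simp: apart_iff)
  moreover have "x \<notin> set (get p y)" using assms(1,3) unfolding agrees_def by blast
  ultimately show ?thesis using assms sym unfolding agrees_def by (auto simp: get_link)
qed

lemma agrees_unlink:
  assumes "agrees p q" "\<not> E x y" "x \<noteq> y" shows "agrees p (link x y q)"
  using assms sym unfolding agrees_def by (auto simp: get_link)

lemma finite_nbrs: "finite {y. E x y}" by simp

text \<open>
  This is the only place where the axioms of \<open>cubic\<close> prune the search; the clauses branched on come
  from \<open>nbr_in_rows\<close> and \<open>nbr_in_cols\<close>.
\<close>

lemma fits_if_adjacent:
  assumes a: "agrees p q" and E: "E x y" and new: "y \<notin> set (get p x)" shows "fits p q x y"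
proof -
  have pE: "E x y" "x \<in> set (get p y)" if "y \<in> set (get p x)" for x y
    using a that unfolding agrees_def by blast+
  have new': "x \<notin> set (get p y)" using new pE by blast
  have short: "length (get p x) < 3" if "E x y" "y \<notin> set (get p x)" for x y
  proof -
    have "insert y (set (get p x)) \<subseteq> {y. E x y}" using that pE by blast
    then have "card (insert y (set (get p x))) \<le> 3"
      using card_mono[OF finite_nbrs] three[OF off_diag[OF that(1)]] by metis
    moreover have "distinct (get p x)" using a unfolding agrees_def by blast
    ultimately show ?thesis using that(2) by (simp add: distinct_card)
  qed
  have "apart y z" if "z \<in> set (get p x)" for z
    using nbrs_apart[OF E, of z] pE(1)[OF that] that new by metis
  moreover have "apart x z" if "z \<in> set (get p y)" for z
    using nbrs_apart[OF sym[OF E], of z] pE(1)[OF that] that new' by metis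
  moreover have "w \<notin> set (get p z)" if z: "z \<in> set (get p x)" and w: "w \<in> set (y # get p y)" for z w
  proof
    assume wz: "w \<in> set (get p z)"
    show False
    proof (cases "w = y")
      case True then show False using no_triangle[OF pE(1)[OF z] pE(1)[OF wz]] E by simp
    next
      case False
      then have "w \<in> set (get p y)" using w by simp
      moreover from this have "x \<noteq> w" using new' by blast
      ultimately have "z = y" using no_square[OF pE(1)[OF z] pE(1)[OF wz] E] pE(1) by blast
      then show False using z new by simp
    qed
  qed
  moreover have "y \<notin> set (get q x)" using a E unfolding agrees_def by blast
  ultimately show ?thesis
    using short[OF E new] short[OF sym[OF E] new'] by (auto simp: fits_def)
qed

text \<open>
  The three neighbours of a cell lie in different rows, none in its own, so they miss only one of the
  other four.
\<close>

lemma nbr_in_rows: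
  assumes "i \<noteq> j" "distinct [i, r, s]" shows "\<exists>y. E (i, j) y \<and> fst y \<in> {r, s}"
proof (rule ccontr)
  assume *: "\<not> ?thesis"
  have "inj_on fst {y. E (i, j) y}"
    using nbrs_apart[of "(i, j)"] by (fastforce simp: inj_on_def apart_iff)
  then have "card (fst ` {y. E (i, j) y}) = 3" using three[of "(i, j)"] assms(1) by (simp add: card_image)
  moreover have "fst ` {y. E (i, j) y} \<subseteq> UNIV - {i, r, s}"
    using * apart[of "(i, j)"] by (fastforce simp: apart_iff)
  then have "card (fst ` {y. E (i, j) y}) \<le> card (UNIV - {i, r, s})" by (intro card_mono) auto
  moreover have "card (UNIV - {i, r, s}) = 2"
    using assms(2) by (subst card_Diff_subset) (auto simp: card_pt)
  ultimately show False by simp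
qed

lemma nbr_in_cols:
  assumes "i \<noteq> j" "distinct [j, r, s]" shows "\<exists>y. E (i, j) y \<and> snd y \<in> {r, s}"
proof (rule ccontr)
  assume *: "\<not> ?thesis"
  have "inj_on snd {y. E (i, j) y}"
    using nbrs_apart[of "(i, j)"] by (fastforce simp: inj_on_def apart_iff)
  then have "card (snd ` {y. E (i, j) y}) = 3" using three[of "(i, j)"] assms(1) by (simp add: card_image)
  moreover have "snd ` {y. E (i, j) y} \<subseteq> UNIV - {j, r, s}"
    using * apart[of "(i, j)"] by (fastforce simp: apart_iff)
  then have "card (snd ` {y. E (i, j) y}) \<le> card (UNIV - {j, r, s})" by (intro card_mono) auto
  moreover have "card (UNIV - {j, r, s}) = 2"
    using assms(2) by (subst card_Diff_subset) (auto simp: card_pt)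
  ultimately show False by simp
qed

lemma check_sound:
  "agrees p q \<Longrightarrow> avoids E K \<Longrightarrow> check R K p q c \<Longrightarrow> realises E R"
  "agrees p q \<Longrightarrow> avoids E K \<Longrightarrow> check_all R K p q x ys cs \<Longrightarrow> \<forall>y\<in>set ys. y \<notin> set (get p x) \<Longrightarrow>
    x \<notin> set ys \<Longrightarrow> realises E R \<or> (\<forall>y\<in>set ys. \<not> E x y)"
proof (induction R K p q c and R K p q x ys cs rule: check_check_all.induct)
  case (1 R K p q i j r s cs)
  have chk: "check_all R K p q (i, j) (in_row j r @ in_row j s) cs" "i \<noteq> j" "distinct [i, r, s]"
    and new: "\<forall>y\<in>set (get p (i, j)). fst y \<noteq> r \<and> fst y \<noteq> s"
    using 1(4) by (auto split: if_splits)
  obtain y where y: "E (i, j) y" "fst y \<in> {r, s}" using nbr_in_rows[OF chk(2,3)] by blast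
  then have "y \<in> set (in_row j r @ in_row j s)"
    using off_diag[OF sym[OF y(1)]] apart[OF y(1)] by (auto simp: set_in_row apart_iff)
  moreover have "\<forall>y\<in>set (in_row j r @ in_row j s). y \<notin> set (get p (i, j))"
    using new by (auto simp: set_in_row)
  moreover have "(i, j) \<notin> set (in_row j r @ in_row j s)" using chk(3) by (auto simp: set_in_row)
  ultimately show ?case using 1(1)[OF _ _ _ _ 1(2,3) chk(1)] y(1) chk(2,3) new by simp blast
next
  case (2 R K p q i j r s cs)
  have chk: "check_all R K p q (i, j) (in_col i r @ in_col i s) cs" "i \<noteq> j" "distinct [j, r, s]"
    and new: "\<forall>y\<in>set (get p (i, j)). snd y \<noteq> r \<and> snd y \<noteq> s"
    using 2(4) by (auto split: if_splits)
  obtain y where y: "E (i, j) y" "snd y \<in> {r, s}" using nbr_in_cols[OF chk(2,3)] by blast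
  then have "y \<in> set (in_col i r @ in_col i s)"
    using off_diag[OF sym[OF y(1)]] apart[OF y(1)] by (auto simp: set_in_col apart_iff)
  moreover have "\<forall>y\<in>set (in_col i r @ in_col i s). y \<notin> set (get p (i, j))"
    using new by (auto simp: set_in_col)
  moreover have "(i, j) \<notin> set (in_col i r @ in_col i s)" using chk(3) by (auto simp: set_in_col)
  ultimately show ?case using 2(1)[OF _ _ _ _ 2(2,3) chk(1)] y(1) chk(2,3) new by simp blast
next
  case (3 R K p q g)
  then obtain T where "T \<in> set K" "\<forall>y\<in>set T. act g y \<in> set (get p (act g (P0, P1)))" "symmetry (act g)"
    by (auto simp: list_ex_iff symmetry_act split: if_splits)
  then show ?case using 3(1,2) unfolding agrees_def avoids_def by blast
next
  case (4 R K p q g)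
  then obtain t where "t \<in> set R" "\<forall>x\<in>set cells. \<forall>y\<in>set (get t x). act g y \<in> set (get p (act g x))"
    "symmetry (act g)"
    by (auto simp: list_ex_iff list_all_iff symmetry_act split: if_splits)
  then show ?case using 4(1) unfolding agrees_def realises_def by blast
next
  case (5 R K p q x cs)
  then show ?case by simp
next
  case (6 R K p q x y ys cs)
  show ?case
  proof (cases "fits p q x y")
    case False
    then have "\<not> E x y" using fits_if_adjacent[OF 6(4), of x y] 6(7) by (meson list.set_intros(1))
    moreover have "check_all R K p q x ys cs" using 6(6) False by simp
    ultimately show ?thesis using 6(3)[OF False 6(4,5)] 6(7,8) by auto
  next
    case True
    then obtain d ds where cs: "cs = d # ds" and d: "check R K (link x y p) q d"
      and ds: "check_all R K p (link x y q) x ys ds"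
      using 6(6) by (auto split: list.splits if_splits)
    show ?thesis
    proof (cases "E x y")
      case E: True
      have "agrees (link x y p) q" using agrees_link[OF 6(4) E] 6(7) by simp
      then show ?thesis using 6(1)[OF True cs _ _ d] 6(5) by blast
    next
      case E: False
      have "agrees p (link x y q)" using agrees_unlink[OF 6(4) E] 6(8) by auto
      then show ?thesis using 6(2)[OF True cs d _ _ ds] 6(5,7,8) E by auto
    qed
  qed
qed

end

lemma realises_symmetry:
  assumes "symmetry f" "realises (\<lambda>x y. E (f x) (f y)) R" shows "realises E R"
  using assms symmetry_comp unfolding realises_def by blast

lemma avoids_symmetry:
  assumes "symmetry f" "avoids E K" shows "avoids (\<lambda>x y. E (f x) (f y)) K"
  using assms symmetry_comp unfolding avoids_def by blast

text \<open>
  One stage of the search: if the configuration \<open>T\<close> occurs at all, then after a symmetry it occurs at the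
  cell \<open>(P0, P1)\<close>, and the tree starting there applies. Otherwise \<open>T\<close> may be assumed not to occur in
  the following stages.
\<close>

lemma avoids_or_realises:
  assumes "cubic E" "avoids E K" "(P0, P1) \<notin> set T" "distinct T" "check R K (start T) empty c"
  shows "avoids E (T # K) \<or> realises E R"
proof (cases "avoids E (T # K)")
  case False
  then obtain f where f: "symmetry f" "\<forall>y\<in>set T. E (f (P0, P1)) (f y)"
    using assms(2) by (auto simp: avoids_def)
  define E' where "E' = (\<lambda>x y. E (f x) (f y))"
  interpret cubic E' using cubic_symmetry[OF assms(1) f(1)] by (simp add: E'_def)
  have "agrees empty empty" by (simp add: agrees_def)
  then have "agrees (start T) empty \<and> set (get (start T) (P0, P1)) = set T"
    using assms(3,4) f(2) unfolding start_def
  proof (induction T)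
    case (Cons y T)
    then show ?case using agrees_link[of _ empty "(P0, P1)" y] by (auto simp: get_link E'_def)
  qed simp
  then have "realises E' R"
    using check_sound(1) avoids_symmetry[OF f(1) assms(2)] assms(5) unfolding E'_def by blast
  then show ?thesis using realises_symmetry f(1) by (auto simp: E'_def)
qed simp

lemma realises_if_check:
  assumes "cubic E" "avoids E K" "check R K empty empty c" shows "realises E R"
proof -
  interpret cubic E by fact
  show ?thesis using check_sound(1)[OF _ assms(2,3)] by (simp add: agrees_def)
qed

section \<open>Counting isomorphisms\<close>

text \<open>
  Membership is tested with \<open>mem\<close> so that unfolding this definition keeps terms executable.
\<close>

definition rel_of :: "table \<Rightarrow> cell \<Rightarrow> cell \<Rightarrow> bool" where
  "rel_of t x y \<longleftrightarrow> mem y (get t x)"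

definition no_short_cycle :: "table \<Rightarrow> cell \<Rightarrow> cell \<Rightarrow> bool" where
  "no_short_cycle t x y \<longleftrightarrow> apart x y \<and> mem x (get t y) \<and>
    list_all (\<lambda>z. z = x \<or> \<not> mem z (get t x) \<and>
      list_all (\<lambda>w. w = y \<or> \<not> mem z (get t w)) (get t x)) (get t y)"

fun three_apart :: "cell list \<Rightarrow> bool" where
  "three_apart [a, b, c] = (apart a b \<and> apart a c \<and> apart b c)"
| "three_apart _ = False"

definition valid :: "table \<Rightarrow> bool" where
  "valid t \<longleftrightarrow> list_all (\<lambda>i. get t (i, i) = []) pts \<and>
    list_all (\<lambda>x. three_apart (get t x) \<and> list_all (no_short_cycle t x) (get t x)) cells"

lemma valid_cubic:
  assumes "valid t" shows "cubic (rel_of t)" and "distinct (get t x)"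
proof -
  have diag: "get t x = []" if "fst x = snd x" for x
    using assms that by (cases x) (auto simp: valid_def list_all_iff)
  have off: "\<exists>a b c. get t x = [a, b, c] \<and> apart a b \<and> apart a c \<and> apart b c" if "fst x \<noteq> snd x" for x
  proof -
    have "x \<in> set cells" using that by (simp add: set_cells)
    then have "three_apart (get t x)" using assms by (simp add: valid_def list_all_iff)
    then show ?thesis by (cases "get t x" rule: three_apart.cases) simp_all
  qed
  have nbr: "apart x y \<and> x \<in> set (get t y) \<and> (\<forall>z\<in>set (get t y). z = x \<or> z \<notin> set (get t x) \<and>
      (\<forall>w\<in>set (get t x). w = y \<or> z \<notin> set (get t w)))" if "y \<in> set (get t x)" for x y
  proof -
    have "fst x \<noteq> snd x" using that diag[of x] by auto
    then have "no_short_cycle t x y"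
      using assms that unfolding valid_def list_all_iff set_cells by blast
    then show ?thesis unfolding no_short_cycle_def list_all_iff mem_iff by blast
  qed
  have irr: "\<not> apart x x" for x by (cases x) simp
  show "distinct (get t x)"
  proof (cases "fst x = snd x")
    case False
    obtain a b c where *: "get t x = [a, b, c]" "apart a b" "apart a c" "apart b c"
      using off[OF False] by blast
    then have "a \<noteq> b" "a \<noteq> c" "b \<noteq> c" using irr by metis+
    with *(1) show ?thesis by simp
  qed (simp add: diag)
  show "cubic (rel_of t)"
  proof
    fix x y z w
    show "rel_of t y x" "fst x \<noteq> snd x" "apart x y" if "rel_of t x y"
      using that nbr[of y x] diag[of x] by (auto simp: rel_of_def)
    show "apart y z" if "rel_of t x y" "rel_of t x z" "y \<noteq> z"
    proof -
      have "fst x \<noteq> snd x" using that(1) diag[of x] by (auto simp: rel_of_def)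
      from off[OF this] show ?thesis using that by (auto simp: rel_of_def apart_iff)
    qed
    show "\<not> rel_of t x z" if "rel_of t x y" "rel_of t y z"
    proof -
      have "z \<noteq> x" if "z \<in> set (get t x)" using nbr[OF that] irr[of x] by auto
      then show ?thesis using nbr[of y x] that by (auto simp: rel_of_def)
    qed
    show "y = w" if "rel_of t x y" "rel_of t y z" "rel_of t x w" "rel_of t w z" "x \<noteq> z"
      using nbr[of y x] that by (auto simp: rel_of_def)
    show "card {y. rel_of t x y} = 3" if "fst x \<noteq> snd x"
    proof -
      obtain a b c where *: "get t x = [a, b, c]" "apart a b" "apart a c" "apart b c"
        using off[OF \<open>fst x \<noteq> snd x\<close>] by blast
      then have "a \<noteq> b" "a \<noteq> c" "b \<noteq> c" using irr by metis+
      moreover have "{y. rel_of t x y} = {a, b, c}" using *(1) by (auto simp: rel_of_def)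
      ultimately show ?thesis by simp
    qed
  qed
qed

text \<open>
  All degrees are 3, so a subset relation suffices. This is why \<open>Found\<close> and the counts below test
  inclusion of edges only.
\<close>

lemma cubic_eqI:
  assumes "cubic E" "cubic F" "\<And>x y. E x y \<Longrightarrow> F x y" shows "E = F"
proof -
  interpret E: cubic E by fact
  interpret F: cubic F by fact
  have "{y. E x y} = {y. F x y}" for x
  proof (cases "fst x = snd x")
    case True then show ?thesis using E.off_diag F.off_diag by auto
  next
    case False
    have "{y. E x y} \<subseteq> {y. F x y}" using assms(3) by blast
    then show ?thesis using E.three[OF False] F.three[OF False] by (intro card_subset_eq) simp_all
  qed
  then show ?thesis by (simp add: fun_eq_iff set_eq_iff)
qed

definition isos :: "(cell \<Rightarrow> cell \<Rightarrow> bool) \<Rightarrow> (cell \<Rightarrow> cell \<Rightarrow> bool) \<Rightarrow> (label \<Rightarrow> label) set" where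
  "isos E F = {f \<in> extensional labels. bij_betw f labels labels \<and>
    (\<forall>x\<in>labels. \<forall>y\<in>labels. label_adj F (f x) (f y) \<longleftrightarrow> label_adj E x y)}"

context near_moore begin

lemma frame_partner:
  assumes p: "frame p" shows "\<not> (\<exists>c. adj (p (A i)) c \<and> adj (p (B i)) c)"
proof
  assume "\<exists>c. adj (p (A i)) c \<and> adj (p (B i)) c"
  then obtain c where c: "adj (p (A i)) c" "adj (p (B i)) c" by blast
  then have "c \<in> p ` labels" using adj_V' frameD(1)[OF p] by (auto simp: bij_betw_def)
  then obtain z where z: "z \<in> labels" "c = p z" by blast
  then have "label_adj (induced p) (A i) z" "label_adj (induced p) (B i) z"
    using c frame_adj[OF p] by auto
  then show False by (cases z) auto
qed

lemma frame_common:
  assumes p: "frame p" and "i \<noteq> j" "adj (p (A i)) c" "adj (p (B j)) c" shows "c = p (C i j)"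
proof -
  have "adj (p (A i)) (p (C i j))" "adj (p (C i j)) (p (B j))" "p (A i) \<noteq> p (B j)"
    using assms(2) frameD(2,3)[OF p] by auto
  then show ?thesis using no_square assms(3,4) sym by blast
qed

lemma frame_partner_unique:
  assumes p: "frame p" and "adj (p W) b" "\<not> (\<exists>c. adj (p (A i)) c \<and> adj b c)" shows "b = p (B i)"
proof -
  have "b \<in> {y. adj (p W) y}" using assms(2) by simp
  then obtain j where j: "b = p (B j)" unfolding frame_nbrs_tree(2)[OF p] by blast
  have "i = j"
  proof (rule ccontr)
    assume "i \<noteq> j"
    then have "adj (p (A i)) (p (C i j))" "adj b (p (C i j))" using frameD(2)[OF p] by (auto simp: j)
    with assms(3) show False by blast
  qed
  with j show ?thesis by simp
qed

text \<open>
  The image of \<open>B i\<close> is the neighbour of \<open>p W\<close> without a common neighbour with \<open>p (A i)\<close>, and the image of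
  \<open>C i j\<close> is a common neighbour of two vertices; both are unique.
\<close>

lemma frame_unique:
  assumes p: "frame p" and q: "frame q" and eq: "p U = q U" "p W = q W" "\<And>i. p (A i) = q (A i)"
    and z: "z \<in> labels"
  shows "p z = q z"
proof -
  have B: "p (B i) = q (B i)" for i
  proof (rule frame_partner_unique[OF q])
    show "adj (q W) (p (B i))" using frameD(2)[OF p, of W "B i"] eq by simp
    show "\<not> (\<exists>c. adj (q (A i)) c \<and> adj (p (B i)) c)" using frame_partner[OF p] eq by simp
  qed
  have "p (C i j) = q (C i j)" if "i \<noteq> j" for i j
  proof (rule frame_common[OF q that])
    show "adj (q (A i)) (p (C i j))" using frameD(2)[OF p, of "A i" "C i j"] that eq by simp
    show "adj (q (B j)) (p (C i j))" using frameD(2)[OF p, of "B j" "C i j"] that B by simp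
  qed
  with B eq z show ?thesis by (cases z) auto
qed

end

lemma isos_iff_frame:
  assumes "cubic E" "cubic F"
  shows "f \<in> isos E F \<longleftrightarrow> f \<in> extensional labels \<and> near_moore.frame labels (label_adj F) f \<and>
    (\<forall>x y. E x y \<longrightarrow> near_moore.induced (label_adj F) f x y)"
proof -
  interpret E: cubic E by fact
  interpret F: cubic F by fact
  interpret near_moore labels "label_adj F" by (rule F.near_moore)
  have weak: "label_adj E x y" if "label_adj (\<lambda>_ _. False) x y" for x y
    using that by (cases x; cases y) auto
  show ?thesis
  proof
    assume f: "f \<in> isos E F"
    then have "frame f" using weak by (auto simp: isos_def frame_def)
    moreover have "induced f x y" if "E x y" for x y
      using f that E.off_diag[OF that] E.off_diag[OF E.sym[OF that]]
      by (cases x; cases y) (simp add: isos_def induced_def)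
    ultimately show "f \<in> extensional labels \<and> frame f \<and> (\<forall>x y. E x y \<longrightarrow> induced f x y)"
      using f by (simp add: isos_def)
  next
    assume f: "f \<in> extensional labels \<and> frame f \<and> (\<forall>x y. E x y \<longrightarrow> induced f x y)"
    then have "E = induced f" using assms(1) frame_cubic by (intro cubic_eqI) auto
    then show "f \<in> isos E F" using f frame_adj frameD(1) by (simp add: isos_def)
  qed
qed

fun nbrs :: "table \<Rightarrow> label \<Rightarrow> label list" where
  "nbrs t U = map A pts"
| "nbrs t W = map B pts"
| "nbrs t (A i) = U # map (C i) (filter (\<lambda>j. j \<noteq> i) pts)"
| "nbrs t (B j) = W # map (\<lambda>i. C i j) (filter (\<lambda>i. i \<noteq> j) pts)"
| "nbrs t (C i j) = A i # B j # map (\<lambda>(k, l). C k l) (get t (i, j))"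

definition label_list :: "label list" where
  "label_list = U # W # map A pts @ map B pts @ map (\<lambda>(i, j). C i j) cells"

definition is_remote :: "table \<Rightarrow> label list \<Rightarrow> label list \<Rightarrow> label \<Rightarrow> bool" where
  "is_remote t near two y =
    (if mem y near then False else if mem y two then False else disj (nbrs t y) two)"

definition remotes :: "table \<Rightarrow> label \<Rightarrow> label list" where
  "remotes t x = filter (is_remote t (x # nbrs t x) (concat (map (nbrs t) (nbrs t x)))) label_list"

fun five_of :: "'a list \<Rightarrow> 'a five" where
  "five_of [a, b, c, d, e] = Five a b c d e"

definition partner :: "table \<Rightarrow> label list \<Rightarrow> label \<Rightarrow> label" where
  "partner t ys u = hd (filter (\<lambda>z. disj (nbrs t z) (nbrs t u)) ys)"

definition common :: "table \<Rightarrow> label \<Rightarrow> label \<Rightarrow> label" where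
  "common t u w = hd (filter (\<lambda>c. mem c (nbrs t w)) (nbrs t u))"

text \<open>
  The matrix of the images of the cells, where \<open>us\<close> and \<open>ws\<close> are the images of the \<open>A i\<close> and \<open>B j\<close>. On the
  diagonal there is no common neighbour; these entries are unspecified and never used.
\<close>

definition middle :: "table \<Rightarrow> label five \<Rightarrow> label five \<Rightarrow> label five five" where
  "middle t us ws = map_five (\<lambda>u. map_five (common t u) ws) us"

definition image_cell :: "label five five \<Rightarrow> pt five \<Rightarrow> cell \<Rightarrow> label" where
  "image_cell m s x = entry (entry m (entry s (fst x))) (entry s (snd x))"

fun sees_all :: "table \<Rightarrow> label five five \<Rightarrow> pt five \<Rightarrow> label \<Rightarrow> cell list \<Rightarrow> bool" where
  "sees_all t m s v [] = True"
| "sees_all t m s v (y # ys) = (if label_adj (rel_of t) v (image_cell m s y) then sees_all t m s v ys else False)"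

fun maps_edges :: "table \<Rightarrow> table \<Rightarrow> label five five \<Rightarrow> cell list \<Rightarrow> pt five \<Rightarrow> bool" where
  "maps_edges t t' m [] s = True"
| "maps_edges t t' m (x # xs) s =
    (if sees_all t' m s (image_cell m s x) (get t x) then maps_edges t t' m xs s else False)"

definition perms :: "pt five list" where
  "perms = [Five a b c d e. a \<leftarrow> pts, b \<leftarrow> pts, b \<noteq> a, c \<leftarrow> pts, c \<noteq> a, c \<noteq> b,
     d \<leftarrow> pts, d \<noteq> a, d \<noteq> b, d \<noteq> c, e \<leftarrow> pts, e \<noteq> a, e \<noteq> b, e \<noteq> c, e \<noteq> d]"

fun hits :: "table \<Rightarrow> table \<Rightarrow> pt five list \<Rightarrow> label five five \<Rightarrow> nat" where
  "hits t t' ps m = length (filter (maps_edges t t' m cells) ps)"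

definition count_at :: "table \<Rightarrow> table \<Rightarrow> pt five list \<Rightarrow> label \<Rightarrow> label \<Rightarrow> nat" where
  "count_at t t' ps x y = hits t t' ps (middle t' (five_of (nbrs t' x))
     (map_five (partner t' (nbrs t' y)) (five_of (nbrs t' x))))"

definition tally_with :: "table \<Rightarrow> table \<Rightarrow> pt five list \<Rightarrow> nat list" where
  "tally_with t t' ps = concat (map (\<lambda>x. map (count_at t t' ps x) (remotes t' x)) label_list)"

text \<open>
  For each ordered pair of vertices of the target at distance at least 4, the number of permutations
  that extend to an isomorphism. The list of permutations is an argument of \<open>tally_with\<close> so that it
  is evaluated only once.
\<close>

definition tally :: "table \<Rightarrow> table \<Rightarrow> nat list" where
  "tally t t' = tally_with t t' perms"

lemma set_perms: "set perms = {s. bijective s}"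
proof (rule Set.set_eqI)
  fix s :: "pt five"
  show "s \<in> set perms \<longleftrightarrow> s \<in> {s. bijective s}"
    by (cases s) (auto simp: perms_def)
qed

lemma distinct_perms: "distinct perms"
  by code_simp

lemma distinct_label_list: "distinct label_list"
  by code_simp

lemma set_label_list: "set label_list = labels"
  by (auto simp: label_list_def set_cells labels_def)

lemma entry_map_five [simp]: "entry (map_five f t) i = f (entry t i)"
  by (cases t; cases i) simp_all

lemma bij_five_of: "distinct xs \<Longrightarrow> length xs = 5 \<Longrightarrow> bij_betw (entry (five_of xs)) UNIV (set xs)"
proof -
  assume xs: "distinct xs" "length xs = 5"
  then obtain a b c d e where [simp]: "xs = [a, b, c, d, e]"
    by (auto simp: eval_nat_numeral length_Suc_conv)
  show ?thesis using xs(1) by (auto simp: bij_betw_def inj_on_def UNIV_pt)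
qed

lemma sees_all_iff [simp]:
  "sees_all t m s v ys \<longleftrightarrow> (\<forall>y\<in>set ys. label_adj (rel_of t) v (image_cell m s y))"
  by (induction ys) auto

lemma maps_edges_iff [simp]:
  "maps_edges t t' m xs s \<longleftrightarrow>
    (\<forall>x\<in>set xs. \<forall>y\<in>set (get t x). label_adj (rel_of t') (image_cell m s x) (image_cell m s y))"
  by (induction xs) auto

lemma set_nbrs:
  assumes "valid t" "x \<in> labels" shows "set (nbrs t x) = {y. label_adj (rel_of t) x y}"
proof -
  interpret cubic "rel_of t" using assms(1) by (rule valid_cubic)
  have "y \<in> set (nbrs t x) \<longleftrightarrow> label_adj (rel_of t) x y" for y
    using assms(2) by (cases x; cases y) (auto simp: rel_of_def)
  then show ?thesis by blast
qed

lemma distinct_nbrs: "valid t \<Longrightarrow> distinct (nbrs t x)"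
proof -
  assume "valid t"
  then have "distinct (map (\<lambda>(k, l). C k l) (get t (i, j)))" for i j
    using valid_cubic(2) by (auto simp: distinct_map inj_on_def)
  moreover have "distinct (map A pts)" "distinct (map B pts)" "distinct (filter P pts)" for P
    by (simp_all add: pts_def)
  ultimately show ?thesis by (cases x) (auto simp: distinct_map inj_on_def)
qed

lemma (in near_moore) frame_remote:
  assumes p: "frame p" shows "remote adj (p U) (p W)"
proof -
  have *: "\<exists>z\<in>labels. y = p z \<and> label_adj (induced p) x z" if "adj (p x) y" "x \<in> labels" for x y
  proof -
    have "y \<in> p ` labels" using adj_V'[OF that(1)] frameD(1)[OF p] by (simp add: bij_betw_def)
    then show ?thesis using that frame_adj[OF p] by blast
  qed
  have U: "\<exists>i. x = p (A i)" if "adj (p U) x" for x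
    using frame_nbrs_tree(1)[OF p] that by blast
  have A: "y = p U \<or> (\<exists>j. i \<noteq> j \<and> y = p (C i j))" if "adj (p (A i)) y" for i y
  proof -
    have "y \<in> p ` insert U (C i ` (- {i}))" unfolding frame_nbrs_tree(3)[OF p, symmetric] using that by simp
    then show ?thesis by auto
  qed
  have W: "\<not> adj (p z) (p W)" if "z = U \<or> (\<exists>i. z = A i) \<or> (\<exists>i j. z = C i j \<and> i \<noteq> j)" for z
    using that frame_adj[OF p, of z W] by auto
  have "p U \<noteq> p W" using frameD(3)[OF p, of U W] by simp
  then show ?thesis unfolding remote_def using U A W by metis
qed

lemma set_remotes:
  assumes "valid t" "x \<in> labels" shows "set (remotes t x) = {y \<in> labels. remote (label_adj (rel_of t)) x y}"
proof -
  interpret cubic "rel_of t" using assms(1) by (rule valid_cubic)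
  interpret near_moore labels "label_adj (rel_of t)" by (rule near_moore)
  have two: "set (concat (map (nbrs t) (nbrs t x))) = {z. \<exists>y. label_adj (rel_of t) x y \<and> label_adj (rel_of t) y z}"
    using assms set_nbrs adj_V' by fastforce
  have "is_remote t (x # nbrs t x) (concat (map (nbrs t) (nbrs t x))) y \<longleftrightarrow> remote (label_adj (rel_of t)) x y"
    if "y \<in> labels" for y
  proof -
    have "set (nbrs t y) = {z. label_adj (rel_of t) z y}" using set_nbrs[OF assms(1) that] sym by blast
    then show ?thesis
      unfolding is_remote_def remote_def mem_iff disj_iff two list.set set_nbrs[OF assms]
      by auto
  qed
  then show ?thesis by (auto simp: remotes_def set_label_list)
qed

text \<open>
  Fix a frame \<open>q\<close> of the target at the pair \<open>x\<close>, \<open>y\<close>. By \<open>frame_unique\<close> every other frame at this pair is \<open>q\<close>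
  after a permutation of the indices, and it is an isomorphism if and only if it carries the edges between
  cells to edges.
\<close>

lemma count_at:
  assumes t: "valid t" and t': "valid t'" and x: "x \<in> labels" and y: "y \<in> labels"
    and far: "remote (label_adj (rel_of t')) x y"
  shows "card {f \<in> isos (rel_of t) (rel_of t'). f U = x \<and> f W = y} = count_at t t' perms x y"
proof -
  interpret cubic "rel_of t'" using t' by (rule valid_cubic)
  interpret near_moore labels "label_adj (rel_of t')" by (rule near_moore)
  define us where "us = five_of (nbrs t' x)"
  define ws where "ws = map_five (partner t' (nbrs t' y)) us"
  define m where "m = middle t' us ws"
  have "length (nbrs t' x) = 5"
    using distinct_card[OF distinct_nbrs[OF t']] degree[OF x] set_nbrs[OF t' x] by metis
  then have us: "bij_betw (entry us) UNIV {z. label_adj (rel_of t') x z}"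
    unfolding us_def set_nbrs[OF t' x, symmetric] by (intro bij_five_of distinct_nbrs t')
  obtain q where q: "frame q" "q U = x" "q W = y" "\<And>i. q (A i) = entry us i"
    using frame_exists[OF x y far us] by blast
  note qlab = frameD(4)[OF q(1)]
  have ws: "entry ws i = q (B i)" for i
  proof -
    let ?P = "\<lambda>z. disj (nbrs t' z) (nbrs t' (entry us i))"
    have P: "?P z \<longleftrightarrow> \<not> (\<exists>c. label_adj (rel_of t') (q (A i)) c \<and> label_adj (rel_of t') z c)" if "z \<in> labels" for z
      using set_nbrs[OF t' that] set_nbrs[OF t' qlab[of "A i"]] q(4) by auto
    have "label_adj (rel_of t') y (q (B i))" using frameD(2)[OF q(1), of W "B i"] q(3) by simp
    then have "q (B i) \<in> set (filter ?P (nbrs t' y))"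
      using P[OF qlab[of "B i"]] frame_partner[OF q(1), of i] set_nbrs[OF t' y] by simp
    moreover have "z = q (B i)" if "z \<in> set (filter ?P (nbrs t' y))" for z
    proof -
      have "label_adj (rel_of t') y z" "?P z" using that set_nbrs[OF t' y] by auto
      then show ?thesis using P[OF adj_V'] q(3) by (intro frame_partner_unique[OF q(1)]) blast+
    qed
    ultimately have "hd (filter ?P (nbrs t' y)) = q (B i)"
      by (metis hd_in_set list.set_cases list.discI)
    then show ?thesis by (simp add: ws_def partner_def)
  qed
  have m: "entry (entry m i) j = q (C i j)" if "i \<noteq> j" for i j
  proof -
    let ?L = "filter (\<lambda>c. mem c (nbrs t' (q (B j)))) (nbrs t' (q (A i)))"
    have L: "c \<in> set ?L \<longleftrightarrow> label_adj (rel_of t') (q (A i)) c \<and> label_adj (rel_of t') (q (B j)) c" for c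
      using set_nbrs[OF t' qlab[of "A i"]] set_nbrs[OF t' qlab[of "B j"]] by simp
    have "q (C i j) \<in> set ?L" unfolding L using frameD(2)[OF q(1)] that by simp
    moreover have "c = q (C i j)" if "c \<in> set ?L" for c
      using that frame_common[OF q(1) \<open>i \<noteq> j\<close>] unfolding L by blast
    ultimately have "hd ?L = q (C i j)" by (metis hd_in_set list.set_cases list.discI)
    then show ?thesis by (simp add: m_def middle_def common_def ws q(4))
  qed
  define g where "g s = restrict (\<lambda>z. q (relabel (entry s) z)) labels" for s
  have relabel_lab: "relabel (entry s) z \<in> labels" if "bijective s" "z \<in> labels" for s z
    using bij_relabel that by (auto simp: bijective_iff bij_betw_def)
  have g_frame: "frame (g s)" if "bijective s" for s
  proof -
    have "frame (\<lambda>z. q (relabel (entry s) z))" using frame_relabel[OF q(1)] that by (simp add: bijective_iff)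
    then show ?thesis by (simp add: frame_def g_def cong: bij_betw_cong)
  qed
  have g_ind: "induced (g s) (i, j) (k, l) \<longleftrightarrow> i \<noteq> j \<and> k \<noteq> l \<and>
      label_adj (rel_of t') (image_cell m s (i, j)) (image_cell m s (k, l))" if "bijective s" for s i j k l
  proof -
    have "entry s a = entry s b \<longleftrightarrow> a = b" for a b
      using that by (simp add: bijective_iff bij_def inj_eq)
    then show ?thesis by (auto simp: induced_def g_def image_cell_def m)
  qed
  interpret t: cubic "rel_of t" using t by (rule valid_cubic)
  have g_iso: "g s \<in> isos (rel_of t) (rel_of t') \<longleftrightarrow> maps_edges t t' m cells s" if "bijective s" for s
  proof -
    have "g s \<in> isos (rel_of t) (rel_of t') \<longleftrightarrow> (\<forall>z w. rel_of t z w \<longrightarrow> induced (g s) z w)"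
      unfolding isos_iff_frame[OF t.cubic_axioms cubic_axioms] using g_frame[OF that] by (simp add: g_def)
    also have "\<dots> \<longleftrightarrow> (\<forall>z w. rel_of t z w \<longrightarrow> label_adj (rel_of t') (image_cell m s z) (image_cell m s w))"
    proof -
      have "induced (g s) z w \<longleftrightarrow> label_adj (rel_of t') (image_cell m s z) (image_cell m s w)"
        if zw: "rel_of t z w" for z w
        using g_ind[OF \<open>bijective s\<close>] t.off_diag[OF zw] t.off_diag[OF t.sym[OF zw]]
        by (cases z; cases w) simp
      then show ?thesis by blast
    qed
    also have "\<dots> \<longleftrightarrow> maps_edges t t' m cells s"
    proof -
      have "w \<in> set (get t z) \<longleftrightarrow> rel_of t z w" for z w by (simp add: rel_of_def)
      then show ?thesis
        unfolding maps_edges_iff set_cells Ball_def mem_Collect_eq using t.off_diag by blast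
    qed
    finally show ?thesis .
  qed
  have "{f \<in> isos (rel_of t) (rel_of t'). f U = x \<and> f W = y} = g ` {s \<in> set perms. maps_edges t t' m cells s}"
  proof (intro equalityI subsetI)
    fix f assume "f \<in> g ` {s \<in> set perms. maps_edges t t' m cells s}"
    then show "f \<in> {f \<in> isos (rel_of t) (rel_of t'). f U = x \<and> f W = y}"
      using g_iso by (auto simp: set_perms) (simp_all add: g_def q)
  next
    fix f assume f: "f \<in> {f \<in> isos (rel_of t) (rel_of t'). f U = x \<and> f W = y}"
    then have fr: "frame f" and ext: "f \<in> extensional labels" and fUW: "f U = x" "f W = y"
      using isos_iff_frame[OF t.cubic_axioms cubic_axioms] by auto
    have "{z. label_adj (rel_of t') x z} = f ` range A" using frame_nbrs_tree(1)[OF fr] fUW by simp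
    then have "\<exists>j. f (A i) = entry us j" for i using us unfolding bij_betw_def by (metis image_iff rangeI)
    then obtain h where h: "\<And>i. f (A i) = entry us (h i)" by metis
    define s where "s = Five (h P0) (h P1) (h P2) (h P3) (h P4)"
    have s: "entry s i = h i" for i by (cases i) (simp_all add: s_def)
    have "inj h"
      using frameD(3)[OF fr, of "A _" "A _"] by (auto simp: inj_def h dest: arg_cong[of _ _ "entry us"])
    moreover have "entry s = h" using s by (simp add: fun_eq_iff)
    ultimately have "bijective s"
      unfolding bijective_iff by (simp add: bij_def finite_UNIV_inj_surj)
    have "f = g s"
    proof (rule extensionalityI[OF ext])
      show "g s \<in> extensional labels" by (simp add: g_def)
      show "f z = g s z" if "z \<in> labels" for z
        using frame_unique[OF fr g_frame[OF \<open>bijective s\<close>] _ _ _ that] fUW q h s by (simp add: g_def)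
    qed
    then show "f \<in> g ` {s \<in> set perms. maps_edges t t' m cells s}"
      using f g_iso \<open>bijective s\<close> by (auto simp: set_perms)
  qed
  moreover have "inj_on g {s \<in> set perms. maps_edges t t' m cells s}"
  proof (rule inj_onI)
    fix r s assume "g r = g s"
    then have "g r (A i) = g s (A i)" for i by simp
    then have "entry us (entry r i) = entry us (entry s i)" for i using q(4) by (simp add: g_def)
    then have "entry r i = entry s i" for i using us by (auto simp: bij_betw_def inj_eq)
    then show "r = s" by (cases r; cases s) (metis entry.simps)
  qed
  ultimately have "card {f \<in> isos (rel_of t) (rel_of t'). f U = x \<and> f W = y} =
      card (set (filter (maps_edges t t' m cells) perms))"
    by (simp add: card_image)
  also have "\<dots> = count_at t t' perms x y"
    using distinct_card[OF distinct_filter[OF distinct_perms]]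
    by (simp add: count_at_def m_def us_def ws_def del: set_filter)
  finally show ?thesis .
qed

text \<open>
  Isomorphisms are sorted by the images of \<open>U\<close> and \<open>W\<close>.
\<close>

lemma card_isos:
  assumes t: "valid t" and t': "valid t'"
  shows "card (isos (rel_of t) (rel_of t')) = sum_list (tally t t')"
proof -
  let ?I = "isos (rel_of t) (rel_of t')" and ?far = "\<lambda>x. set (remotes t' x)"
  interpret t: cubic "rel_of t" using t by (rule valid_cubic)
  interpret cubic "rel_of t'" using t' by (rule valid_cubic)
  interpret near_moore labels "label_adj (rel_of t')" by (rule near_moore)
  define S where "S x y = {f \<in> ?I. f U = x \<and> f W = y}" for x y
  have "?I \<subseteq> labels \<rightarrow>\<^sub>E labels" by (auto simp: isos_def PiE_def bij_betw_def)
  then have fin: "finite ?I" using finite_PiE[OF finite_labels finite_labels] finite_subset by blast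
  have "f U \<in> labels \<and> f W \<in> ?far (f U)" if "f \<in> ?I" for f
  proof -
    have "frame f" using that isos_iff_frame[OF t.cubic_axioms cubic_axioms] by blast
    then show ?thesis using frame_remote frameD(4) set_remotes[OF t'] by simp
  qed
  then have "?I = (\<Union>x\<in>labels. \<Union>y\<in>?far x. S x y)" by (auto simp: S_def)
  then have "card ?I = (\<Sum>x\<in>labels. card (\<Union>y\<in>?far x. S x y))"
    using fin finite_labels by (simp only:) (subst card_UN_disjoint, auto simp: S_def)
  also have "\<dots> = (\<Sum>x\<in>labels. \<Sum>y\<in>?far x. card (S x y))"
    using fin by (intro sum.cong refl card_UN_disjoint) (auto simp: S_def)
  also have "\<dots> = (\<Sum>x\<in>labels. \<Sum>y\<in>?far x. count_at t t' perms x y)"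
    unfolding S_def using set_remotes[OF t'] count_at[OF t t'] by (intro sum.cong refl) auto
  also have "\<dots> = (\<Sum>x\<in>labels. sum_list (map (count_at t t' perms x) (remotes t' x)))"
    using distinct_label_list by (simp add: sum_list_distinct_conv_sum_set remotes_def)
  also have "\<dots> = sum_list (tally t t')"
  proof -
    have "sum_list (concat xss) = sum_list (map sum_list xss)" for xss :: "nat list list"
      by (induction xss) auto
    then show ?thesis using distinct_label_list
      by (simp add: tally_def tally_with_def comp_def sum_list_distinct_conv_sum_set set_label_list)
  qed
  finally show ?thesis .
qed

section \<open>The graph of a table\<close>

instance pt :: countable by countable_datatype
instance label :: countable by countable_datatype

definition graph_of :: "table \<Rightarrow> nat pair_pre_digraph" where
  "graph_of t = \<lparr>pverts = to_nat ` labels, parcs = {(to_nat x, to_nat y) | x y. label_adj (rel_of t) x y}\<rparr>"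

lemma adjacent_graph_of [simp]: "adjacent (graph_of t) (to_nat x) (to_nat y) \<longleftrightarrow> label_adj (rel_of t) x y"
  by (auto simp: graph_of_def)

lemma pverts_graph_of: "pverts (graph_of t) = to_nat ` labels"
  by (simp add: graph_of_def)

lemma bij_to_nat: "bij_betw to_nat labels (pverts (graph_of t))"
  by (simp add: pverts_graph_of bij_betw_def inj_on_def)

lemma pair_graph_graph_of:
  assumes "valid t" shows "pair_graph (graph_of t)"
proof -
  interpret cubic "rel_of t" using assms by (rule valid_cubic)
  interpret near_moore labels "label_adj (rel_of t)" by (rule near_moore)
  have fin: "finite (pverts (graph_of t))" by (simp add: pverts_graph_of finite_V)
  have sub: "parcs (graph_of t) \<subseteq> pverts (graph_of t) \<times> pverts (graph_of t)"
    using adj_V adj_V' by (auto simp: graph_of_def)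
  then have "finite (parcs (graph_of t))" using fin by (meson finite_SigmaI finite_subset)
  moreover have "symmetric (with_proj (graph_of t))"
    unfolding symmetric_def with_proj_simps by (rule symI) (auto simp: graph_of_def dest: sym)
  ultimately show ?thesis using fin irrefl
    by unfold_locales (auto simp: graph_of_def dest: adj_V adj_V')
qed

lemma graph_of_mem:
  assumes "valid t" shows "graph_of t \<in> graphs_with 5 5 4 (5^2 + 5 + 2)"
proof -
  let ?G = "graph_of t"
  interpret E: cubic "rel_of t" using assms by (rule valid_cubic)
  interpret near_moore labels "label_adj (rel_of t)" by (rule E.near_moore)
  interpret G: pair_graph ?G using assms by (rule pair_graph_graph_of)
  have nat: "\<exists>x\<in>labels. n = to_nat x" if "adjacent ?G n m \<or> adjacent ?G m n" for n m
  proof -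
    have "n \<in> pverts ?G" using that G.in_arcsD1 G.in_arcsD2 by blast
    then show ?thesis by (auto simp: pverts_graph_of)
  qed
  have nm: "near_moore (pverts ?G) (adjacent ?G)"
  proof
    show "\<not> adjacent ?G n n" for n using G.no_loops'[of n n] by blast
    show "card (pverts ?G) = 32"
      using card_V bij_betw_same_card[OF bij_to_nat] by metis
    show "card {m. adjacent ?G n m} = 5" if n: "n \<in> pverts ?G" for n
    proof -
      obtain x where x: "x \<in> labels" "n = to_nat x" using n by (auto simp: pverts_graph_of)
      have "{m. adjacent ?G n m} = to_nat ` {y. label_adj (rel_of t) x y}"
        using nat x by (auto simp: graph_of_def)
      then show ?thesis using degree[OF x(1)] by (simp add: card_image inj_on_def)
    qed
    show "\<not> adjacent ?G n k" if "adjacent ?G n m" "adjacent ?G m k" for n m k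
      using that nat no_triangle by (metis adjacent_graph_of)
    show "m = l" if "adjacent ?G n m" "adjacent ?G m k" "adjacent ?G n l" "adjacent ?G l k" "n \<noteq> k" for n m k l
      using that nat no_square by (metis adjacent_graph_of)
  qed (use G.pair_finite_verts G.wellformed' G.arcs_symmetric in auto)
  have id: "frame id"
  proof -
    have "label_adj (rel_of t) x y" if "label_adj (\<lambda>_ _. False) x y" for x y using that by (cases x; cases y) auto
    then show ?thesis by (simp add: frame_def)
  qed
  have "remote (label_adj (rel_of t)) U W" using frame_remote[OF id] by simp
  then have far: "remote (adjacent ?G) (to_nat U) (to_nat W)"
    unfolding remote_def using nat by (metis adjacent_graph_of to_nat_split inj_eq inj_to_nat)
  have "{y. rel_of t (P0, P1) y} \<noteq> {}" using E.three[of "(P0, P1)"] by force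
  then obtain k l where E: "rel_of t (P0, P1) (k, l)" by auto
  have ne: "k \<noteq> P0" "k \<noteq> l" using E.apart[OF E] E.off_diag[OF E.sym[OF E]] by (auto simp: apart_iff)
  \<comment> \<open>a circuit of length 5 through any edge between two cells\<close>
  let ?p = "[(U, A P0), (A P0, C P0 P1), (C P0 P1, C k l), (C k l, A k), (A k, U)]"
  have "G.cycle (map (map_prod to_nat to_nat) ?p)"
    unfolding G.cycle_def
    by (rule exI[of _ "to_nat U"]) (use E ne in \<open>auto simp: G.awalk_def pverts_graph_of\<close>)
  from graphs_with_I[OF G.pair_graph nm _ _ far this] show ?thesis by (simp add: pverts_graph_of)
qed

lemma graph_iso_imp_isos:
  assumes "valid t" "valid t'" "graph_iso (graph_of t) (graph_of t')"
  shows "isos (rel_of t) (rel_of t') \<noteq> {}"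
proof -
  obtain f where f: "bij_betw f (to_nat ` labels) (to_nat ` labels)"
    "\<forall>x\<in>labels. \<forall>y\<in>labels. adjacent (graph_of t') (f (to_nat x)) (f (to_nat y)) \<longleftrightarrow> label_adj (rel_of t) x y"
    using assms pair_graph_graph_of by (fastforce simp: graph_iso_iff pverts_graph_of)
  have "\<forall>x\<in>labels. \<exists>y\<in>labels. f (to_nat x) = to_nat y" using f(1) by (auto simp: bij_betw_def)
  then obtain h where h: "\<forall>x\<in>labels. h x \<in> labels \<and> f (to_nat x) = to_nat (h x)" by metis
  have "inj_on h labels"
  proof (rule inj_onI)
    fix x y assume "x \<in> labels" "y \<in> labels" "h x = h y"
    then show "x = y" using h f(1) by (metis bij_betw_def imageI inj_onD inj_eq inj_to_nat)
  qed
  moreover from this have "h ` labels = labels" using h by (intro endo_inj_surj[OF finite_labels]) auto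
  ultimately have "bij_betw h labels labels" by (simp add: bij_betw_def)
  then have "restrict h labels \<in> isos (rel_of t) (rel_of t')"
    using f(2) h by (simp add: isos_def cong: bij_betw_cong)
  then show ?thesis by blast
qed

lemma graph_iso_graph_of:
  assumes "valid t" "pair_graph H" "bij_betw f labels (pverts H)"
    "\<And>x y. x \<in> labels \<Longrightarrow> y \<in> labels \<Longrightarrow> adjacent H (f x) (f y) \<longleftrightarrow> label_adj (rel_of t) x y"
  shows "graph_iso (graph_of t) H"
proof -
  have "bij_betw (\<lambda>n. f (from_nat n)) (pverts (graph_of t)) (pverts H)"
  proof -
    have "bij_betw (from_nat :: nat \<Rightarrow> label) (pverts (graph_of t)) labels"
      by (rule bij_betwI[where g = to_nat]) (auto simp: pverts_graph_of)
    from bij_betw_trans[OF this assms(3)] show ?thesis by (simp add: comp_def)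
  qed
  then show ?thesis
    using assms(4) graph_iso_iff[OF pair_graph_graph_of[OF assms(1)] assms(2)]
    by (auto simp: pverts_graph_of intro!: exI[of _ "\<lambda>n. f (from_nat n)"])
qed

lemma isos_imp_graph_iso:
  assumes "valid t" "valid t'" "isos (rel_of t) (rel_of t') \<noteq> {}"
  shows "graph_iso (graph_of t) (graph_of t')"
proof -
  obtain f where f: "f \<in> isos (rel_of t) (rel_of t')" using assms(3) by blast
  have "bij_betw (\<lambda>x. to_nat (f x)) labels (pverts (graph_of t'))"
    using bij_betw_trans[OF _ bij_to_nat[of t'], of f labels] f by (simp add: isos_def comp_def)
  then show ?thesis
    using f by (intro graph_iso_graph_of pair_graph_graph_of assms) (auto simp: isos_def)
qed

lemma order_graph_of:
  assumes "valid t" shows "order (graph_AutoGroup (graph_of t)) = sum_list (tally t t)"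
proof -
  have "isos (rel_of t) (rel_of t) = rel_autos labels (label_adj (rel_of t))" by (simp add: isos_def rel_autos_def)
  then have "card (rel_autos labels (label_adj (rel_of t))) = sum_list (tally t t)"
    using card_isos[OF assms assms] by simp
  moreover have "card (rel_autos labels (label_adj (rel_of t))) =
      card (rel_autos (pverts (graph_of t)) (adjacent (graph_of t)))"
    by (rule card_rel_autos_eq[OF finite_labels bij_to_nat]) simp
  ultimately show ?thesis by (simp add: order_AutoGroup)
qed

lemma graph_iso_of_tally:
  assumes "valid t" "valid t'"
  shows "graph_iso (graph_of t) (graph_of t') \<longleftrightarrow> sum_list (tally t t') \<noteq> 0"
proof -
  have "isos (rel_of t) (rel_of t') \<subseteq> labels \<rightarrow>\<^sub>E labels" by (auto simp: isos_def PiE_def bij_betw_def)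
  then have "finite (isos (rel_of t) (rel_of t'))"
    using finite_PiE[OF finite_labels finite_labels] finite_subset by blast
  then show ?thesis
    using graph_iso_imp_isos isos_imp_graph_iso card_isos assms by (metis card_0_eq)
qed

section \<open>The search tree and the eight relations at its leaves\<close>

text \<open>
  The eight relations that the search ends in, as tables of neighbour lists. The first seven are ordered
  by the orders of the automorphism groups of their graphs.
\<close>

definition "rep_0 =
  (Five (Five [] [(P1, P2), (P2, P0), (P3, P4)] [(P1, P3), (P2, P1), (P4, P0)] [(P2, P4), (P3, P1),
  (P4, P2)] [(P1, P0), (P2, P3), (P3, P2)]) (Five [(P0, P4), (P2, P1), (P4, P2)] [] [(P0, P1), (P2,
  P3), (P3, P0)] [(P0, P2), (P3, P4), (P4, P1)] [(P2, P0), (P3, P1), (P4, P3)]) (Five [(P0, P1),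
  (P1, P4), (P3, P2)] [(P0, P2), (P1, P0), (P4, P3)] [] [(P0, P4), (P1, P2), (P4, P0)] [(P0, P3),
  (P3, P0), (P4, P1)]) (Five [(P1, P2), (P2, P4), (P4, P3)] [(P0, P3), (P1, P4), (P4, P0)] [(P0,
  P4), (P2, P0), (P4, P1)] [] [(P0, P1), (P1, P3), (P4, P2)]) (Five [(P0, P2), (P2, P3), (P3, P1)]
  [(P1, P3), (P2, P4), (P3, P2)] [(P0, P3), (P1, P0), (P3, P4)] [(P1, P4), (P2, P1), (P3, P0)] []))"

definition "rep_1 =
  (Five (Five [] [(P1, P2), (P2, P0), (P3, P4)] [(P1, P3), (P2, P4), (P3, P0)] [(P2, P1), (P3, P2),
  (P4, P0)] [(P1, P0), (P2, P3), (P4, P1)]) (Five [(P0, P4), (P3, P1), (P4, P2)] [] [(P0, P1), (P2,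
  P3), (P4, P0)] [(P0, P2), (P3, P4), (P4, P1)] [(P2, P1), (P3, P0), (P4, P3)]) (Five [(P0, P1),
  (P3, P2), (P4, P3)] [(P0, P3), (P1, P4), (P4, P2)] [] [(P0, P4), (P1, P2), (P3, P0)] [(P0, P2),
  (P3, P1), (P4, P0)]) (Five [(P0, P2), (P1, P4), (P2, P3)] [(P1, P0), (P2, P4), (P4, P3)] [(P0,
  P3), (P2, P0), (P4, P1)] [] [(P0, P1), (P1, P3), (P4, P2)]) (Five [(P0, P3), (P1, P2), (P2, P4)]
  [(P0, P4), (P1, P3), (P3, P2)] [(P1, P0), (P2, P1), (P3, P4)] [(P1, P4), (P2, P0), (P3, P1)] []))"

definition "rep_2 =
  (Five (Five [] [(P1, P0), (P2, P3), (P3, P2)] [(P2, P0), (P3, P1), (P4, P3)] [(P1, P4), (P2, P1),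
  (P4, P2)] [(P1, P3), (P3, P0), (P4, P1)]) (Five [(P0, P1), (P2, P4), (P4, P3)] [] [(P2, P3), (P3,
  P4), (P4, P1)] [(P0, P4), (P3, P1), (P4, P0)] [(P0, P3), (P2, P0), (P3, P2)]) (Five [(P0, P2),
  (P1, P4), (P4, P1)] [(P0, P3), (P3, P4), (P4, P0)] [] [(P0, P1), (P1, P2), (P3, P0)] [(P1, P0),
  (P3, P1), (P4, P2)]) (Five [(P0, P4), (P2, P3), (P4, P2)] [(P0, P2), (P1, P3), (P2, P4)] [(P0,
  P1), (P1, P4), (P4, P0)] [] [(P1, P2), (P2, P1), (P4, P3)]) (Five [(P1, P3), (P2, P1), (P3, P2)]
  [(P0, P4), (P1, P2), (P2, P0)] [(P0, P3), (P2, P4), (P3, P0)] [(P0, P2), (P1, P0), (P3, P4)] []))"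

definition "rep_3 =
  (Five (Five [] [(P1, P0), (P2, P3), (P3, P4)] [(P1, P4), (P3, P1), (P4, P3)] [(P1, P2), (P3, P0),
  (P4, P1)] [(P1, P3), (P2, P1), (P3, P2)]) (Five [(P0, P1), (P2, P4), (P3, P2)] [] [(P0, P3), (P2,
  P1), (P4, P0)] [(P0, P4), (P2, P0), (P4, P2)] [(P0, P2), (P2, P3), (P3, P0)]) (Five [(P1, P3),
  (P3, P4), (P4, P1)] [(P0, P4), (P1, P2), (P4, P3)] [] [(P0, P1), (P1, P4), (P4, P0)] [(P1, P0),
  (P3, P1), (P4, P2)]) (Five [(P0, P3), (P1, P4), (P4, P2)] [(P0, P2), (P2, P4), (P4, P0)] [(P0,
  P4), (P1, P0), (P4, P1)] [] [(P0, P1), (P2, P0), (P4, P3)]) (Five [(P1, P2), (P2, P3), (P3, P1)]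
  [(P0, P3), (P2, P0), (P3, P2)] [(P1, P3), (P2, P4), (P3, P0)] [(P0, P2), (P2, P1), (P3, P4)] []))"

definition "rep_4 =
  (Five (Five [] [(P1, P0), (P2, P3), (P3, P4)] [(P2, P0), (P3, P1), (P4, P3)] [(P1, P2), (P2, P4),
  (P4, P1)] [(P1, P3), (P3, P2), (P4, P0)]) (Five [(P0, P1), (P3, P2), (P4, P3)] [] [(P0, P3), (P2,
  P1), (P3, P4)] [(P0, P4), (P2, P0), (P4, P2)] [(P2, P3), (P3, P0), (P4, P1)]) (Five [(P0, P2),
  (P1, P3), (P3, P4)] [(P1, P2), (P3, P0), (P4, P3)] [] [(P0, P1), (P1, P4), (P4, P0)] [(P0, P3),
  (P3, P1), (P4, P2)]) (Five [(P1, P4), (P2, P1), (P4, P2)] [(P0, P2), (P2, P4), (P4, P0)] [(P0,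
  P4), (P1, P0), (P4, P1)] [] [(P0, P1), (P1, P2), (P2, P0)]) (Five [(P0, P4), (P2, P3), (P3, P1)]
  [(P0, P3), (P1, P4), (P3, P2)] [(P1, P3), (P2, P4), (P3, P0)] [(P0, P2), (P1, P0), (P2, P1)] []))"

definition "rep_5 =
  (Five (Five [] [(P1, P0), (P2, P3), (P3, P4)] [(P1, P4), (P3, P1), (P4, P3)] [(P1, P2), (P2, P4),
  (P4, P1)] [(P1, P3), (P3, P2), (P4, P0)]) (Five [(P0, P1), (P3, P2), (P4, P3)] [] [(P0, P3), (P2,
  P1), (P3, P4)] [(P0, P4), (P2, P0), (P4, P2)] [(P0, P2), (P2, P3), (P3, P0)]) (Five [(P1, P3),
  (P3, P4), (P4, P1)] [(P1, P2), (P3, P0), (P4, P3)] [] [(P0, P1), (P1, P4), (P4, P0)] [(P0, P3),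
  (P3, P1), (P4, P2)]) (Five [(P1, P4), (P2, P1), (P4, P2)] [(P0, P2), (P2, P4), (P4, P0)] [(P0,
  P4), (P1, P0), (P4, P1)] [] [(P0, P1), (P1, P2), (P2, P0)]) (Five [(P0, P4), (P2, P3), (P3, P1)]
  [(P0, P3), (P2, P0), (P3, P2)] [(P1, P3), (P2, P4), (P3, P0)] [(P0, P2), (P1, P0), (P2, P1)] []))"

definition "rep_6 =
  (Five (Five [] [(P2, P3), (P3, P4), (P4, P2)] [(P1, P4), (P3, P1), (P4, P3)] [(P1, P2), (P2, P4),
  (P4, P1)] [(P1, P3), (P2, P1), (P3, P2)]) (Five [(P2, P4), (P3, P2), (P4, P3)] [] [(P0, P3), (P3,
  P4), (P4, P0)] [(P0, P4), (P2, P0), (P4, P2)] [(P0, P2), (P2, P3), (P3, P0)]) (Five [(P1, P3),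
  (P3, P4), (P4, P1)] [(P0, P4), (P3, P0), (P4, P3)] [] [(P0, P1), (P1, P4), (P4, P0)] [(P0, P3),
  (P1, P0), (P3, P1)]) (Five [(P1, P4), (P2, P1), (P4, P2)] [(P0, P2), (P2, P4), (P4, P0)] [(P0,
  P4), (P1, P0), (P4, P1)] [] [(P0, P1), (P1, P2), (P2, P0)]) (Five [(P1, P2), (P2, P3), (P3, P1)]
  [(P0, P3), (P2, P0), (P3, P2)] [(P0, P1), (P1, P3), (P3, P0)] [(P0, P2), (P1, P0), (P2, P1)] []))"

definition "rep_7 =
  (Five (Five [] [(P1, P0), (P2, P3), (P3, P4)] [(P1, P4), (P3, P1), (P4, P3)] [(P1, P2), (P2, P4),
  (P4, P1)] [(P1, P3), (P2, P1), (P3, P2)]) (Five [(P0, P1), (P3, P2), (P4, P3)] [] [(P0, P3), (P3,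
  P4), (P4, P0)] [(P0, P4), (P2, P0), (P4, P2)] [(P0, P2), (P2, P3), (P3, P0)]) (Five [(P1, P3),
  (P3, P4), (P4, P1)] [(P0, P4), (P3, P0), (P4, P3)] [] [(P0, P1), (P1, P4), (P4, P0)] [(P0, P3),
  (P3, P1), (P4, P2)]) (Five [(P1, P4), (P2, P1), (P4, P2)] [(P0, P2), (P2, P4), (P4, P0)] [(P0,
  P4), (P1, P0), (P4, P1)] [] [(P0, P1), (P1, P2), (P2, P0)]) (Five [(P1, P2), (P2, P3), (P3, P1)]
  [(P0, P3), (P2, P0), (P3, P2)] [(P1, P3), (P2, P4), (P3, P0)] [(P0, P2), (P1, P0), (P2, P1)] []))"

definition "reps = [rep_0, rep_1, rep_2, rep_3, rep_4, rep_5, rep_6, rep_7]"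

text \<open>
  As arcs, with the cell \<open>(0, 1)\<close> itself as the marked arc: a path of length two together with a
  2-cycle, the marked arc lying on the path.
\<close>

definition "pattern_1 = [(P1, P2), (P3, P4), (P4, P3)]"

text \<open>
  A path of length four, the marked arc being an inner one.
\<close>

definition "pattern_2 = [(P1, P2), (P2, P3), (P4, P0)]"

text \<open>
  A path of length four, the marked arc being an outer one.
\<close>

definition "pattern_3 = [(P1, P2), (P2, P3), (P3, P4)]"

text \<open>
  A directed 4-cycle.
\<close>

definition "pattern_4 = [(P1, P2), (P2, P3), (P3, P0)]"

text \<open>
  A 2-cycle containing the marked arc, together with a path of length two. The three remaining
  configurations are two 2-cycles, and a 3-cycle with a separate arc, marked in either part. They
  are left to the final tree, which starts without any edges.
\<close>

definition "pattern_5 = [(P1, P0), (P2, P3), (P3, P4)]"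

definition "cert_1 =
 Row P1 P2 P3 P4 [Row P1 P2 P2 P4 [Row P2 P3 P0 P3 [Row P3 P0 P0 P4 [Row P3 P4 P1 P2 [Row P3 P4 P2
P4 [Col P1 P0 P2 P3 [Col P0 P2 P3 P4 [Col P4 P2 P0 P1 [Col P4 P3 P0 P2 [Col P3 P2 P0 P1 [Row P1 P3
P0 P3 [Row P2 P0 P0 P3 [Row P1 P3 P0 P2 [Row P0 P2 P3 P4 [Row P1 P0 P2 P4 [Col P4 P0 P1 P2
[]]]]]]]],Row P1 P0 P2 P4 [Row P0 P2 P3 P4 [Row P0 P4 P1 P3 [Row P2 P0 P0 P4 [Col P2 P4 P1 P3 [Row
P1 P3 P0 P3 [Row P1 P3 P0 P4 [Row P4 P0 P0 P2 []]]]]]]]]]]],Row P3 P4 P2 P4 [Col P2 P0 P1 P3 [Row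
P2 P0 P0 P1 [Row P0 P2 P1 P4 [Row P0 P2 P3 P4 [Row P1 P3 P0 P2 [Row P1 P4 P2 P3 []]]]]],Row P4 P0
P0 P1 [Row P2 P0 P0 P4 [Row P2 P0 P0 P3 [Col P3 P2 P1 P3 [Row P4 P1 P1 P3 [Row P1 P3 P0 P2 [],Row
P1 P4 P2 P3 []]]],Row P2 P0 P0 P3 [Row P3 P1 P1 P4 [Col P1 P4 P0 P2 [Row P3 P1 P0 P4 []]]],Row P1
P3 P0 P2 [Row P1 P3 P0 P4 [Col P0 P3 P1 P2 [Col P1 P0 P2 P3 [Row P2 P1 P0 P4 [Row P0 P2 P1 P3 [Row
P0 P3 P1 P2 [Row P2 P1 P3 P4 [Row P4 P0 P1 P2 [Row P4 P1 P2 P3 [Col P1 P0 P1 P3 []]]]]]]]]]]]],Row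
P2 P3 P3 P4 [Col P2 P0 P1 P3 [Col P1 P0 P1 P3 [Col P2 P1 P3 P4 [Row P2 P4 P0 P1 [Row P2 P4 P1 P3
[Col P2 P4 P1 P3 [Row P2 P0 P0 P3 [Row P2 P1 P3 P4 [Row P4 P2 P0 P1 []]]]]]],Row P0 P4 P1 P3 [Row
P3 P1 P0 P4 [Row P1 P0 P0 P2 [Col P2 P4 P1 P2 []]]],Row P4 P2 P0 P1 [Col P4 P2 P0 P1 [Row P2 P1 P0
P3 []]]],Col P2 P0 P1 P4 [],Col P2 P0 P1 P4 [Row P4 P3 P1 P3 [Row P2 P0 P0 P3 [Col P0 P2 P3 P4 [Col
P1 P4 P2 P3 [Row P2 P4 P0 P1 [Row P0 P4 P1 P3 [Row P2 P4 P0 P3 []]]]]]]]],Col P3 P1 P2 P3 [Row P0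
P2 P2 P4 [Row P4 P0 P0 P1 [Row P2 P0 P1 P3 [Row P0 P2 P1 P4 [Row P1 P3 P0 P4 [Row P2 P0 P3 P4
[]]]]],Col P3 P1 P3 P4 [Row P3 P1 P2 P4 [Row P1 P4 P0 P2 [Col P1 P4 P0 P2 [Col P4 P0 P1 P2 [Row P3
P2 P0 P1 []]]],Row P4 P0 P0 P1 []]],Row P4 P0 P1 P3 [Col P0 P2 P3 P4 [Row P2 P0 P0 P1 [Col P2 P0 P1
P4 [Row P3 P1 P2 P4 [Row P3 P0 P2 P4 [Row P2 P1 P0 P4 [Col P0 P3 P1 P2 [Col P0 P4 P1 P2 [Row P1 P4
P0 P3 [Row P1 P4 P2 P3 []]]]]]]]]]]]],Col P3 P1 P2 P3 [Col P0 P4 P1 P2 [Row P4 P1 P0 P3 []]]]],Row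
P3 P4 P1 P4 [Col P1 P3 P0 P4 [Col P4 P3 P0 P2 [Row P4 P2 P0 P1 [Col P4 P2 P0 P1 [Row P2 P1 P0 P3
[]]],Col P1 P3 P2 P4 [Row P2 P0 P0 P4 [Col P4 P1 P2 P3 [Col P2 P1 P3 P4 [Row P4 P1 P1 P3
[]]]]]],Row P2 P0 P1 P4 [Col P2 P3 P0 P1 [Row P2 P0 P0 P1 [Row P0 P2 P3 P4 [Col P2 P4 P1 P2 [Row P0
P4 P1 P3 [Col P0 P4 P1 P2 [Col P1 P4 P0 P2 [Row P0 P3 P1 P4 [Row P1 P4 P2 P3 [Row P1 P0 P2 P3 [Row
P1 P3 P0 P3 []]]]]]]]]]]],Row P2 P0 P1 P4 [Row P2 P0 P0 P1 [Row P0 P2 P3 P4 [Row P2 P4 P0 P4 [Row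
P4 P0 P0 P1 []]]]]]]],Row P3 P0 P0 P2 [Row P4 P1 P0 P2 [Row P0 P2 P2 P3 [Col P2 P4 P1 P2 [Col P3 P4
P2 P3 [Row P2 P4 P0 P1 [Row P2 P1 P0 P3 [Row P2 P1 P0 P4 [Col P2 P3 P0 P1 [Col P0 P3 P1 P2 [Col P0
P4 P1 P2 []]]]]]]]],Row P4 P1 P1 P2 [Col P0 P3 P2 P4 [Row P1 P4 P0 P3 [Row P1 P4 P2 P3 [Row P0 P3
P1 P2 [Row P4 P3 P1 P3 []]]]]],Col P4 P1 P2 P3 [Row P2 P4 P1 P4 [Row P2 P4 P0 P1 [Col P2 P1 P3 P4
[Col P2 P1 P0 P3 [Col P1 P4 P0 P3 [Row P1 P0 P2 P4 [Row P0 P3 P1 P4 [Row P0 P2 P3 P4 [Row P4 P2 P0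
P3 []]]]]]]],Row P2 P4 P0 P1 [Row P2 P0 P0 P4 [Row P1 P3 P0 P2 [Col P1 P3 P0 P4 [Row P2 P1 P0 P3
[Row P2 P1 P0 P4 [Col P2 P1 P3 P4 [Row P1 P4 P0 P3 [Col P1 P4 P0 P2 [Row P2 P0 P1 P4 []]]]]]]],Row
P2 P0 P0 P3 [Col P2 P3 P0 P1 [Row P2 P1 P0 P4 [Row P2 P1 P3 P4 [Row P3 P1 P0 P4 [Col P4 P2 P1 P3
[Row P3 P1 P1 P4 [Row P1 P4 P0 P2 [Col P1 P4 P0 P2 [Col P2 P0 P3 P4 [Row P0 P2 P1 P4 [Row P0 P4 P1
P3 [Row P4 P0 P0 P3 []]]]]]]]]]]],Col P2 P0 P1 P3 [Row P3 P4 P1 P4 []]]]]]]]]],Row P2 P3 P0 P4 [Col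
P4 P0 P1 P4 [Row P4 P0 P1 P3 [Row P0 P4 P1 P3 [Row P0 P4 P2 P3 [Row P1 P3 P2 P3 [Col P4 P3 P0 P2
[Col P1 P4 P0 P3 [Col P0 P2 P3 P4 [Col P3 P2 P1 P4 [Row P3 P2 P0 P2 []]]]]]]]],Row P4 P0 P0 P3 [Row
P0 P2 P1 P3 [Col P0 P4 P1 P3 [Col P0 P2 P1 P4 [Row P1 P4 P0 P2 [Row P1 P4 P2 P3 [Col P0 P4 P2 P3
[Col P0 P3 P1 P2 [Row P3 P1 P0 P4 [Col P3 P1 P0 P4 [Row P0 P4 P1 P3 [Col P1 P0 P2 P3 [Col P1 P0 P2
P4 [Row P2 P1 P3 P4 [Col P2 P1 P0 P3 [Col P1 P3 P0 P4 [Row P2 P0 P1 P3 [Col P2 P4 P1 P3 [Row P2 P0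
P1 P4 [Col P2 P0 P1 P3 [Row P3 P0 P2 P4 [Row P3 P2 P0 P4 [Found (Keep P0 P2 P4 P1
P3)]]]]]]]]]]]]]]]]]]],Col P0 P4 P2 P3 [Col P3 P1 P0 P2 [Row P4 P2 P1 P3 []]],Col P0 P4 P2 P3 [Row
P1 P4 P0 P3 [Row P1 P4 P2 P3 [Col P0 P2 P1 P4 [Col P0 P3 P1 P2 [Row P2 P1 P0 P4 []]]]]]]],Row P1 P4
P2 P3 [Row P4 P3 P1 P3 [Row P4 P3 P2 P3 [Row P1 P0 P2 P3 [Row P2 P4 P0 P1 [Col P1 P0 P2 P4 [Row P0
P4 P2 P3 [Col P0 P4 P1 P3 [Row P0 P2 P1 P4 [Row P3 P2 P1 P2 []]]]]]]]]]],Row P3 P4 P1 P2 [Col P4 P0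
P1 P2 [Row P0 P2 P1 P3 [Col P0 P2 P1 P3 [Row P2 P1 P3 P4 [Col P2 P1 P3 P4 [Row P1 P3 P0 P4 [Col P0
P4 P2 P3 [Col P0 P3 P1 P2 [Col P0 P4 P1 P3 []],Col P0 P4 P1 P3 [Row P1 P4 P2 P3 [Row P0 P4 P1 P2
[Row P3 P1 P1 P4 []]]]]]]]]]]]]]],Row P2 P4 P0 P3 [Row P3 P0 P0 P4 [Row P4 P3 P2 P3 [Row P4 P3 P1
P3 [Col P2 P0 P1 P4 [Col P1 P4 P0 P1 [Row P2 P0 P0 P1 [Row P0 P2 P1 P3 [Row P0 P2 P3 P4 [Row P0 P4
P1 P2 [Col P0 P4 P1 P2 [Row P1 P3 P2 P4 [Row P0 P3 P1 P4 [Row P1 P4 P0 P3 [Row P1 P0 P2 P3 [Row P1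
P3 P2 P3 []]]]]]]]]]]],Row P3 P2 P0 P2 [Row P3 P2 P0 P1 [Col P4 P2 P0 P1 [Col P3 P4 P0 P2 [Col P1
P0 P1 P4 [Row P3 P0 P2 P4 [Col P1 P0 P3 P4 [Col P2 P4 P0 P1 [Row P0 P3 P3 P4 []]]]]]],Row P1 P4 P0
P2 [Row P2 P0 P1 P3 [Row P2 P0 P0 P1 [Row P0 P2 P1 P3 [Row P0 P2 P3 P4 [Row P0 P4 P1 P2 [Col P0 P4
P2 P3 [Col P0 P3 P1 P2 [Col P3 P1 P2 P4 [Col P4 P0 P1 P2 [Row P1 P0 P2 P3 [Row P1 P3 P2 P3
[]]]]]]]]]]]]]]],Row P3 P2 P0 P1 [Col P3 P2 P1 P4 [Row P4 P3 P1 P2 [Col P1 P0 P1 P4 [Row P3 P0 P2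
P4 [Col P1 P0 P3 P4 [Row P2 P3 P0 P1 [Row P2 P3 P1 P4 [Row P4 P1 P0 P3 []]]]]]]],Row P4 P3 P1 P2
[Col P1 P0 P2 P4 [Col P0 P2 P3 P4 [Row P0 P3 P1 P3 [Row P0 P2 P3 P4 [Col P3 P1 P2 P4 [Row P0 P3 P1
P4 [Row P2 P3 P1 P4 [Col P2 P3 P0 P1 [Col P2 P4 P0 P1 [Col P4 P0 P1 P2 [Row P1 P0 P2 P3 [Col P2 P0
P1 P3 [Col P2 P0 P1 P4 [Row P3 P4 P1 P4 []]]]]]]]]]]]]]]]],Row P3 P0 P0 P2 [Col P2 P1 P3 P4 [Row P4
P1 P1 P2 [Col P1 P4 P0 P3 [Row P2 P3 P1 P4 [Row P2 P3 P0 P1 [Col P2 P1 P0 P4 [Row P1 P3 P0 P4 [Col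
P1 P3 P0 P4 [Row P1 P4 P0 P3 [Col P0 P4 P1 P2 [Row P2 P4 P3 P4 []]]]]]]]]],Col P2 P3 P1 P4 [Row P4
P1 P1 P2 [Row P4 P1 P0 P2 [Col P0 P2 P3 P4 [Row P2 P3 P0 P4 [Row P0 P2 P2 P3 [Row P1 P3 P0 P2 [Col
P1 P3 P0 P2 [Col P2 P1 P2 P3 []]]]]]]]],Col P2 P1 P0 P3 [Col P1 P4 P0 P3 [Row P1 P0 P2 P4 [Row P2
P3 P1 P4 [Row P2 P3 P0 P1 [Col P2 P4 P0 P1 [Row P0 P4 P1 P3 [Col P0 P3 P1 P2 [Row P4 P1 P1 P2
[]]]]]]]]]]]],Col P2 P4 P0 P3 [Col P4 P0 P1 P2 [Row P4 P0 P1 P3 [Row P0 P2 P1 P3 [Row P4 P3 P2 P3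
[Col P2 P0 P1 P2 [Row P4 P3 P1 P3 [Row P1 P4 P2 P3 [Col P0 P2 P1 P3 [Row P1 P3 P0 P2 [Col P2 P0 P1
P4 [Row P1 P3 P2 P3 []]]]]]],Col P0 P3 P2 P4 [Col P4 P1 P2 P3 [Col P2 P0 P1 P3 [Col P0 P3 P1 P4
[Row P2 P0 P1 P4 [Row P2 P0 P3 P4 [Col P3 P1 P0 P2 [Col P1 P0 P2 P4 [Row P1 P3 P0 P2 [Col P0 P2 P1
P3 [Row P1 P4 P3 P4 []]]]]]]]]]]]]],Row P4 P3 P2 P3 [Row P2 P0 P1 P3 [Row P4 P3 P1 P3 []]]]]]],Row
P1 P2 P2 P3 [Row P2 P3 P0 P4 [Row P3 P4 P2 P4 [Row P2 P0 P0 P1 [Row P2 P0 P1 P4 [Col P0 P2 P3 P4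
[Row P3 P4 P1 P4 [Row P1 P3 P0 P4 [Row P0 P2 P3 P4 [Col P1 P3 P2 P4 [Row P3 P2 P0 P4 [Col P3 P2 P0
P1 [Col P3 P0 P1 P2 [Row P4 P1 P0 P2 [Row P4 P3 P2 P3 []]]]]]]]]],Row P0 P2 P3 P4 [Col P3 P0 P1 P2
[Col P2 P3 P0 P1 [Row P4 P0 P2 P3 [Col P4 P0 P1 P3 [Row P2 P4 P0 P1 [Row P2 P4 P0 P3 [Col P0 P3 P1
P2 [Col P0 P3 P2 P4 [Row P0 P2 P1 P4 [Row P1 P4 P2 P3 [Row P1 P0 P2 P3 [Row P1 P0 P2 P4 [Row P4 P3
P2 P3 []]]]]]]]]]]],Row P3 P4 P1 P4 [Row P0 P2 P1 P4 [Row P1 P3 P0 P2 [Row P1 P3 P0 P4 [Row P1 P4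
P2 P3 [Row P2 P1 P0 P3 [Row P4 P1 P1 P3 []]]]]]]]]],Row P4 P0 P0 P3 [Row P4 P0 P0 P2 [Col P2 P4 P1
P3 [Col P2 P1 P3 P4 [Row P3 P1 P1 P2 []]]]],Row P3 P4 P1 P4 [Row P2 P0 P0 P4 [Row P1 P3 P0 P4 [Row
P1 P3 P3 P4 [Row P0 P2 P3 P4 [Col P2 P3 P0 P1 [Row P3 P0 P1 P4 [Col P3 P1 P0 P2 [Row P0 P2 P2 P4
[Row P2 P1 P3 P4 [],Row P2 P4 P1 P3 [Col P2 P1 P0 P3 [Col P2 P1 P0 P4 [Col P1 P4 P2 P3 [Row P2 P4
P3 P4 []]]]]]]]]]]]]]],Row P4 P2 P0 P1 [Row P4 P0 P0 P3 [Row P4 P0 P0 P2 [Col P0 P4 P1 P2 [Row P0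
P4 P1 P4 [Row P3 P4 P1 P2 [Row P3 P1 P1 P2 []]],Col P2 P3 P0 P1 [Row P3 P0 P1 P4 [Col P2 P0 P1 P4
[Col P3 P0 P1 P2 [Col P3 P1 P2 P4 []]]]],Row P2 P4 P1 P3 [Row P2 P4 P0 P3 [Col P0 P2 P1 P3 [Row P1
P3 P0 P4 []]]]]]],Row P3 P4 P1 P2 [Col P4 P2 P1 P3 [Row P1 P0 P2 P3 [Row P4 P0 P2 P3 [Row P0 P4 P1
P4 [Col P2 P3 P0 P1 [Row P0 P4 P1 P3 [Row P2 P1 P0 P3 [Row P1 P0 P0 P3 []]]]]],Row P4 P0 P2 P3 [Col
P4 P0 P1 P3 [Col P1 P0 P3 P4 [Row P2 P4 P0 P1 [Row P2 P4 P1 P3 [Row P3 P1 P0 P4 []]]]]]]]],Row P3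
P4 P1 P2 [Row P0 P4 P1 P4 [Col P4 P1 P2 P3 [Row P0 P4 P1 P3 [Row P0 P2 P3 P4 [Col P2 P3 P0 P1 [Col
P2 P4 P0 P1 [Col P3 P0 P1 P2 [Row P1 P0 P2 P4 [Col P2 P0 P1 P4 [Col P3 P1 P0 P4 [Row P0 P2 P1 P4
[Col P0 P2 P3 P4 [Row P2 P4 P1 P3 [Col P2 P1 P3 P4 [Col P2 P0 P1 P3 [Row P4 P3 P1 P3
[]]]]]]]]]]]]]]]]]]],Col P2 P3 P0 P4 [Col P3 P0 P1 P2 [Row P3 P0 P1 P4 [Row P0 P2 P1 P4 [Row P3 P4
P2 P4 [Col P2 P0 P1 P2 [Row P3 P4 P1 P4 [Row P1 P3 P2 P4 [Col P0 P2 P1 P4 [Row P1 P4 P0 P2 [Col P2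
P0 P1 P3 [Row P1 P4 P2 P4 []]]]]]],Col P0 P4 P2 P3 [Col P3 P1 P2 P4 [Col P2 P0 P1 P4 [Col P0 P4 P1
P3 [Row P2 P0 P1 P3 [Row P2 P0 P3 P4 [Row P3 P4 P1 P2 [Col P1 P0 P2 P3 [Row P4 P2 P0 P1
[]]]]]]]]]]]],Row P3 P4 P2 P4 [Row P2 P0 P1 P4 [Row P3 P4 P1 P4 []]]]]],Row P2 P4 P0 P4 [Row P4 P0
P0 P3 [Row P4 P3 P1 P2 [Row P4 P3 P2 P3 [Col P1 P0 P2 P4 [Col P0 P2 P3 P4 [Col P3 P2 P0 P1 [Col P3
P4 P0 P2 [Col P4 P2 P0 P1 [Row P1 P4 P0 P4 [Row P2 P0 P0 P4 [Row P1 P4 P0 P2 [Row P0 P2 P3 P4 [Row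
P1 P0 P2 P3 [Col P3 P0 P1 P2 []]]]]]]],Row P1 P0 P2 P3 [Row P0 P2 P3 P4 [Row P0 P3 P1 P4 [Row P2 P0
P0 P3 [Col P2 P3 P1 P4 [Row P1 P4 P0 P4 [Row P1 P4 P0 P3 [Row P3 P0 P0 P2 []]]]]]]]]]]],Row P4 P3
P2 P3 [Col P2 P0 P1 P4 [Row P2 P0 P0 P1 [Row P0 P2 P1 P3 [Row P0 P2 P3 P4 [Row P1 P3 P2 P4 [Row P1
P4 P0 P2 []]]]]],Row P3 P0 P0 P1 [Row P2 P0 P0 P3 [Row P2 P0 P0 P4 [Col P4 P2 P1 P4 [Row P3 P1 P1
P4 [Row P1 P3 P2 P4 [],Row P1 P4 P0 P2 []]]],Row P2 P0 P0 P4 [Row P4 P1 P1 P3 [Col P1 P3 P0 P2 [Row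
P4 P1 P0 P3 []]]],Row P1 P4 P0 P2 [Row P1 P4 P0 P3 [Col P0 P4 P1 P2 [Col P1 P0 P2 P4 [Row P2 P1 P0
P3 [Row P0 P2 P1 P4 [Row P0 P4 P1 P2 [Row P2 P1 P3 P4 [Row P3 P0 P1 P2 [Row P3 P1 P2 P4 [Col P1 P0
P1 P4 []]]]]]]]]]]]],Row P2 P4 P3 P4 [Col P4 P1 P2 P4 [Row P0 P2 P2 P3 [Row P3 P0 P0 P1 [Row P2 P0
P1 P4 [Row P0 P2 P1 P3 [Row P1 P3 P2 P4 [Row P1 P4 P0 P3 [Row P2 P0 P3 P4 []]]]]],Col P4 P1 P3 P4
[Row P3 P0 P0 P1 [Row P3 P0 P1 P4 [],Row P1 P3 P0 P2 [Col P3 P0 P1 P2 [Row P4 P2 P0 P1 []]]]],Row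
P3 P0 P1 P4 [Col P0 P2 P3 P4 [Row P2 P0 P0 P1 [Col P2 P0 P1 P3 [Row P4 P1 P2 P3 [Row P4 P0 P2 P3
[Row P2 P1 P0 P3 [Col P0 P4 P1 P2 [Col P0 P3 P1 P2 [Row P1 P3 P0 P4 [Row P1 P3 P2 P4
[]]]]]]]]]]]]],Col P4 P1 P2 P4 [Col P0 P3 P1 P2 [Row P3 P1 P0 P4 []]],Col P2 P0 P1 P4 [Col P1 P0 P1
P4 [Col P2 P1 P3 P4 [Row P2 P3 P0 P1 [Row P2 P3 P1 P4 [Col P2 P3 P1 P4 [Row P2 P0 P0 P4 [Row P2 P1
P3 P4 [Row P3 P2 P0 P1 []]]]]]],Row P0 P3 P1 P4 [Row P4 P1 P0 P3 [Row P1 P0 P0 P2 [Col P2 P3 P1 P2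
[]]]],Row P3 P2 P0 P1 [Col P3 P2 P0 P1 [Row P2 P1 P0 P4 []]]],Col P2 P0 P1 P3 [],Col P2 P0 P1 P3
[Row P3 P4 P1 P4 [Row P2 P0 P0 P4 [Col P0 P2 P3 P4 [Col P1 P3 P2 P4 [Row P2 P3 P0 P1 [Row P0 P3 P1
P4 [Row P2 P3 P0 P4 []]]]]]]]]]],Row P4 P3 P1 P3 [Col P1 P4 P0 P3 [Col P3 P4 P0 P2 [Row P3 P2 P0 P1
[Col P3 P2 P0 P1 [Row P2 P1 P0 P4 []]],Col P1 P4 P2 P3 [Row P2 P0 P0 P3 [Col P3 P1 P2 P4 [Col P2 P1
P3 P4 [Row P3 P1 P1 P4 []]]]]],Row P2 P0 P1 P3 [Col P2 P4 P0 P1 [Row P2 P0 P0 P1 [Row P0 P2 P3 P4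
[Col P2 P3 P1 P2 [Row P0 P3 P1 P4 [Col P0 P3 P1 P2 [Col P1 P3 P0 P2 [Row P0 P4 P1 P3 [Row P1 P3 P2
P4 [Row P1 P0 P2 P4 [Row P1 P4 P0 P4 []]]]]]]]]]]],Row P2 P0 P1 P3 [Row P2 P0 P0 P1 [Row P0 P2 P3
P4 [Row P2 P3 P0 P3 [Row P3 P0 P0 P1 []]]]]]]],Row P4 P0 P0 P2 [Row P3 P1 P0 P2 [Row P0 P2 P2 P4
[Col P2 P3 P1 P2 [Col P4 P3 P2 P4 [Row P2 P3 P0 P1 [Row P2 P1 P0 P3 [Row P2 P1 P0 P4 [Col P2 P4 P0
P1 [Col P0 P3 P1 P2 [Col P0 P4 P1 P2 []]]]]]]]],Col P3 P1 P2 P4 [Row P2 P3 P0 P1 [Col P2 P3 P1 P4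
[Row P2 P0 P0 P3 [Row P1 P4 P0 P2 [Col P1 P4 P0 P3 [Row P2 P1 P0 P4 [Row P2 P1 P0 P3 [Col P2 P1 P3
P4 [Row P1 P3 P0 P4 [Col P1 P3 P0 P2 [Row P2 P0 P1 P3 []]]]]]]],Row P2 P0 P0 P4 [Col P2 P4 P0 P1
[Row P2 P1 P0 P3 [Row P2 P1 P3 P4 [Col P3 P2 P1 P4 [Row P4 P1 P0 P3 [Row P4 P1 P1 P3 [Row P1 P3 P0
P2 [Col P1 P3 P0 P2 [Col P2 P0 P3 P4 [Row P0 P2 P1 P3 [Row P0 P3 P1 P4 [Row P3 P0 P0 P4
[]]]]]]]]]]]],Col P2 P0 P1 P4 [Row P4 P3 P1 P3 []]]]],Col P2 P1 P3 P4 [Col P2 P1 P0 P4 [Col P1 P3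
P0 P4 [Row P1 P0 P2 P3 [Col P2 P4 P0 P1 [Col P2 P0 P1 P3 [Row P1 P0 P2 P4 [Row P0 P3 P1 P4 [Col P0
P4 P1 P2 [Row P0 P4 P1 P4 []]]]]]]]]]]],Row P3 P1 P1 P2 [Col P0 P4 P2 P3 [Row P1 P3 P0 P4 [Row P1
P3 P2 P4 [Row P0 P4 P1 P2 [Row P3 P4 P1 P4 []]]]]]]]],Row P2 P4 P0 P3 [Col P3 P0 P1 P3 [Row P3 P0
P1 P4 [Row P0 P3 P1 P4 [Row P0 P3 P2 P4 [Row P1 P4 P2 P4 [Col P3 P4 P0 P2 [Col P1 P3 P0 P4 [Col P0
P2 P3 P4 [Col P4 P2 P1 P3 [Row P4 P2 P0 P2 []]]]]]]]],Row P3 P0 P0 P4 [Row P0 P2 P1 P4 [Col P0 P3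
P1 P4 [Col P0 P2 P1 P3 [Row P1 P3 P0 P2 [Row P1 P3 P2 P4 [Col P0 P3 P2 P4 [Col P0 P4 P1 P2 [Col P3
P2 P1 P4 [Col P4 P1 P0 P3 [Row P0 P3 P1 P4 [Col P1 P0 P2 P3 [Col P1 P0 P2 P4 [Row P2 P1 P3 P4 [Col
P2 P1 P0 P4 [Col P1 P4 P0 P3 [Row P2 P0 P1 P4 [Col P2 P3 P1 P4 [Row P2 P0 P1 P3 [Col P2 P0 P1 P4
[Col P3 P1 P0 P2 [Row P4 P2 P0 P3 [Found (Keep P0 P2 P3 P1 P4)]]]]]]]]]]]]]]]]]]],Col P0 P3 P2 P4
[Row P1 P3 P0 P4 [Row P1 P3 P2 P4 [Col P0 P2 P1 P3 [Col P0 P4 P1 P2 [Row P2 P1 P0 P3 []]]]]],Col P0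
P3 P2 P4 [Row P3 P2 P1 P4 [Row P4 P1 P1 P3 []]]]],Row P1 P3 P2 P4 [Row P3 P4 P1 P4 [Row P3 P4 P2 P4
[Row P1 P0 P2 P4 [Row P2 P3 P0 P1 [Col P1 P0 P2 P3 [Row P0 P3 P2 P4 [Col P0 P3 P1 P4 [Row P0 P2 P1
P3 [Row P4 P2 P1 P2 []]]]]]]]]]],Col P3 P0 P1 P2 [Row P4 P3 P1 P2 [Row P0 P2 P1 P4 [Col P0 P2 P1 P4
[Row P2 P1 P3 P4 [Col P2 P1 P3 P4 [Row P1 P4 P0 P3 [Col P0 P3 P1 P4 [Col P0 P3 P2 P4 [Col P0 P4 P1
P2 []],Col P0 P3 P2 P4 [Row P1 P3 P2 P4 [Row P0 P3 P1 P2 [Row P4 P1 P1 P3 []]]]]]]]]]]]]]]]]"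

definition "cert_2 =
 Row P2 P3 P1 P4 [Row P2 P3 P3 P4 [Col P3 P2 P0 P1 [Col P4 P0 P2 P3 [Col P1 P2 P3 P4 [Row P3 P2 P0
P1 [Row P4 P0 P2 P3 [Row P2 P4 P1 P3 [Row P0 P2 P2 P4 [Col P1 P2 P0 P4 [Row P2 P4 P0 P1 [Row P1 P4
P0 P3 [Col P1 P4 P0 P3 []]],Known (Flip P2 P1 P0 P3 P4)],Row P2 P4 P0 P1 [Row P0 P3 P1 P3 [Row P0
P2 P3 P4 [Row P1 P4 P0 P3 [Col P1 P2 P0 P4 [Row P1 P4 P0 P2 [Col P1 P4 P2 P3 [Row P3 P0 P2 P4
[]]]]]]]],Col P0 P2 P1 P3 []]],Row P3 P4 P1 P2 [Col P0 P4 P0 P1 [Col P4 P1 P0 P3 [Col P2 P1 P0 P3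
[Row P2 P1 P0 P1 [Known (Flip P1 P2 P0 P3 P4)]]]]]],Row P1 P4 P0 P4 [Col P4 P1 P0 P3 [Row P1 P4 P2
P4 [Row P4 P1 P0 P1 [Row P0 P4 P2 P3 [Row P0 P4 P1 P2 [Row P0 P2 P1 P4 [Row P4 P2 P0 P1 [Row P1 P3
P2 P3 [Row P1 P0 P3 P4 [Row P3 P4 P0 P2 []]]]]]]]]]]],Row P1 P2 P3 P4 [Row P4 P0 P2 P3 [Row P3 P4
P1 P2 [Row P3 P0 P2 P4 [Col P2 P4 P0 P3 [Col P2 P1 P0 P3 [Row P2 P1 P0 P1 [Known (Flip P1 P2 P0 P3
P4)]]]]]]],Col P1 P2 P0 P3 [Col P3 P4 P0 P1 [Row P4 P0 P2 P3 [Row P2 P4 P1 P3 [Row P3 P0 P1 P2 [Row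
P3 P2 P0 P1 [Col P0 P4 P0 P1 [Row P2 P0 P3 P4 [Row P3 P4 P0 P4 [Known (Flip P4 P3 P0 P1
P2)]]]]]]]]]]]],Known (Keep P2 P3 P4 P0 P1),Known (Flip P3 P2 P4 P0 P1)],Col P1 P2 P3 P4 [Row P4 P0
P1 P2 [Row P4 P0 P2 P3 [Row P2 P4 P1 P3 [Col P3 P1 P0 P2 [Row P1 P0 P2 P4 [Row P1 P4 P0 P3 [Row P2
P4 P0 P1 [Col P1 P0 P3 P4 [Row P1 P3 P0 P2 [Row P3 P4 P0 P1 [Known (Flip P2 P1 P0 P3 P4),Row P3 P2
P1 P4 [Row P3 P4 P0 P2 [Col P3 P2 P0 P4 [Col P3 P4 P1 P2 [Row P2 P1 P3 P4 [Row P0 P3 P1 P3 [Row P0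
P2 P3 P4 [Row P2 P1 P0 P4 [Row P4 P3 P0 P3 []]]]]]]]]]]]],Col P1 P2 P0 P4 [Col P3 P2 P0 P4 [Row P1
P4 P0 P4 [Col P3 P2 P0 P1 [Col P2 P1 P0 P4 [],Row P0 P2 P1 P4 [Row P3 P2 P1 P2 []]]]],Known (Flip
P2 P1 P0 P3 P4)],Row P1 P4 P0 P4 [Row P3 P2 P0 P4 [Row P0 P3 P1 P4 [Row P0 P3 P2 P4 [Row P2 P1 P1
P4 []]]]]]],Row P2 P4 P0 P1 [Row P0 P2 P2 P4 [Col P1 P2 P0 P4 [Row P2 P0 P1 P3 [Row P3 P4 P0 P1
[Row P0 P2 P1 P4 [Row P1 P3 P0 P2 [Row P1 P0 P2 P3 [Row P1 P0 P2 P4 [Row P1 P4 P3 P4 []]]]]]],Known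
(Flip P2 P1 P0 P3 P4)]]],Row P3 P1 P0 P1 [Known (Flip P1 P3 P0 P2 P4)]],Row P2 P4 P0 P1 [Row P3 P2
P0 P1 [Col P1 P0 P3 P4 [Row P3 P2 P0 P4 [Row P0 P3 P1 P4 [Col P0 P4 P2 P3 [Row P1 P0 P2 P4 [Row P0
P4 P2 P3 [Row P1 P3 P0 P2 [Row P1 P4 P0 P3 [Row P2 P3 P3 P4 []]]]]]]]]]]],Row P3 P2 P0 P1 [Row P3
P2 P1 P2 [Row P1 P4 P0 P4 [Row P0 P3 P1 P4 [Col P4 P1 P2 P3 [Row P4 P1 P2 P3 [Col P2 P0 P2 P3 [Row
P0 P3 P2 P4 [Row P2 P1 P1 P4 [Row P1 P0 P2 P4 [Row P1 P0 P3 P4 [Col P2 P1 P0 P4 [Known (Flip P1 P2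
P4 P0 P3),Col P2 P0 P3 P4 [Col P3 P0 P1 P4 []]]]]],Row P0 P2 P1 P2 [Row P2 P4 P1 P4 [Row P4 P2 P0
P1 []]]]],Row P2 P3 P3 P4 [Col P2 P1 P0 P2 [Row P0 P3 P2 P4 [Col P2 P1 P2 P3 [Row P2 P0 P1 P4 [Row
P2 P4 P1 P4 []]]]]]]]]],Row P1 P4 P0 P3 [Row P3 P4 P0 P2 [Row P3 P4 P0 P1 [Known (Flip P2 P1 P0 P3
P4),Row P1 P3 P0 P2 []]],Row P2 P3 P3 P4 [Row P1 P4 P0 P4 [Row P3 P0 P2 P4 [Row P2 P1 P0 P4 [Col P2
P1 P0 P3 [Row P0 P3 P1 P4 [Row P0 P4 P1 P3 [Col P3 P4 P1 P3 []]],Known (Keep P4 P3 P0 P1 P2)],Known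
(Keep P4 P3 P0 P1 P2)]]]],Col P1 P4 P0 P2 [Col P4 P2 P1 P3 []]],Row P2 P4 P0 P1 [Row P0 P3 P1 P4
[Row P0 P3 P1 P2 [Col P2 P4 P1 P3 [Row P0 P2 P2 P4 [Row P0 P4 P1 P2 [Row P2 P1 P1 P4 [Known (Flip
P3 P1 P2 P0 P4)]]]]]]]],Row P3 P2 P1 P2 [Known (Keep P3 P2 P1 P0 P4)],Row P1 P4 P0 P4 [Row P3 P2 P0
P2 [Row P2 P3 P3 P4 [Row P3 P0 P1 P4 [Col P3 P0 P1 P4 [Col P0 P4 P1 P2 [Col P3 P4 P1 P2 [Col P3 P1
P2 P4 [Col P3 P1 P0 P2 [Row P1 P0 P2 P4 []]],Known (Flip P2 P1 P0 P3 P4)]]]],Col P1 P2 P0 P4 [Row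
P3 P0 P1 P2 [Col P2 P4 P1 P2 [Col P0 P3 P2 P4 [Row P3 P0 P0 P1 []]]],Col P0 P3 P0 P2 [Col P3 P0 P1
P3 [Row P2 P0 P1 P4 [Row P2 P1 P1 P4 [Row P2 P1 P0 P4 [Row P2 P0 P0 P1 [Row P2 P4 P0 P4 [Row P2 P4
P1 P4 []]]]]]],Row P0 P3 P1 P4 [Row P2 P0 P1 P4 []],Row P0 P3 P1 P4 [Row P0 P3 P1 P2 [Row P3 P0 P2
P4 []]]],Row P3 P0 P1 P2 [Row P2 P4 P0 P4 [Known (Flip P4 P2 P1 P0 P3)]],Known (Flip P2 P1 P0 P3
P4)]]]]],Row P3 P4 P1 P2 [Row P0 P2 P2 P4 [Row P2 P0 P1 P3 [Row P2 P0 P1 P4 [Row P4 P3 P0 P3 [Row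
P0 P4 P1 P2 [Row P0 P4 P2 P3 [Row P1 P0 P2 P3 [Row P1 P0 P3 P4 [Row P2 P1 P0 P4 [Row P0 P3 P1 P4
[]]]]]]]]],Row P0 P2 P3 P4 [Col P2 P1 P0 P3 [Row P3 P4 P0 P1 [Row P0 P3 P1 P2 [Col P1 P0 P3 P4 [Row
P1 P2 P2 P3 [Row P2 P4 P0 P1 [Row P4 P3 P0 P2 [Row P2 P0 P3 P4 [Col P4 P3 P0 P1 [Col P4 P1 P0 P2
[Col P4 P1 P0 P3 [Row P4 P2 P0 P3 [Row P4 P2 P0 P2 [Row P4 P2 P0 P1 [Row P0 P4 P2 P3 [Row P2 P4 P0
P3 [Row P0 P2 P1 P4 [Row P1 P4 P3 P4 [Row P2 P4 P0 P4 []]]]]],Row P2 P4 P0 P3 [Row P0 P2 P1 P4 [Row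
P4 P2 P0 P1 [Row P0 P4 P2 P3 [Row P1 P3 P0 P3 [Row P2 P3 P3 P4 []]]]]]]]]]],Row P0 P3 P1 P4 [Col P3
P1 P0 P2 [Row P4 P1 P0 P3 [Col P4 P3 P0 P1 [Row P2 P3 P3 P4 [Row P4 P1 P0 P1 []]]]]]]]],Row P1 P3
P0 P2 [Col P2 P4 P0 P3 [Col P2 P4 P1 P3 [Row P3 P0 P1 P4 []]]]]]]],Known (Flip P1 P2 P0 P3
P4)]],Row P3 P4 P0 P1 [Row P2 P1 P0 P1 [Row P0 P3 P1 P2 [Col P1 P0 P3 P4 [Row P2 P1 P0 P4 [Row P0
P3 P1 P4 [Row P0 P2 P1 P4 [Row P0 P2 P3 P4 [Row P4 P2 P0 P3 [],Known (Keep P0 P2 P4 P1 P3)]]],Known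
(Keep P2 P1 P0 P3 P4)]]]]],Row P0 P2 P2 P3 [Col P0 P2 P3 P4 [Row P3 P4 P0 P1 [Col P0 P3 P1 P2 [Row
P2 P1 P0 P4 [Row P2 P1 P0 P1 [Known (Keep P2 P1 P0 P3 P4)]]]],Known (Flip P2 P0 P3 P1 P4)],Row P0
P2 P1 P2 [Row P0 P3 P1 P4 [Row P1 P0 P2 P4 [Row P1 P0 P3 P4 [Row P1 P3 P0 P2 [Row P1 P3 P2 P3
[Known (Keep P1 P3 P2 P0 P4)]]]]]]]]]],Row P4 P0 P1 P3 [Row P1 P4 P0 P4 [Col P2 P4 P1 P2 [Row P2 P4
P0 P1 [Row P3 P2 P0 P1 [Row P3 P2 P1 P2 [Known (Flip P2 P3 P1 P0 P4),Known (Keep P3 P2 P1 P0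
P4)],Col P3 P2 P1 P4 [Row P3 P4 P0 P1 [Row P3 P4 P0 P2 [],Known (Flip P2 P1 P0 P3 P4)]]],Known
(Keep P2 P4 P0 P1 P3)]],Row P2 P4 P1 P3 [Row P2 P4 P0 P3 [Row P1 P3 P0 P4 [Row P1 P0 P2 P4 [Row P1
P0 P3 P4 [Row P3 P4 P0 P2 [Row P0 P3 P1 P2 [Row P0 P3 P1 P4 [Row P0 P2 P1 P4 [Row P0 P2 P3 P4 [Row
P1 P3 P0 P3 [Known (Keep P1 P3 P0 P2 P4)]]]]]]]]],Known (Keep P2 P4 P0 P1 P3)],Col P3 P1 P0 P2 [Row
P1 P0 P2 P4 [Row P1 P3 P3 P4 [Col P1 P2 P0 P4 [Row P1 P3 P2 P4 [Row P1 P4 P0 P3 [Row P3 P0 P2 P4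
[Row P2 P0 P3 P4 [Col P2 P0 P1 P3 [Col P3 P4 P1 P3 []]]]]],Known (Flip P2 P1 P0 P3 P4)],Row P0 P2
P1 P4 [Row P1 P3 P0 P4 [Col P1 P0 P3 P4 [Row P0 P3 P2 P4 [Row P2 P1 P1 P4 []]]]],Row P1 P3 P0 P4
[Row P1 P3 P2 P4 [Known (Keep P1 P3 P4 P0 P2),Row P3 P4 P0 P2 [Col P3 P4 P1 P2 [Row P2 P1 P0 P4
[Row P1 P2 P2 P3 [Row P4 P3 P0 P2 [Col P0 P3 P1 P4 [Row P0 P3 P1 P4 [],Col P4 P2 P1 P3 [Row P0 P2
P2 P4 [Row P0 P2 P3 P4 [Col P0 P3 P2 P4 [Row P0 P4 P1 P3 [Row P3 P1 P0 P4 []]]]]],Row P0 P3 P1 P4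
[Col P1 P0 P3 P4 [Col P2 P0 P1 P3 [Row P3 P1 P0 P4 [Row P0 P2 P2 P4 []]]]]]],Row P1 P4 P0 P3 [Col
P0 P4 P2 P3 [Row P0 P4 P1 P3 [Col P4 P3 P0 P1 [Row P2 P0 P0 P1 []]]]]]]]]]]]],Col P0 P2 P3 P4 [Row
P2 P4 P0 P1 [Col P4 P1 P2 P3 [Row P0 P2 P2 P4 [Col P1 P2 P0 P4 [Row P1 P3 P2 P4 [Row P1 P0 P2 P3
[Row P1 P3 P3 P4 []]],Known (Flip P2 P1 P0 P3 P4)]]]]],Row P3 P1 P0 P1 [Known (Flip P1 P3 P0 P2
P4),Row P1 P3 P2 P4 [Col P1 P2 P0 P4 [Row P1 P4 P0 P3 [Col P4 P3 P0 P1 [Row P3 P0 P2 P4 [Row P2 P0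
P3 P4 [Row P1 P0 P2 P3 [Row P1 P0 P3 P4 [Col P3 P4 P1 P2 [Col P0 P2 P0 P3 []]]]]]]],Known (Flip P2
P1 P0 P3 P4)]]]]],Row P2 P3 P3 P4 [Col P1 P2 P0 P4 [Row P1 P4 P0 P3 [Row P2 P4 P1 P3 [Col P1 P3 P0
P2 [Row P2 P4 P0 P3 []]]],Known (Flip P2 P1 P0 P3 P4)]]]]],Row P1 P2 P3 P4 [Row P4 P0 P1 P2 [Row P3
P0 P2 P4 [Row P3 P0 P0 P4 [Row P0 P3 P1 P2 [],Known (Keep P3 P0 P4 P1 P2),Known (Flip P0 P3 P4 P1
P2)],Col P2 P4 P0 P1 [Col P1 P4 P0 P1 [Row P2 P0 P1 P4 [Row P2 P0 P1 P3 [Col P2 P0 P1 P3 [Row P0 P3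
P1 P4 [Col P0 P3 P2 P4 [Row P2 P3 P3 P4 []]]]],Col P2 P4 P0 P3 [Row P3 P0 P0 P2 [Col P2 P0 P1 P4
[Col P1 P0 P3 P4 [Row P4 P0 P2 P3 [Row P1 P0 P2 P3 [Row P1 P0 P3 P4 [Row P2 P1 P3 P4 [Col P0 P3 P1
P2 [Row P2 P1 P0 P4 [Row P3 P2 P0 P1 [Row P2 P0 P0 P1 [Row P0 P2 P1 P4 [Row P3 P4 P0 P1
[]]]]]]]]]]]]]]]]],Col P2 P4 P0 P3 [Col P3 P0 P1 P4 [Col P2 P0 P3 P4 [Col P1 P0 P3 P4 [Col P2 P0 P1
P3 [Col P2 P4 P0 P1 [Row P4 P0 P2 P3 [Row P1 P0 P2 P3 [Row P1 P0 P3 P4 [Row P4 P3 P0 P1 [Row P1 P3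
P0 P2 [Col P3 P4 P1 P3 []]]]]]]]]]]]]]],Col P1 P2 P0 P3 [Row P3 P4 P0 P2 [Col P3 P4 P0 P1 [Known
(Flip P4 P3 P0 P1 P2),Row P4 P1 P0 P2 [Row P4 P1 P1 P2 [Row P0 P3 P1 P2 [Row P0 P3 P1 P4 [Row P2 P1
P1 P4 []]],Row P4 P0 P1 P2 [Row P4 P0 P1 P3 [Col P4 P3 P2 P4 [Row P1 P3 P0 P2 [Row P2 P4 P0 P3
[Known (Keep P2 P4 P0 P1 P3)]]]]]]]],Row P3 P4 P0 P4 [Row P4 P3 P0 P2 [Row P4 P3 P1 P2 [Col P2 P1
P0 P2 [Row P0 P3 P1 P4 [Col P2 P1 P0 P3 [Col P4 P2 P0 P3 [Col P0 P2 P0 P1 [Col P0 P4 P1 P3 [Col P0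
P4 P1 P2 [Row P1 P3 P3 P4 [Known (Flip P3 P1 P2 P0 P4)]]]]]],Col P2 P1 P0 P3 [Col P4 P1 P2 P3 [Col
P3 P0 P1 P2 [Row P4 P0 P1 P3 [Col P0 P4 P2 P3 [Col P0 P4 P1 P3 [Known (Flip P3 P1 P2 P0 P4)],Known
(Flip P3 P1 P2 P0 P4)]],Known (Keep P4 P2 P1 P0 P3)]]]]]]]]]]],Row P2 P3 P1 P3 [Row P1 P2 P3 P4
[Col P1 P2 P0 P3 [Row P3 P4 P0 P2 [Col P3 P4 P0 P1 [Known (Flip P4 P3 P0 P1 P2),Row P0 P3 P1 P4
[Row P0 P3 P2 P4 [Row P2 P1 P3 P4 [Col P2 P1 P0 P4 [Row P3 P0 P1 P4 [Col P3 P0 P1 P2 [Col P1 P4 P2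
P3 [Row P4 P1 P0 P2 [Col P4 P1 P0 P3 [Col P0 P2 P3 P4 [Row P1 P3 P0 P2 [Col P1 P3 P0 P2 [Col P2 P4
P1 P3 [Row P0 P4 P2 P3 [Col P0 P4 P1 P2 [Row P2 P0 P3 P4 [Row P3 P2 P0 P4 [Row P4 P0 P1 P2 [Row P1
P0 P2 P3 [Row P1 P0 P2 P4 [Row P3 P1 P0 P4 [Found (Keep P1 P0 P3 P4 P2)]]]]]]]]]]]]]]]]]]]]]],Row
P3 P4 P0 P4 [Row P4 P3 P0 P2 [Row P2 P1 P0 P4 [Col P2 P0 P3 P4 [Row P4 P3 P1 P2 [Row P2 P1 P1 P4
[]]]]]]],Known (Flip P2 P1 P0 P3 P4)],Row P3 P0 P1 P4 [Col P3 P0 P1 P2 [Known (Flip P0 P3 P2 P1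
P4),Col P1 P4 P2 P3 [Row P1 P4 P2 P4 [Known (Flip P4 P1 P2 P0 P3),Row P0 P2 P1 P4 [Row P4 P1 P0 P2
[Row P0 P3 P2 P4 [Col P0 P2 P1 P4 [Col P1 P2 P0 P4 [Row P1 P3 P2 P4 [Row P4 P1 P0 P3 [Row P0 P3 P3
P4 []]]]]]]]]]],Col P4 P1 P2 P3 [Col P3 P0 P2 P4 [Col P0 P4 P1 P2 [Row P1 P4 P0 P2 [Row P0 P3 P1 P4
[Row P0 P3 P2 P4 [Row P3 P4 P0 P2 [Row P1 P4 P2 P3 [Col P1 P4 P0 P3 [Col P2 P4 P0 P1 [Row P1 P3 P0
P4 [Row P3 P4 P0 P1 []]]]]]]],Row P0 P3 P2 P4 [Row P2 P0 P1 P4 [Row P1 P4 P2 P3 [Row P3 P1 P0 P2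
[],Col P0 P3 P1 P2 [Row P2 P0 P3 P4 [Col P1 P0 P3 P4 [Row P3 P2 P0 P4 [Row P4 P0 P1 P2 [Row P4 P2
P0 P1 [Row P1 P0 P0 P3 [Known (Flip P0 P1 P3 P2 P4)]]]]]]]]]],Row P0 P3 P1 P4 [Row P0 P3 P2 P4 [Col
P1 P2 P0 P4 [Row P3 P4 P0 P2 [Row P4 P0 P1 P2 [Row P4 P2 P0 P3 [Row P0 P2 P1 P2 [Col P0 P4 P2 P3
[Row P3 P4 P2 P4 []],Row P1 P4 P0 P4 [Row P1 P4 P0 P3 []]]]]]]]]]]],Row P4 P1 P1 P2 [Col P1 P4 P0
P3 [Col P1 P2 P0 P4 [Col P2 P4 P0 P1 [Col P2 P0 P1 P3 [Col P2 P4 P0 P3 [Row P4 P0 P1 P2 [Row P0 P3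
P1 P3 [Col P3 P1 P0 P3 [Col P2 P1 P0 P3 [Col P3 P2 P1 P3 [Row P2 P1 P0 P4 [Row P3 P2 P0 P1 [Row P0
P2 P1 P4 [Col P0 P2 P1 P4 [Row P0 P4 P1 P3 [Col P0 P4 P2 P3 [Row P3 P4 P2 P4 []]]]]]]]]],Row P1 P4
P0 P3 [Col P0 P2 P0 P3 []]]]]]]]],Known (Flip P1 P4 P2 P0 P3)],Col P4 P0 P2 P3 [Row P3 P0 P0 P1
[Row P0 P2 P1 P4 [Col P0 P2 P1 P3 [Row P0 P3 P1 P4 [Row P0 P3 P2 P4 [Col P1 P4 P1 P3 [Col P1 P4 P0
P3 [Known (Flip P4 P1 P3 P0 P2),Col P2 P4 P0 P1 [Col P0 P4 P0 P1 [Row P3 P4 P0 P2 [Col P2 P1 P0 P3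
[Row P1 P0 P3 P4 [Col P3 P4 P0 P2 []],Known (Flip P1 P2 P0 P3 P4)]]]]]]]]]],Row P0 P4 P1 P2 [Col P0
P4 P2 P3 [Row P2 P1 P3 P4 [Col P2 P1 P0 P3 [Row P4 P1 P0 P2 [Row P2 P4 P1 P3 [Row P2 P4 P0 P3 [Row
P0 P3 P1 P4 [Col P0 P3 P1 P2 [Row P0 P2 P3 P4 [Row P0 P2 P1 P4 [Row P1 P3 P2 P3 [Known (Flip P3 P1
P4 P0 P2)]]]]]]]]]]]]]]]]],Col P1 P2 P3 P4 [Row P3 P4 P0 P1 [Row P0 P2 P1 P4 [Col P1 P0 P3 P4 [Col
P3 P4 P0 P1 [Col P0 P2 P1 P3 [Row P1 P0 P3 P4 [Row P4 P0 P2 P3 [Col P4 P1 P0 P2 [Col P2 P4 P1 P2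
[Row P4 P0 P1 P2 [Col P1 P3 P2 P4 [Row P1 P3 P2 P3 [Known (Flip P3 P1 P2 P0 P4)]],Row P1 P4 P0 P3
[Row P1 P4 P2 P3 [Col P2 P4 P1 P3 [Row P2 P1 P3 P4 [Row P3 P1 P2 P4 [Row P3 P2 P0 P1 [Row P4 P2 P0
P1 [Col P0 P4 P1 P3 [Row P3 P1 P0 P2 [Row P0 P3 P2 P4 [Row P0 P4 P2 P3 [Col P1 P2 P0 P4 [Row P1 P3
P2 P4 [Row P3 P0 P1 P4 [Found (Keep P3 P0 P4 P2 P1)]],Known (Keep P3 P0 P4 P1
P2)]]]]]]]]]]]]]]]]]]]],Col P1 P0 P2 P3 [Col P3 P4 P0 P1 [Row P4 P0 P2 P3 [Row P4 P0 P1 P3 [Row P2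
P4 P0 P1 [Col P1 P4 P2 P3 [Col P4 P1 P2 P3 [Row P2 P4 P1 P3 [Row P3 P1 P0 P1 [],Row P3 P2 P0 P4
[]]]]]]]],Col P3 P4 P0 P1 [Col P4 P1 P0 P2 [Col P4 P1 P2 P3 [Row P0 P2 P2 P4 [Col P3 P2 P1 P3 [Col
P1 P4 P2 P3 [Col P3 P2 P0 P1 [Row P1 P4 P0 P4 []],Known (Keep P0 P3 P2 P1 P4)]]]]]],Row P1 P4 P0 P3
[Row P1 P4 P0 P2 [Row P3 P0 P0 P2 []],Row P1 P4 P0 P2 [Row P0 P4 P1 P2 [Col P1 P4 P2 P3 [Col P3 P1
P0 P2 []]]],Row P4 P2 P0 P1 [Row P1 P4 P0 P4 [Row P4 P0 P2 P3 [],Row P1 P4 P0 P2 [Row P0 P4 P1 P2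
[Row P0 P4 P1 P3 [Col P3 P4 P0 P1 [Row P1 P0 P2 P4 [Row P4 P1 P2 P3 [Row P4 P2 P1 P3 [Row P4 P3 P0
P3 []]]]]]]]]]]],Col P3 P4 P0 P1 [Row P1 P0 P2 P4 [Col P1 P0 P2 P3 [Row P0 P3 P2 P4 [Row P1 P4 P0
P2 [Row P1 P3 P0 P2 [Row P0 P2 P1 P2 [Row P1 P4 P0 P4 [Row P1 P4 P0 P3 [Col P3 P1 P0 P2
[]]]]]]]]]]],Col P3 P4 P1 P2 [Row P1 P0 P2 P4 [Row P0 P2 P3 P4 [Col P1 P0 P2 P3 [Row P0 P3 P2 P4
[Col P4 P2 P0 P1 [Col P1 P4 P1 P3 [Col P1 P4 P2 P3 [Col P0 P2 P1 P3 [Col P1 P4 P0 P3 [Known (Flip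
P4 P1 P3 P0 P2),Row P2 P1 P3 P4 [Row P4 P3 P0 P3 [Known (Flip P3 P4 P0 P1 P2)]]],Known (Flip P2 P0
P3 P1 P4)]]]]]],Col P4 P1 P0 P2 [Col P4 P2 P0 P1 [Row P0 P2 P1 P4 [Col P0 P2 P3 P4 [Col P1 P2 P0 P4
[Row P1 P4 P0 P2 [Row P3 P1 P2 P4 [Row P2 P1 P3 P4 [Col P2 P4 P1 P3 [Col P3 P1 P0 P4 [Row P4 P3 P0
P2 [Row P0 P4 P1 P2 [Row P0 P4 P1 P3 [Col P2 P0 P3 P4 [Col P0 P3 P1 P2 [Col P2 P4 P0 P1 [Row P1 P3
P0 P4 [Col P1 P3 P0 P2 [Col P1 P4 P0 P2 [Row P3 P2 P1 P4 [Found (Keep P0 P3 P2 P1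
P4)]]]]]]]]]]]]]]]]],Col P1 P0 P2 P3 [Row P0 P3 P2 P4 [Col P0 P3 P1 P2 [Row P0 P4 P1 P3 [Row P0 P4
P1 P2 [Col P0 P4 P2 P3 [Row P2 P1 P3 P4 []]]]]]],Col P1 P4 P1 P3 []]]],Col P1 P0 P2 P3 [Row P0 P3
P2 P4 [Col P4 P1 P0 P3 [Known (Flip P1 P4 P3 P0 P2),Row P0 P2 P1 P3 [Col P4 P0 P2 P3 [Row P4 P2 P0
P1 [Row P0 P2 P2 P3 [Row P1 P3 P0 P2 [Row P2 P0 P1 P3 [Col P1 P4 P1 P3 []]]]]]]]]]]]]],Row P1 P2 P3
P4 [Row P4 P0 P2 P3 [Row P3 P0 P2 P4 [Row P3 P0 P0 P4 [Row P0 P3 P1 P2 [Row P0 P3 P2 P4 [Row P2 P4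
P0 P3 [Col P2 P4 P0 P3 [Row P2 P0 P3 P4 [Row P1 P4 P2 P3 [Row P1 P4 P2 P4 []]]]]]],Known (Keep P3
P0 P4 P1 P2),Known (Flip P0 P3 P4 P1 P2)],Col P2 P4 P0 P1 [Row P2 P0 P3 P4 [Row P2 P0 P1 P3 [Row P2
P1 P3 P4 [Col P2 P4 P0 P3 [Row P2 P1 P0 P4 [Col P3 P4 P0 P1 [Row P1 P0 P2 P4 [Col P3 P4 P1 P2 [Col
P1 P0 P2 P3 [Col P0 P3 P1 P2 [Row P1 P3 P2 P4 [Row P1 P4 P0 P3 [Col P3 P1 P0 P2 [Row P4 P3 P1 P3
[]]]]]]]]]]]]]]],Col P2 P4 P0 P3 [Col P3 P0 P1 P4 [Col P2 P0 P3 P4 [Row P4 P0 P1 P2 [Col P1 P4 P2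
P3 [Col P3 P2 P1 P4 [Row P1 P4 P2 P3 [Col P2 P4 P0 P1 [Row P3 P4 P0 P4 []]]]]],Row P4 P0 P1 P2 [Col
P2 P0 P2 P3 [Row P2 P4 P3 P4 [Row P1 P4 P0 P3 [Row P2 P0 P3 P4 [Col P4 P1 P2 P3 [Row P1 P4 P0 P4
[Row P0 P2 P1 P4 [Row P0 P4 P1 P2 [Row P4 P3 P0 P2 []]]]]]],Row P0 P3 P1 P4 [Row P4 P1 P1 P3
[]]]]]]]]]]]]]]"

definition "cert_3 =
 Col P1 P2 P3 P4 [Col P3 P4 P2 P3 [Row P3 P4 P1 P2 [Known (Keep P3 P4 P2 P0 P1),Known (Flip P4 P3
P1 P0 P2),Col P1 P2 P0 P4 [Row P4 P2 P0 P2 [Col P4 P2 P0 P1 [Col P1 P0 P1 P3 [Col P1 P0 P3 P4 [Col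
P2 P1 P3 P4 [Row P4 P3 P0 P3 []]],Col P1 P0 P3 P4 [Row P2 P3 P3 P4 [Row P4 P3 P0 P3 [Row P0 P4 P1
P2 [Row P0 P4 P1 P3 [Row P1 P4 P2 P3 []]],Row P3 P1 P0 P2 [Known (Keep P3 P1 P0 P2 P4),Row P0 P4 P1
P2 [Row P0 P2 P1 P3 [Row P3 P2 P0 P1 []]],Known (Flip P1 P3 P4 P2 P0)]]],Known (Keep P1 P0 P4 P2
P3),Known (Flip P0 P1 P3 P2 P4)],Row P1 P0 P0 P3 [Row P2 P3 P3 P4 [Col P0 P4 P2 P3 [Row P0 P4 P2 P3
[Known (Flip P4 P0 P1 P2 P3),Row P3 P1 P2 P4 [Row P2 P1 P3 P4 [Row P2 P4 P1 P3 [Row P2 P4 P0 P3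
[Row P0 P2 P1 P3 []]],Known (Flip P3 P4 P0 P1 P2)]]]]]]],Known (Flip P2 P4 P3 P0 P1)],Row P4 P2 P0
P1 [Known (Keep P4 P2 P1 P0 P3),Col P1 P3 P0 P1 [Col P4 P3 P0 P1 [Row P2 P0 P0 P1 [Col P0 P2 P3 P4
[Row P4 P3 P0 P3 [Row P1 P3 P0 P2 [Col P0 P3 P2 P4 [Row P3 P1 P2 P4 [Col P0 P4 P0 P2 [Row P0 P3 P1
P2 [Row P0 P3 P1 P4 [Known (Keep P0 P3 P2 P1 P4)]]]]]]]]]]]]],Known (Keep P1 P2 P4 P3 P0)]],Row P1
P2 P2 P3 [Col P3 P4 P0 P2 [Row P4 P0 P1 P2 [Row P1 P3 P0 P2 [Row P1 P3 P2 P4 [Col P4 P0 P2 P3 [Col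
P2 P0 P3 P4 [Row P2 P0 P3 P4 [Known (Flip P0 P2 P1 P3 P4),Col P0 P4 P1 P3 [Row P0 P2 P3 P4 [Col P0
P2 P1 P4 [Col P0 P3 P1 P2 [Row P0 P3 P1 P2 [Known (Flip P3 P0 P4 P1 P2),Row P4 P3 P0 P2 []]],Known
(Flip P2 P0 P3 P1 P4)]]]]]]]]]],Known (Keep P1 P2 P4 P3 P0),Row P3 P4 P2 P4 [Col P4 P3 P0 P4 [Row
P2 P0 P0 P1 [Col P0 P2 P3 P4 [Row P1 P3 P0 P2 [Row P1 P3 P0 P4 [Known (Keep P1 P3 P4 P0 P2),Col P4
P2 P0 P1 [Row P0 P2 P3 P4 [Col P4 P1 P3 P4 [Row P4 P2 P0 P2 [Known (Flip P2 P4 P0 P1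
P3)]]]]]]]],Row P4 P3 P2 P3 [Known (Flip P3 P4 P0 P1 P2),Known (Keep P4 P3 P1 P2 P0)],Col P4 P3 P0
P1 [Col P2 P4 P0 P1 [Row P0 P4 P1 P2 [Row P2 P4 P0 P3 [Known (Flip P4 P2 P0 P1 P3),Row P0 P4 P1 P3
[Row P0 P4 P1 P4 [Known (Keep P0 P4 P2 P1 P3)]]]]]]],Row P4 P0 P1 P2 [Col P4 P0 P2 P3 [Known (Keep
P4 P0 P2 P1 P3),Col P3 P0 P1 P3 [Row P2 P1 P1 P3 [Col P1 P4 P0 P3 [],Row P2 P1 P0 P1 [Known (Flip
P1 P2 P3 P0 P4)]]]]]]]],Row P1 P2 P3 P4 [Known (Flip P2 P1 P0 P3 P4),Col P4 P0 P3 P4 [Row P4 P0 P2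
P3 [Known (Keep P4 P0 P3 P1 P2),Row P2 P4 P0 P3 [Col P2 P4 P1 P3 [Row P3 P0 P0 P1 [Row P3 P0 P1 P4
[Known (Keep P3 P0 P2 P4 P1),Col P2 P0 P1 P3 [Row P3 P1 P0 P2 [Row P4 P1 P0 P3 [Col P4 P1 P0 P3
[Known (Flip P1 P4 P2 P3 P0),Row P3 P1 P1 P2 []]]]]],Row P3 P0 P0 P4 [Known (Flip P0 P3 P1 P2
P4)]],Known (Keep P2 P4 P3 P0 P1)]]],Row P2 P3 P3 P4 [Row P2 P3 P1 P4 [Col P3 P0 P1 P4 [Col P3 P0
P2 P4 [Col P0 P2 P1 P4 [Row P0 P2 P1 P4 [Row P0 P4 P1 P2 [],Known (Flip P2 P0 P3 P4 P1)]]]],Known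
(Keep P2 P3 P0 P1 P4)],Row P2 P3 P1 P4 [Col P3 P2 P0 P1 [Col P1 P0 P1 P4 [Row P4 P0 P2 P3 [Row P0
P4 P1 P2 [Row P3 P4 P1 P2 [Row P2 P1 P1 P3 [Row P2 P1 P0 P3 [Col P0 P2 P3 P4 [Row P0 P2 P1 P3 [Col
P3 P0 P1 P2 [Row P3 P1 P2 P4 [Row P0 P4 P2 P3 [Col P3 P0 P1 P4 [Row P1 P4 P0 P4 [Known (Flip P4 P1
P2 P0 P3)]]]]],Known (Flip P2 P0 P3 P4 P1)]],Row P0 P3 P1 P4 [Row P0 P3 P1 P3 [Row P3 P0 P1 P4
[]]]]]]]]]],Row P4 P0 P2 P3 [Row P0 P4 P1 P2 [Row P2 P1 P1 P3 []],Row P2 P4 P0 P3 [Col P2 P4 P0 P1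
[Known (Flip P4 P2 P1 P0 P3),Col P2 P0 P1 P4 [Row P0 P3 P1 P4 [Col P0 P3 P1 P2 [Col P3 P1 P2 P4
[Row P4 P3 P0 P1 [Col P1 P0 P1 P4 [Row P1 P0 P3 P4 [Row P3 P0 P1 P2 [Row P1 P3 P0 P2 [Col P2 P0 P1
P3 [Row P2 P0 P0 P1 []]]],Known (Flip P0 P1 P2 P4 P3)]]]],Known (Flip P3 P0 P1 P2 P4)],Col P1 P0 P3
P4 [Col P2 P0 P1 P3 [Row P3 P1 P0 P2 [Row P0 P3 P1 P3 [Row P3 P0 P1 P4 [Row P3 P0 P2 P4 [Col P1 P0
P1 P4 []]]],Known (Keep P0 P3 P1 P2 P4)]]]]]],Col P0 P3 P2 P4 [Col P2 P4 P1 P3 [Col P2 P0 P1 P4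
[Col P1 P4 P0 P1 [Col P2 P0 P1 P2 [Col P3 P0 P1 P2 [Row P3 P0 P0 P1 [Known (Flip P0 P3 P1 P2
P4)]],Row P4 P2 P1 P3 [Known (Keep P4 P2 P0 P3 P1)]]]],Known (Keep P2 P4 P3 P0 P1)]]]]],Col P2 P3
P0 P4 [Known (Flip P3 P2 P4 P0 P1),Row P4 P2 P0 P1 [Row P4 P2 P0 P3 [Row P4 P0 P2 P3 [Row P0 P4 P1
P2 [Row P1 P0 P2 P3 [Col P2 P1 P3 P4 [Row P0 P3 P1 P4 [Col P0 P3 P2 P4 [Row P2 P1 P1 P3
[]]]]]]]]]]]]]]"

definition "cert_4 =
 Row P1 P2 P3 P4 [Col P1 P2 P0 P3 [Row P2 P0 P3 P4 [Col P2 P0 P3 P4 [Row P3 P4 P0 P2 [Row P3 P4 P0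
P4 [Known (Keep P3 P4 P0 P1 P2),Row P4 P3 P0 P2 [Row P4 P3 P1 P2 [Col P4 P1 P0 P2 [Col P4 P0 P1 P2
[Row P2 P1 P0 P1 [Known (Keep P2 P1 P3 P4 P0)]]]]]]],Known (Flip P0 P2 P1 P3 P4),Known (Flip P0 P2
P1 P3 P4)],Col P2 P0 P3 P4 [Known (Flip P0 P2 P1 P4 P3),Row P3 P4 P0 P2 [Col P3 P4 P0 P1 [Row P0 P3
P1 P2 [Row P0 P3 P2 P4 [Known (Flip P3 P0 P1 P2 P4),Col P2 P1 P0 P4 [Row P1 P0 P3 P4 [Row P2 P1 P0
P3 [Row P2 P1 P3 P4 [Row P0 P2 P3 P4 [Row P0 P2 P1 P3 [Known (Keep P0 P2 P1 P3 P4),Row P2 P4 P0 P1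
[Row P1 P3 P0 P4 [Known (Flip P0 P4 P3 P1 P2),Row P2 P4 P0 P4 []]]]]]],Known (Flip P0 P1 P2 P4
P3)],Row P4 P0 P0 P1 [Known (Keep P4 P0 P2 P1 P3),Known (Flip P0 P4 P3 P1 P2)],Col P2 P1 P0 P3 [Col
P1 P4 P0 P3 [Row P3 P0 P2 P4 [Known (Keep P3 P0 P1 P4 P2)]]]],Known (Keep P0 P3 P4 P2 P1)],Row P0
P3 P1 P4 [Known (Keep P0 P3 P4 P2 P1)]],Known (Flip P4 P3 P0 P1 P2)],Row P3 P4 P0 P4 [Known (Keep
P3 P4 P0 P1 P2),Row P4 P3 P0 P2 [Row P4 P3 P1 P2 [Col P0 P2 P0 P1 [Col P0 P4 P1 P3 [Col P0 P4 P1 P2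
[Known (Flip P4 P0 P2 P3 P1),Row P4 P2 P1 P3 [Row P3 P0 P1 P2 [Known (Keep P3 P0 P1 P4 P2),Known
(Keep P3 P0 P1 P2 P4)]]]]]]]]]],Row P2 P0 P0 P3 [Known (Keep P2 P0 P4 P3 P1)]],Known (Flip P2 P1 P0
P4 P3),Known (Flip P2 P1 P0 P3 P4)],Col P1 P2 P3 P4 [Row P2 P3 P1 P4 [Row P2 P3 P3 P4 [Col P3 P2 P0
P1 [Col P4 P1 P0 P3 [Col P2 P4 P0 P1 [Col P2 P4 P0 P3 [Known (Flip P4 P2 P1 P3 P0),Row P4 P3 P0 P1
[Col P4 P3 P0 P1 [Row P3 P0 P1 P2 [Row P3 P2 P0 P1 [Col P1 P0 P1 P4 [Col P1 P0 P2 P4 [Col P0 P2 P1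
P4 [Col P4 P2 P0 P1 [Known (Keep P3 P1 P0 P2 P4)],Known (Flip P2 P0 P1 P3 P4)],Known (Flip P0 P1 P3
P2 P4)],Row P0 P2 P1 P3 [Known (Keep P1 P0 P2 P3 P4),Row P2 P0 P1 P3 [Col P3 P1 P0 P2 [Row P4 P0 P2
P3 [Row P0 P2 P1 P2 [Row P0 P3 P1 P3 [Row P0 P3 P2 P3 [Row P0 P4 P1 P2 [Row P0 P3 P3 P4 [Row P0 P4
P2 P4 [Row P1 P0 P0 P4 [Row P1 P3 P3 P4 [Row P1 P4 P2 P4 [Row P2 P1 P1 P3 [Found (Keep P0 P2 P4 P3
P1)]]]]]]],Known (Flip P1 P3 P0 P2 P4)],Known (Flip P1 P3 P0 P2 P4)],Known (Keep P0 P2 P1 P3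
P4)]]]]]]]]]]]],Col P2 P4 P0 P1 [Col P2 P4 P0 P3 [Known (Flip P4 P2 P1 P3 P0),Col P4 P0 P1 P3 [Row
P4 P3 P0 P1 [Row P3 P1 P0 P4 [Row P3 P0 P2 P4 [Row P3 P0 P1 P2 [Row P3 P2 P0 P1 [Col P0 P3 P0 P2
[Row P0 P3 P1 P3 [Known (Flip P3 P0 P2 P1 P4),Known (Keep P0 P3 P4 P1 P2)]]]]]]]]],Known (Flip P1
P4 P2 P3 P0)],Row P4 P1 P0 P2 [Known (Keep P4 P1 P3 P2 P0),Row P2 P4 P0 P3 [Row P0 P3 P1 P4 [Row P0
P3 P1 P3 [Known (Keep P0 P3 P1 P2 P4)]]]]]],Known (Keep P2 P3 P4 P0 P1),Known (Flip P3 P2 P4 P0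
P1)],Row P3 P0 P1 P2 [Row P3 P0 P2 P4 [Row P2 P3 P3 P4 [Col P4 P2 P1 P3 [Row P1 P3 P2 P4 [Row P1 P3
P0 P2 [Known (Keep P1 P3 P0 P2 P4),Row P4 P2 P0 P1 [Known (Keep P4 P2 P1 P0 P3),Row P1 P4 P0 P3
[Row P2 P4 P0 P3 [Row P0 P3 P1 P4 [Col P0 P3 P1 P2 [Row P0 P2 P1 P3 [Row P1 P0 P2 P4 [Row P1 P0 P3
P4 [Row P2 P0 P1 P3 [Known (Flip P1 P3 P0 P2 P4),Row P0 P2 P1 P2 []],Known (Keep P1 P0 P3 P4
P2)]]]]]]]]]],Row P4 P2 P1 P2 [Known (Flip P2 P4 P1 P0 P3)]]]]],Col P2 P3 P0 P4 [Row P3 P0 P2 P4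
[Row P3 P0 P1 P2 [Row P3 P4 P0 P1 [Col P3 P4 P0 P1 [Known (Flip P4 P3 P2 P0 P1),Col P4 P0 P1 P3
[Known (Flip P0 P4 P3 P1 P2),Col P1 P0 P3 P4 [Col P1 P3 P0 P4 [Row P2 P4 P0 P3 [Col P2 P0 P1 P4
[Row P1 P3 P0 P4 [Row P0 P2 P2 P4 [Known (Keep P0 P2 P1 P3 P4)]]]]]]],Known (Flip P4 P3 P2 P0
P1)],Row P3 P4 P0 P4 [Known (Keep P3 P4 P1 P0 P2)]]]]]]],Col P1 P2 P0 P4 [Row P2 P0 P3 P4 [Col P2
P0 P3 P4 [Col P4 P3 P0 P1 [Row P4 P3 P0 P3 [Known (Flip P3 P4 P0 P1 P2),Row P3 P4 P0 P2 [Row P3 P4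
P1 P2 [Row P2 P4 P0 P1 [Row P0 P4 P1 P2 [Row P2 P1 P1 P3 [Known (Flip P1 P2 P3 P4 P0)]]]]]]],Known
(Flip P0 P2 P1 P3 P4)],Row P2 P0 P0 P4 [Known (Keep P2 P0 P3 P4 P1),Known (Flip P0 P2 P1 P4
P3)],Col P2 P0 P3 P4 [Known (Flip P0 P2 P1 P4 P3),Row P4 P3 P0 P2 [Row P4 P3 P0 P3 [Row P3 P4 P0 P2
[Row P2 P1 P0 P3 [Col P2 P1 P0 P4 [Known (Flip P1 P2 P3 P4 P0),Row P3 P4 P1 P2 [Row P0 P2 P1 P2
[Col P0 P4 P1 P3 [Col P0 P4 P2 P3 [Col P2 P4 P1 P2 []]]]]]]]],Col P4 P3 P0 P1 [Row P2 P4 P0 P1 [Row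
P2 P4 P1 P3 [Known (Flip P4 P2 P0 P1 P3),Row P3 P0 P1 P4 [Row P0 P2 P1 P3 [Row P0 P2 P3 P4 [Row P3
P1 P0 P2 [Col P0 P4 P2 P3 [Row P1 P3 P0 P2 [Row P1 P3 P0 P4 [Known (Flip P3 P1 P2 P4 P0)]],Known
(Flip P4 P0 P2 P1 P3)]]]],Known (Keep P3 P0 P1 P2 P4)]],Row P2 P4 P0 P3 [Row P1 P0 P3 P4 [Row P1 P0
P0 P3 [Known (Keep P1 P0 P3 P2 P4)]]]]]]]],Known (Keep P1 P2 P4 P3 P0)]]"

definition "cert_5 =
 Row P2 P3 P1 P3 [Row P2 P3 P3 P4 [Known (Keep P2 P3 P0 P1 P4),Known (Flip P3 P2 P1 P0 P4)],Row P2
P3 P3 P4 [Known (Keep P2 P3 P0 P1 P4),Row P1 P0 P2 P3 [Row P3 P2 P0 P1 [Row P3 P2 P1 P4 [Col P4 P0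
P1 P4 [Row P4 P0 P0 P1 [Known (Keep P4 P0 P3 P2 P1),Row P0 P4 P1 P2 [Row P0 P4 P1 P4 [Known (Flip
P4 P0 P2 P3 P1),Known (Keep P0 P4 P3 P2 P1)]]]],Row P4 P1 P0 P1 [Row P4 P1 P1 P2 [Row P1 P4 P0 P4
[Row P1 P4 P3 P4 [Row P1 P0 P3 P4 [Col P4 P2 P3 P4 [],Row P4 P2 P0 P1 [Col P4 P0 P3 P4 [Col P4 P0
P2 P3 [Col P4 P3 P2 P4 [Row P4 P3 P2 P3 [Row P4 P0 P2 P3 [Col P4 P2 P0 P1 [Row P3 P4 P2 P4 [Row P3
P4 P1 P4 [Row P4 P2 P0 P2 [Row P0 P3 P1 P3 [Row P2 P1 P0 P1 [Row P1 P3 P0 P2 [Row P0 P2 P2 P3 [Row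
P1 P3 P0 P3 [Row P2 P4 P0 P3 [Row P2 P1 P1 P3 [Found (Flip P0 P1 P3 P4 P2)]]]]]],Row P0 P3 P1 P2
[]]],Known (Flip P4 P3 P1 P0 P2)]]]],Known (Keep P4 P3 P1 P0 P2)]]],Row P3 P4 P1 P2 [Known (Keep P3
P4 P0 P1 P2),Known (Keep P3 P4 P0 P1 P2)]]]],Known (Flip P4 P1 P3 P2 P0),Known (Keep P1 P4 P0 P2
P3)],Row P1 P4 P0 P3 [Known (Flip P4 P1 P3 P2 P0)],Row P1 P4 P0 P3 [Known (Keep P1 P4 P2 P3
P0),Known (Keep P1 P4 P2 P3 P0)]],Known (Flip P1 P4 P2 P3 P0)],Row P4 P1 P0 P2 [Known (Keep P4 P1
P3 P2 P0),Known (Keep P4 P1 P3 P2 P0)]]]]],Row P3 P4 P2 P4 [Row P3 P4 P1 P4 [Row P0 P4 P1 P2 [Row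
P1 P0 P2 P3 [Col P4 P3 P1 P4 [Col P4 P3 P0 P4 [Row P4 P3 P0 P3 [Row P0 P2 P1 P2 [Row P0 P2 P2 P3
[Col P3 P1 P0 P2 [Col P4 P2 P0 P1 [Col P3 P2 P0 P4 [Col P3 P2 P0 P3 [],Row P2 P4 P0 P4 [Known (Flip
P4 P2 P3 P0 P1),Known (Keep P2 P4 P1 P0 P3)]]],Col P4 P0 P1 P4 [Col P3 P0 P2 P4 [Col P3 P0 P2 P3
[Col P3 P1 P0 P3 [Row P1 P3 P2 P4 [Row P3 P1 P0 P2 [Row P4 P2 P1 P2 []]]]]]]],Known (Flip P2 P0 P3
P4 P1),Col P4 P2 P1 P4 [Row P0 P4 P2 P3 [Known (Keep P0 P4 P2 P1 P3),Known (Flip P4 P0 P3 P1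
P2)],Col P4 P2 P0 P1 [Col P2 P0 P1 P2 [Row P2 P0 P0 P1 [Known (Keep P2 P0 P3 P4 P1),Row P3 P2 P1 P2
[Known (Keep P1 P3 P2 P0 P4),Row P2 P1 P0 P1 [Known (Flip P1 P2 P3 P4 P0)]]]]]]],Row P0 P2 P1 P3
[Col P4 P2 P0 P1 [Row P0 P3 P1 P3 [Col P4 P2 P1 P3 [Row P1 P4 P0 P4 [Col P3 P2 P0 P3 [Row P1 P4 P0
P3 [Row P3 P1 P2 P4 [Row P3 P2 P0 P1 [Row P3 P2 P1 P2 [Known (Keep P3 P2 P1 P0 P4)]]]]]]],Row P0 P3
P1 P2 [Row P0 P3 P1 P4 [Col P1 P2 P0 P3 [Col P4 P2 P1 P3 [Col P3 P2 P0 P3 []]]]],Row P0 P3 P1 P2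
[Row P0 P3 P1 P4 [Known (Keep P0 P3 P2 P4 P1)]]]]]],Known (Keep P4 P3 P2 P1 P0)],Row P4 P3 P0 P1
[Known (Keep P4 P3 P0 P2 P1),Known (Keep P4 P3 P0 P1 P2)]],Col P3 P1 P0 P2 [Col P3 P1 P0 P4 [Row P1
P4 P0 P4 [Known (Keep P1 P4 P2 P3 P0)],Known (Flip P1 P3 P4 P2 P0)]],Row P2 P4 P0 P3 [Known (Flip
P4 P2 P0 P1 P3),Known (Keep P2 P4 P3 P1 P0),Row P1 P0 P3 P4 [Col P4 P3 P0 P1 [Row P4 P3 P0 P1
[Known (Keep P4 P3 P0 P2 P1),Known (Flip P3 P4 P2 P1 P0)]]]]],Row P1 P0 P2 P4 [Col P2 P4 P0 P3 [Col
P2 P1 P0 P4 [Col P2 P1 P0 P3 [Row P2 P1 P1 P3 [Row P3 P2 P2 P4 [Row P3 P2 P0 P2 [Known (Flip P2 P3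
P0 P1 P4),Col P4 P0 P1 P4 [Row P1 P4 P0 P3 [Row P2 P4 P0 P1 [Col P3 P1 P2 P4 [Col P3 P0 P1 P2 [Row
P2 P4 P1 P4 [Known (Keep P2 P4 P1 P0 P3)]]]]]]]]]]],Col P4 P3 P2 P4 [Row P4 P3 P2 P3 [Row P2 P4 P1
P3 [Row P2 P4 P1 P4 [Row P4 P2 P0 P1 [Row P4 P2 P0 P3 [Col P0 P3 P0 P1 [Row P0 P3 P1 P3 [Row P1 P3
P2 P3 [Row P3 P0 P0 P1 [Row P3 P0 P0 P2 [Row P3 P1 P0 P1 [Row P3 P1 P1 P4 [Row P3 P2 P0 P2 [Row P3
P2 P2 P4 [Row P0 P2 P1 P2 [Row P2 P0 P0 P4 [Row P0 P4 P2 P4 [Row P1 P2 P2 P4 [Found (Keep P0 P1 P2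
P3 P4)],Row P1 P2 P2 P4 [Found (Keep P0 P1 P2 P3 P4)]]],Row P1 P4 P0 P4 [Row P0 P4 P2 P4 [Row P1 P2
P2 P4 [Found (Keep P0 P2 P4 P3 P1)],Row P1 P2 P2 P4 [Found (Keep P0 P1 P2 P3 P4)]]]]]]]]]]],Known
(Keep P0 P3 P2 P4 P1)]]]]],Row P2 P4 P1 P4 [Known (Flip P4 P2 P3 P0 P1)]],Known (Keep P4 P3 P1 P0
P2)]],Row P4 P3 P0 P3 [Known (Flip P3 P4 P2 P0 P1),Known (Keep P4 P3 P1 P0 P2)]]]],Row P0 P4 P1 P3
[Col P0 P4 P2 P3 [Known (Keep P0 P4 P2 P1 P3),Col P2 P1 P0 P3 [Col P1 P3 P0 P4 []]],Row P0 P4 P1 P4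
[Row P3 P2 P1 P2 [Row P3 P2 P2 P4 [Col P1 P2 P0 P1 [Row P1 P2 P0 P2 [Row P1 P3 P0 P3 [Row P4 P2 P0
P1 [Row P1 P4 P0 P3 [Known (Keep P1 P4 P2 P3 P0),Known (Keep P1 P4 P2 P3 P0)]],Col P0 P3 P0 P4 [Row
P1 P3 P0 P2 [Row P1 P3 P0 P4 [Known (Flip P3 P1 P2 P4 P0)]]],Row P1 P3 P0 P4 [Row P3 P1 P0 P4 [Row
P3 P1 P2 P4 [Row P1 P3 P0 P2 [Row P4 P2 P0 P3 [Row P4 P2 P0 P2 [Known (Keep P4 P2 P1 P3
P0)]]]]]]]],Row P4 P0 P1 P3 [Col P4 P2 P0 P1 [Row P2 P0 P0 P1 [Known (Keep P2 P0 P3 P4 P1),Known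
(Flip P0 P2 P4 P3 P1)],Row P4 P3 P0 P3 [Row P1 P2 P0 P4 [Col P4 P2 P1 P3 [Row P1 P3 P0 P3 [Row P4
P2 P0 P2 [Row P1 P3 P0 P2 [Row P2 P4 P0 P3 [Row P2 P4 P1 P3 [Row P4 P3 P1 P3 []]]]]]]]]]]],Known
(Flip P2 P3 P4 P0 P1)],Row P3 P2 P2 P4 [Known (Flip P2 P3 P1 P4 P0)]],Known (Keep P0 P4 P3 P2
P1)]]],Known (Flip P4 P3 P1 P0 P2),Known (Keep P3 P4 P2 P0 P1),Col P1 P0 P3 P4 [Col P4 P3 P0 P1
[Row P4 P3 P0 P1 [Row P0 P2 P1 P2 [Row P0 P2 P2 P3 [Known (Flip P2 P0 P3 P4 P1),Col P1 P2 P3 P4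
[Col P4 P2 P1 P3 [Row P1 P0 P3 P4 [Col P3 P2 P3 P4 [Row P4 P2 P0 P3 [Row P3 P2 P2 P4 [Known (Keep
P3 P2 P1 P0 P4),Row P1 P2 P3 P4 [Row P1 P2 P2 P3 [Col P2 P0 P1 P2 [Row P2 P0 P0 P1 [Known (Keep P2
P0 P3 P4 P1),Row P4 P2 P0 P2 [Row P0 P4 P1 P4 [Row P3 P1 P1 P2 [Row P0 P3 P2 P4 [Row P0 P3 P2 P3
[Row P2 P1 P0 P3 [Row P3 P0 P1 P2 [Row P3 P1 P1 P4 [Found (Keep P0 P1 P2 P3 P4)]]]]]],Row P0 P4 P1
P2 []]]]]]]]]]]],Row P1 P3 P0 P2 [Row P0 P3 P1 P2 [Row P2 P0 P0 P4 [Row P1 P3 P0 P4 [Row P0 P3 P1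
P4 [Col P3 P2 P3 P4 [Known (Keep P0 P3 P2 P4 P1),Known (Flip P4 P2 P3 P0 P1)]]],Known (Flip P0 P2
P4 P3 P1)]]]]],Row P0 P2 P1 P3 [Known (Keep P0 P2 P4 P3 P1),Known (Keep P0 P2 P4 P3 P1)]],Row P1 P2
P0 P2 [Col P2 P1 P0 P4 [Row P1 P2 P2 P3 [Known (Flip P2 P1 P3 P4 P0)]]]]]]],Row P3 P4 P1 P2 [Known
(Flip P4 P3 P1 P0 P2)],Col P1 P0 P3 P4 [Row P3 P4 P1 P2 [Row P4 P3 P0 P1 [Row P4 P3 P1 P2 [Row P2
P0 P0 P1 [Row P2 P0 P1 P3 [Known (Keep P2 P0 P4 P3 P1),Known (Keep P2 P0 P4 P3 P1)]],Row P2 P1 P0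
P1 [Row P2 P1 P1 P3 [Row P1 P0 P3 P4 [Row P3 P2 P2 P4 [Col P1 P2 P1 P3 [Row P1 P2 P2 P4 [Known
(Keep P1 P2 P0 P3 P4),Row P3 P2 P0 P2 [Row P0 P4 P1 P4 [Row P4 P0 P0 P3 [Row P2 P0 P1 P3 [Col P2 P0
P1 P4 [Row P4 P2 P0 P3 [Col P4 P2 P1 P3 [Row P2 P0 P0 P3 [Row P3 P1 P0 P1 [Row P1 P4 P0 P3 [Row P0
P3 P2 P3 [Row P0 P3 P3 P4 [Row P1 P4 P0 P4 []]]]]]]]]]],Row P1 P3 P0 P2 [Col P1 P3 P2 P4 [Row P1 P3
P0 P3 [Row P2 P0 P3 P4 [Row P3 P1 P0 P4 [Row P2 P0 P0 P3 []]]]]]]]]]],Col P3 P0 P2 P4 [Row P3 P0 P0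
P4 [Col P2 P0 P3 P4 [Row P1 P2 P0 P2 [Col P4 P2 P1 P3 [Row P4 P2 P0 P2 [Known (Flip P2 P4 P0 P1
P3)]]]]]]],Known (Flip P1 P2 P3 P4 P0)]]]]]]],Known (Flip P3 P2 P4 P1 P0)],Row P2 P3 P1 P4 [Known
(Keep P2 P3 P0 P1 P4)],Row P1 P0 P2 P3 [Row P2 P3 P1 P4 [Col P3 P2 P0 P1 [Row P3 P4 P2 P4 [Row P3
P2 P0 P1 [Col P0 P4 P0 P1 [Row P0 P4 P1 P4 [Row P1 P0 P3 P4 [Row P1 P3 P2 P4 [Row P1 P3 P3 P4 [Row
P1 P4 P2 P3 [Col P4 P0 P1 P4 [Row P4 P2 P0 P3 [Row P4 P2 P2 P3 [Known (Keep P4 P2 P1 P0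
P3)]]]]]],Row P3 P4 P1 P4 [Col P4 P3 P2 P4 [Row P4 P0 P0 P3 [Row P4 P0 P0 P1 [Row P4 P3 P2 P3 [Row
P1 P2 P0 P2 [Row P1 P4 P0 P2 [Col P1 P4 P0 P3 [Row P4 P2 P0 P1 [Row P4 P2 P0 P3 [Row P1 P4 P2 P4
[Row P2 P1 P1 P3 [Row P0 P3 P2 P3 [Row P0 P3 P3 P4 [Row P2 P0 P1 P4 [Row P2 P0 P0 P4 [Row P3 P1 P0
P1 []]]]]]]]]]],Row P3 P0 P2 P4 [Col P3 P0 P1 P4 [Row P1 P4 P2 P4 [Row P3 P0 P0 P2 [Row P0 P3 P1 P4
[]]]]]]],Known (Flip P0 P4 P1 P3 P2)]]],Known (Keep P3 P4 P2 P0 P1)]],Known (Keep P0 P4 P3 P2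
P1)]],Col P1 P4 P0 P1 [Row P1 P4 P0 P4 [Known (Flip P4 P1 P2 P3 P0),Known (Keep P1 P4 P3 P2
P0)]]],Row P3 P4 P1 P2 [Known (Flip P4 P3 P1 P0 P2)],Row P1 P0 P3 P4 [Row P3 P0 P2 P4 [Row P3 P4 P1
P2 [Row P4 P3 P0 P1 [Col P1 P3 P2 P4 [Row P4 P2 P2 P3 [Row P4 P2 P0 P3 [Known (Keep P4 P2 P1 P0
P3),Known (Keep P4 P2 P1 P0 P3)],Col P4 P0 P1 P2 [Row P2 P4 P3 P4 [Row P2 P4 P0 P3 [Known (Keep P2
P4 P1 P0 P3),Known (Keep P2 P4 P1 P0 P3)]]]]]]]]]]]]]]"

definition "cert_final =
 Row P0 P1 P2 P3 [Row P0 P1 P1 P3 [Row P1 P2 P2 P3 [Row P1 P2 P3 P4 [Known (Keep P1 P2 P3 P0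
P4),Known (Keep P1 P2 P3 P4 P0),Known (Flip P2 P1 P0 P4 P3)],Row P1 P2 P3 P4 [Known (Flip P2 P1 P0
P3 P4),Known (Keep P1 P2 P4 P0 P3),Known (Keep P1 P2 P4 P3 P0)],Row P1 P2 P2 P4 [Known (Flip P2 P1
P0 P3 P4)],Row P1 P2 P2 P4 [Known (Flip P2 P1 P0 P4 P3),Known (Flip P2 P1 P0 P3 P4)]],Row P0 P1 P3
P4 [Known (Keep P0 P1 P3 P2 P4),Known (Keep P0 P1 P3 P4 P2),Known (Flip P1 P0 P2 P4 P3)],Row P0 P1
P3 P4 [Known (Flip P1 P0 P2 P3 P4),Known (Keep P0 P1 P4 P2 P3),Known (Keep P0 P1 P4 P3 P2)],Row P0
P1 P1 P4 [Known (Flip P1 P0 P2 P3 P4)],Row P0 P1 P1 P4 [Known (Flip P1 P0 P2 P4 P3),Known (Flip P1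
P0 P2 P3 P4)]],Row P0 P1 P1 P4 [Row P0 P1 P3 P4 [Row P2 P3 P1 P3 [Row P2 P3 P3 P4 [Known (Keep P2
P3 P0 P1 P4),Known (Flip P3 P2 P1 P0 P4),Known (Flip P3 P2 P1 P0 P4)],Row P2 P3 P3 P4 [Known (Keep
P2 P3 P0 P1 P4),Row P3 P2 P1 P4 [Row P3 P2 P2 P4 [Known (Keep P3 P2 P0 P1 P4),Known (Flip P2 P3 P1
P0 P4)],Col P1 P0 P2 P3 [Row P1 P0 P2 P3 [Row P3 P2 P1 P2 [Known (Keep P3 P2 P0 P1 P4)],Known (Keep
P1 P0 P3 P4 P2)]]],Known (Flip P3 P2 P4 P1 P0)],Row P2 P3 P1 P4 [Known (Keep P2 P3 P0 P1 P4)],Row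
P1 P0 P2 P3 [Row P1 P0 P3 P4 [Row P2 P3 P1 P4 [Known (Keep P2 P3 P4 P0 P1)],Known (Keep P1 P0 P2 P4
P3)]]],Known (Keep P0 P1 P2 P3 P4),Known (Keep P0 P1 P4 P2 P3)],Row P0 P1 P3 P4 [Known (Keep P0 P1
P2 P3 P4),Known (Keep P0 P1 P2 P3 P4),Known (Keep P0 P1 P2 P3 P4)],Row P0 P1 P3 P4 [Known (Flip P1
P0 P3 P2 P4),Known (Keep P0 P1 P4 P2 P3),Row P1 P4 P2 P3 [Row P1 P4 P3 P4 [Known (Flip P4 P1 P0 P2
P3),Known (Keep P1 P4 P2 P0 P3),Known (Flip P4 P1 P0 P2 P3)],Row P1 P4 P2 P4 [Known (Flip P4 P1 P0
P3 P2),Known (Keep P1 P4 P3 P0 P2)],Row P1 P4 P2 P4 [Known (Keep P1 P4 P3 P2 P0)]],Known (Keep P0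
P1 P4 P2 P3)],Row P0 P1 P1 P3 [Known (Flip P1 P0 P4 P2 P3),Known (Flip P1 P0 P4 P3 P2)],Row P0 P1
P1 P3 [Known (Flip P1 P0 P3 P2 P4),Row P2 P3 P3 P4 [Row P2 P3 P1 P4 [Known (Keep P2 P3 P0 P1
P4),Known (Keep P2 P3 P0 P1 P4)],Row P2 P3 P1 P4 [Col P1 P0 P2 P4 [Row P1 P0 P3 P4 [Known (Keep P1
P0 P2 P3 P4),Known (Keep P1 P0 P2 P3 P4)],Col P0 P4 P2 P3 [Row P0 P4 P2 P3 [Known (Flip P4 P0 P1 P2
P3),Known (Keep P0 P4 P3 P1 P2)]]],Known (Keep P2 P3 P0 P1 P4),Known (Keep P2 P3 P4 P0 P1)],Row P2
P3 P1 P3 [Known (Flip P3 P2 P1 P0 P4),Row P1 P4 P0 P4 [Row P1 P4 P3 P4 [Col P4 P2 P3 P4 [Row P4 P2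
P2 P3 [Known (Keep P4 P2 P0 P1 P3),Known (Keep P4 P2 P0 P1 P3),Row P3 P0 P0 P2 [Known (Keep P3 P0
P1 P4 P2),Row P0 P2 P2 P3 [Row P0 P2 P3 P4 [Known (Keep P0 P2 P3 P1 P4),Row P4 P1 P2 P3 [Row P4 P1
P1 P3 [Known (Keep P4 P1 P0 P2 P3)]],Known (Keep P0 P2 P1 P4 P3)],Row P0 P2 P2 P4 [Row P1 P3 P0 P3
[Row P1 P3 P2 P3 [Row P2 P0 P0 P4 [Row P2 P0 P0 P3 [Known (Flip P0 P2 P3 P1 P4),Col P3 P1 P3 P4
[Col P1 P0 P1 P2 [Known (Keep P3 P1 P0 P2 P4),Col P1 P0 P1 P4 [Col P0 P3 P0 P4 [Known (Keep P1 P0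
P3 P2 P4),Row P0 P3 P1 P3 [Row P0 P3 P3 P4 [Row P1 P0 P0 P4 [Row P3 P1 P1 P4 [Row P0 P4 P2 P4 [Row
P0 P4 P3 P4 [Row P1 P2 P2 P3 [Known (Keep P2 P1 P3 P0 P4),Row P1 P2 P2 P4 [Row P2 P1 P1 P4 [Row P3
P2 P2 P4 [Found (Keep P0 P1 P2 P3 P4)]]]],Known (Keep P0 P4 P2 P1 P3)],Known (Keep P4 P0 P2 P3
P1)]]]]]]]]]]],Known (Keep P1 P3 P0 P4 P2)],Row P1 P3 P0 P2 [Known (Keep P1 P3 P4 P2 P0),Row P2 P4
P0 P3 [Row P2 P4 P0 P4 [Known (Keep P2 P4 P1 P3 P0)]]]]]]]],Row P4 P2 P1 P3 [Col P2 P4 P0 P1 [Row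
P1 P0 P2 P3 [Row P1 P0 P0 P3 [Known (Flip P0 P1 P2 P4 P3),Known (Keep P1 P0 P4 P2 P3)]]],Known
(Keep P4 P2 P3 P0 P1)]],Known (Flip P4 P1 P3 P2 P0),Known (Keep P1 P4 P0 P2 P3)],Row P1 P4 P0 P3
[Known (Keep P1 P4 P2 P3 P0),Row P3 P2 P0 P4 [Row P0 P3 P1 P4 [Row P0 P3 P2 P4 [Known (Keep P0 P3
P2 P1 P4),Known (Keep P0 P3 P2 P4 P1)]],Row P3 P2 P0 P2 [Known (Flip P2 P3 P4 P1 P0),Known (Keep P3
P2 P1 P4 P0)]]]]]]]],Row P0 P1 P1 P3 [Row P0 P1 P3 P4 [Known (Keep P0 P1 P3 P2 P4),Row P2 P4 P1 P4
[Row P2 P4 P3 P4 [Known (Flip P4 P2 P1 P0 P3),Known (Keep P2 P4 P0 P1 P3),Known (Flip P4 P2 P1 P0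
P3)],Row P2 P4 P3 P4 [Row P4 P2 P1 P3 [Row P4 P2 P2 P3 [Known (Keep P4 P2 P0 P1 P3),Known (Flip P2
P4 P1 P0 P3)],Col P1 P0 P2 P4 [Row P1 P0 P2 P4 [Row P4 P2 P1 P2 [Known (Keep P4 P2 P0 P1 P3)],Known
(Keep P1 P0 P4 P3 P2)]]],Known (Flip P4 P2 P3 P1 P0),Known (Keep P2 P4 P0 P1 P3)],Row P2 P4 P1 P3
[Known (Keep P2 P4 P0 P1 P3)],Row P1 P0 P2 P4 [Row P1 P0 P3 P4 [Row P2 P4 P1 P3 [Known (Keep P2 P4
P3 P0 P1)],Known (Keep P1 P0 P2 P3 P4)]]],Known (Keep P0 P1 P2 P4 P3)],Row P0 P1 P3 P4 [Known (Keep
P0 P1 P2 P4 P3),Known (Keep P0 P1 P2 P4 P3),Known (Keep P0 P1 P2 P4 P3)],Row P0 P1 P3 P4 [Row P1 P3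
P2 P3 [Row P1 P3 P3 P4 [Known (Keep P1 P3 P2 P0 P4),Known (Flip P3 P1 P0 P2 P4),Known (Flip P3 P1
P0 P2 P4)],Row P1 P3 P2 P4 [Known (Flip P3 P1 P0 P4 P2)],Row P1 P3 P2 P4 [Known (Keep P1 P3 P4 P0
P2),Known (Keep P1 P3 P4 P2 P0)]],Known (Keep P0 P1 P3 P2 P4),Known (Flip P1 P0 P4 P2 P3),Known
(Keep P0 P1 P3 P2 P4)],Row P0 P1 P1 P4 [Known (Flip P1 P0 P3 P2 P4),Known (Flip P1 P0 P3 P4
P2)],Row P0 P1 P1 P4 [Known (Flip P1 P0 P4 P2 P3),Row P2 P4 P3 P4 [Row P2 P4 P1 P4 [Known (Flip P4
P2 P1 P0 P3),Row P1 P3 P0 P3 [Row P1 P3 P3 P4 [Known (Keep P1 P3 P0 P2 P4),Col P3 P2 P3 P4 [Row P3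
P2 P1 P4 [Col P2 P3 P0 P1 [Row P1 P0 P2 P4 [Row P1 P0 P0 P4 [Known (Keep P1 P0 P3 P2 P4),Known
(Flip P0 P1 P2 P3 P4)]]],Known (Keep P3 P2 P0 P1 P4),Known (Keep P3 P2 P4 P0 P1)],Row P3 P2 P2 P4
[Known (Keep P3 P2 P0 P1 P4),Row P4 P0 P0 P2 [Known (Keep P4 P0 P1 P3 P2),Row P0 P2 P2 P4 [Row P0
P2 P3 P4 [Row P3 P1 P2 P4 [Row P3 P1 P1 P4 [Known (Keep P3 P1 P0 P2 P4)]],Known (Keep P0 P2 P1 P3
P4),Known (Keep P0 P2 P4 P1 P3)],Row P0 P2 P2 P3 [Row P1 P4 P0 P4 [Row P1 P4 P2 P4 [Row P2 P0 P0 P3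
[Row P2 P0 P0 P4 [Known (Flip P0 P2 P4 P1 P3),Col P3 P1 P3 P4 [Row P3 P1 P1 P4 [Known (Keep P3 P1
P2 P0 P4),Row P0 P4 P2 P4 [Row P0 P4 P1 P4 [Known (Flip P4 P0 P1 P3 P2),Row P1 P0 P0 P2 [Row P1 P0
P0 P3 [Row P1 P0 P0 P4 [Row P2 P3 P3 P4 [Row P3 P4 P2 P4 [Row P1 P2 P2 P3 [Known (Keep P2 P1 P3 P4
P0),Row P0 P3 P2 P3 [Row P0 P3 P3 P4 [Known (Keep P0 P3 P2 P1 P4),Row P1 P2 P2 P4 [Row P3 P0 P0 P4
[Found (Keep P0 P1 P2 P4 P3)]]],Known (Keep P3 P0 P1 P2 P4)]],Known (Keep P3 P4 P1 P0
P2)]]]]]]]]]]],Known (Keep P1 P4 P0 P3 P2)],Row P1 P4 P0 P2 [Known (Keep P1 P4 P3 P2 P0),Row P2 P3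
P0 P4 [Row P2 P3 P0 P3 [Known (Keep P2 P3 P1 P4 P0)]]]]]]]]],Known (Flip P3 P1 P4 P2 P0)],Row P1 P3
P0 P4 [Known (Keep P1 P3 P2 P4 P0),Row P4 P2 P0 P3 [Row P0 P4 P1 P3 [Row P0 P4 P2 P3 [Known (Keep
P0 P4 P2 P1 P3),Known (Keep P0 P4 P2 P3 P1)]],Row P4 P2 P0 P2 [Known (Flip P2 P4 P3 P1 P0),Known
(Keep P4 P2 P1 P3 P0)]]]],Known (Keep P2 P4 P3 P0 P1)],Row P2 P4 P1 P3 [Known (Keep P2 P4 P0 P1
P3),Known (Keep P2 P4 P0 P1 P3)],Row P2 P4 P1 P3 [Col P1 P0 P2 P3 [Row P1 P0 P3 P4 [Known (Keep P1
P0 P2 P4 P3),Known (Keep P1 P0 P2 P4 P3)],Col P0 P3 P2 P4 [Row P0 P3 P2 P4 [Known (Flip P3 P0 P1 P2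
P4),Known (Keep P0 P3 P4 P1 P2)]]],Known (Keep P2 P4 P0 P1 P3)]]]],Row P3 P0 P2 P4 [Row P3 P0 P1 P4
[Known (Keep P3 P0 P1 P2 P4),Known (Keep P3 P0 P1 P4 P2),Known (Flip P0 P3 P2 P4 P1)],Row P3 P0 P1
P4 [Known (Keep P3 P0 P1 P2 P4),Row P0 P1 P1 P2 [Row P0 P1 P2 P4 [Known (Flip P1 P0 P3 P4 P2)],Row
P0 P1 P2 P4 [Known (Keep P0 P1 P4 P2 P3),Known (Keep P0 P1 P4 P3 P2)]],Known (Keep P3 P0 P1 P2
P4),Known (Flip P0 P3 P4 P2 P1)],Row P0 P1 P2 P4 [Row P0 P1 P1 P2 [Known (Flip P1 P0 P3 P4
P2),Known (Keep P0 P1 P4 P3 P2)]],Row P3 P0 P1 P2 [Known (Keep P3 P0 P1 P2 P4),Known (Keep P3 P0 P1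
P4 P2)]],Row P0 P1 P2 P4 [Col P0 P1 P3 P4 [Known (Keep P0 P1 P3 P2 P4),Row P1 P4 P2 P3 [Row P1 P4
P3 P4 [Known (Keep P1 P4 P2 P0 P3),Known (Flip P4 P1 P0 P2 P3)],Row P1 P4 P3 P4 [Known (Flip P4 P1
P0 P3 P2),Known (Keep P1 P4 P2 P3 P0)],Row P1 P4 P2 P4 [Known (Flip P4 P1 P0 P3 P2),Known (Keep P1
P4 P3 P0 P2)]]],Row P0 P1 P1 P2 [Known (Keep P0 P1 P4 P3 P2),Known (Keep P0 P1 P4 P3 P2)]],Row P0
P1 P1 P2 [Row P0 P1 P2 P4 [Known (Keep P0 P1 P3 P4 P2),Row P3 P4 P1 P4 [Row P3 P4 P2 P4 [Row P4 P3
P1 P2 [Row P4 P3 P2 P3 [Known (Keep P4 P3 P0 P1 P2),Known (Flip P3 P4 P1 P0 P2)],Col P1 P0 P3 P4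
[Row P1 P0 P3 P4 [Row P4 P3 P1 P3 [Known (Keep P4 P3 P0 P1 P2)],Known (Keep P1 P0 P4 P2
P3)]]],Known (Flip P4 P3 P2 P1 P0),Known (Keep P3 P4 P0 P1 P2)],Row P3 P4 P2 P4 [Known (Flip P4 P3
P1 P0 P2),Known (Keep P3 P4 P0 P1 P2),Known (Flip P4 P3 P1 P0 P2)],Row P3 P4 P1 P2 [Known (Keep P3
P4 P0 P1 P2)],Row P1 P0 P3 P4 [Row P1 P0 P2 P4 [Row P3 P4 P1 P2 [Known (Keep P3 P4 P2 P0 P1)],Known
(Keep P1 P0 P3 P2 P4)]]]],Row P0 P1 P2 P4 [Known (Flip P1 P0 P4 P3 P2),Known (Keep P0 P1 P2 P3
P4)],Row P0 P1 P2 P4 [Known (Keep P0 P1 P3 P4 P2),Known (Keep P0 P1 P3 P4 P2)]]]"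

lemma check_1: "check reps [] (start pattern_1) empty cert_1"
  by code_simp

lemma check_2: "check reps [pattern_1] (start pattern_2) empty cert_2"
  by code_simp

lemma check_3: "check reps [pattern_2, pattern_1] (start pattern_3) empty cert_3"
  by code_simp

lemma check_4: "check reps [pattern_3, pattern_2, pattern_1] (start pattern_4) empty cert_4"
  by code_simp

lemma check_5: "check reps [pattern_4, pattern_3, pattern_2, pattern_1] (start pattern_5) empty cert_5"
  by code_simp

lemma check_final: "check reps [pattern_5, pattern_4, pattern_3, pattern_2, pattern_1] empty empty cert_final"
  by code_simp

text \<open>
  The stages in turn, each with the configurations of the previous ones excluded.
\<close>

lemma cubic_realises_reps:
  assumes "cubic E" shows "realises E reps"
proof -
  have pat: "(P0, P1) \<notin> set T \<and> distinct T" if "T \<in> {pattern_1, pattern_2, pattern_3, pattern_4, pattern_5}" for T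
    using that by (auto simp: pattern_1_def pattern_2_def pattern_3_def pattern_4_def pattern_5_def)
  note step = avoids_or_realises[OF assms]
  have "avoids E []" by (simp add: avoids_def)
  then consider "realises E reps" | "avoids E [pattern_1]" using step check_1 pat by blast
  then consider "realises E reps" | "avoids E [pattern_2, pattern_1]" using step check_2 pat by cases blast+
  then consider "realises E reps" | "avoids E [pattern_3, pattern_2, pattern_1]" using step check_3 pat by cases blast+
  then consider "realises E reps" | "avoids E [pattern_4, pattern_3, pattern_2, pattern_1]"
    using step check_4 pat by cases blast+
  then consider "realises E reps" | "avoids E [pattern_5, pattern_4, pattern_3, pattern_2, pattern_1]"
    using step check_5 pat by cases blast+
  then show ?thesis using realises_if_check[OF assms _ check_final] by cases blast+
qed

lemma valid_reps: "list_all valid reps" 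
  by code_simp

text \<open>
  A frame of \<open>H\<close> induces a cubic relation; the symmetry that turns it into a relation in the list is
  absorbed into the frame.
\<close>

lemma iso_to_representative:
  assumes "H \<in> graphs_with 5 5 4 (5^2 + 5 + 2)"
  shows "\<exists>t\<in>set reps. graph_iso (graph_of t) H"
proof -
  interpret near_moore "pverts H" "adjacent H" using assms by (rule graphs_with_D)
  have H: "pair_graph H" using assms by (simp add: graphs_with_def)
  obtain u v where uv: "u \<in> pverts H" "v \<in> pverts H" "remote (adjacent H) u v"
    using graphs_with_D(2)[OF assms] by blast
  have "card {y. adjacent H u y} = card (UNIV :: pt set)" using degree[OF uv(1)] by (simp add: card_pt)
  then obtain a :: "pt \<Rightarrow> 'a" where "bij_betw a UNIV {y. adjacent H u y}"
    using finite_nbrs by (metis finite finite_same_card_bij)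
  then obtain p where p: "frame p" using frame_exists[OF uv] by blast
  from cubic_realises_reps[OF frame_cubic[OF p]] obtain f t where f: "symmetry f" and t: "t \<in> set reps"
    and sub: "\<forall>x\<in>set cells. \<forall>y\<in>set (get t x). induced p (f x) (f y)"
    by (auto simp: realises_def)
  obtain q where q: "frame q" "induced q = (\<lambda>x y. induced p (f x) (f y))"
    using frame_symmetry[OF p f] by blast
  have "valid t" using t valid_reps by (simp add: list_all_iff)
  then interpret t: cubic "rel_of t" by (rule valid_cubic)
  have "rel_of t = induced q"
  proof (rule cubic_eqI[OF t.cubic_axioms frame_cubic[OF q(1)]])
    fix x y assume xy: "rel_of t x y"
    then have "x \<in> set cells" using t.off_diag[OF xy] by (simp add: set_cells)
    with xy sub show "induced q x y" by (simp add: q(2) rel_of_def)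
  qed
  then have "graph_iso (graph_of t) H"
    using graph_iso_graph_of[OF \<open>valid t\<close> H frameD(1)[OF q(1)]] frame_adj[OF q(1)] by simp
  with t show ?thesis by blast
qed

section \<open>The seven graphs\<close>

text \<open>
  The length of each list is the number of ordered pairs at distance 4, and an entry different from 0
  is the order of the stabiliser of \<open>(U, W)\<close>. An entry 0 belongs to a pair in another orbit. For \<open>rep_3\<close>
  this is \<open>(W, U)\<close>; for \<open>rep_4\<close> there are twelve such pairs.
\<close>

lemma tallies:
  "tally rep_0 rep_0 = [2, 2]"
  "tally rep_1 rep_1 = [2, 2]"
  "tally rep_2 rep_2 = [5, 5]"
  "tally rep_3 rep_3 = [10, 0]"
  by code_simp+

lemma tally_4: "tally rep_4 rep_4 = [12, 12, 12, 12, 0, 0, 0, 0, 0, 0, 0, 0, 0, 0, 0, 0]"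
  by code_simp

lemma tally_5: "tally rep_5 rep_5 = replicate 16 4"
  by code_simp

lemma tally_6: "tally rep_6 rep_6 = replicate 32 60"
  by code_simp

lemma cross_tallies:
  "tally rep_0 rep_1 = [0, 0]"
  "tally rep_2 rep_3 = [0, 0]"
  by code_simp+

text \<open>
  Relative to the twelve pairs just mentioned, the graph of \<open>rep_4\<close> has the relation \<open>rep_7\<close>.
\<close>

lemma tally_7_4: "tally rep_7 rep_4 = [0, 0, 0, 0, 4, 4, 4, 4, 4, 4, 4, 4, 4, 4, 4, 4]"
  by code_simp

theorem mainTheorem4:
  shows "\<exists>Gs :: nat pair_pre_digraph list.
    length Gs = 7 \<and>
    set Gs \<subseteq> graphs_with 5 5 4 (5^2 + 5 + 2) \<and>
    (\<forall>i < 7. \<forall>j < 7. i \<noteq> j \<longrightarrow> \<not> graph_iso (Gs ! i) (Gs ! j)) \<and>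
    (\<forall>H :: 'a pair_pre_digraph. H \<in> graphs_with 5 5 4 (5^2 + 5 + 2) \<longrightarrow>
      (\<exists>G \<in> set Gs. graph_iso G H)) \<and>
    map (\<lambda>G. order (graph_AutoGroup G)) Gs = [4, 4, 10, 10, 48, 64, 1920]"
proof -
  define ts where "ts = [rep_0, rep_1, rep_2, rep_3, rep_4, rep_5, rep_6]"
  let ?Gs = "map graph_of ts"
  let ?orders = "[4, 4, 10, 10, 48, 64, 1920] :: nat list"
  have valid: "valid t" if "t \<in> set reps" for t using valid_reps that by (simp add: list_all_iff)
  have reps: "set reps = insert rep_7 (set ts)" by (auto simp: reps_def ts_def)
  have len: "length ts = 7" by (simp add: ts_def)
  have valid_ts: "valid (ts ! i)" if "i < 7" for i
    using that nth_mem[of i ts] by (intro valid) (simp add: reps len)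
  have orders: "map (\<lambda>G. order (graph_AutoGroup G)) ?Gs = ?orders"
    using valid by (simp add: order_graph_of reps ts_def tallies tally_4 tally_5 tally_6 sum_list_replicate)
  have apart: "\<not> graph_iso (graph_of rep_0) (graph_of rep_1)" "\<not> graph_iso (graph_of rep_2) (graph_of rep_3)"
    using valid by (simp_all add: graph_iso_of_tally cross_tallies reps ts_def)
  have swap: "graph_iso (graph_of t') (graph_of t)"
    if "graph_iso (graph_of t) (graph_of t')" "t \<in> set reps" for t t'
    using digraph_iso_swap[OF _ that(1)] pair_graph_graph_of[OF valid[OF that(2)]]
    by (simp add: wf_digraph_wp_iff pair_graph_def pair_digraph_def pair_fin_digraph_def)
  have distinct: "\<not> graph_iso (?Gs ! i) (?Gs ! j)" if ij: "i < 7" "j < 7" "i \<noteq> j" for i j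
  proof
    assume iso: "graph_iso (?Gs ! i) (?Gs ! j)"
    have "order (graph_AutoGroup (?Gs ! i)) = order (graph_AutoGroup (?Gs ! j))"
      using iso ij len by (intro order_AutoGroup_iso) (simp_all add: pair_graph_graph_of valid_ts)
    then have "?orders ! i = ?orders ! j"
      using ij len unfolding orders[symmetric] by simp
    moreover have "i \<in> {0, 1, 2, 3, 4, 5, 6}" "j \<in> {0, 1, 2, 3, 4, 5, 6}" using ij by auto
    \<comment> \<open>only these positions of the list of orders carry equal entries\<close>
    ultimately have "(i, j) \<in> {(0, 1), (1, 0), (2, 3), (3, 2)}" using ij(3) by auto
    then show False using iso apart swap by (auto simp: ts_def reps)
  qed
  have "\<exists>G\<in>set ?Gs. graph_iso G H" if H: "H \<in> graphs_with 5 5 4 (5^2 + 5 + 2)" for H :: "'a pair_pre_digraph"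
  proof -
    obtain t where t: "t \<in> set reps" "graph_iso (graph_of t) H" using iso_to_representative[OF H] by blast
    show ?thesis
    proof (cases "t = rep_7")
      case True
      have "graph_iso (graph_of rep_7) (graph_of rep_4)"
        using valid by (simp add: graph_iso_of_tally tally_7_4 reps ts_def)
      then have "graph_iso (graph_of rep_4) (graph_of rep_7)" using swap by (simp add: reps)
      then have "graph_iso (graph_of rep_4) H" using t(2) True digraph_iso_trans by blast
      then show ?thesis by (auto simp: ts_def)
    next
      case False
      then show ?thesis using t by (auto simp: reps)
    qed
  qed
  moreover have "set ?Gs \<subseteq> graphs_with 5 5 4 (5^2 + 5 + 2)"
    using graph_of_mem valid by (auto simp: reps)
  ultimately show ?thesis
    using distinct orders by (intro exI[of _ ?Gs]) (simp add: ts_def)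
qed

end
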